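(* Let $X$ be a connected topological space which is locally path-connected and semi-locally simply-connected, and let $x\in X$ be a base point. The functor $\mathrm{Fib}_x$ induces an equivalence between the category of finite covers of $X$ and the category of finite sets with a continuous left action of $\widehat{\pi_1(X,x)}$. Connected covers correspond to finite $\widehat{\pi_1(X,x)}$-sets with transitive action, and Galois covers correspond to coset spaces of open normal subgroups.
   Context: A cover of $X$ is a continuous map $p:Y\to X$ such that every $x\in X$ has a neighbourhood $U$ with $p^{-1}(U)=\bigsqcup_{y\in p^{-1}(x)}V_y$, each $V_y$ open (with $y\in V_y$) and mapped homeomorphically onto $U$; it is finite if its fibres are finite. $\mathrm{Fib}_x$ sends a cover to the fibre $p^{-1}(x)$ with the monodromy action $[\gamma]\cdot y=\widetilde{\gamma}_y(1)$, where $\widetilde{\gamma}_y$ is the unique lift of $\gamma$ starting at $y$; the product $[\delta][\gamma]$ in $\pi_1(X,x)$ means "first $\gamma$, then $\delta$", so this is a left action. For a finite cover this action factors through a finite quotient of $\pi_1(X,x)$ and hence gives an action of $\widehat{\pi_1(X,x)}$. For a group $G$, $\widehat{G}=\varprojlim G/N$ over normal subgroups $N$ of finite index, with its profinite topology. A cover is Galois if $Y$ is connected and the induced map $Y/\operatorname{Aut}(Y|X)\to X$ is a homeomorphism, where $\operatorname{Aut}(Y|X)$ is the group of homeomorphisms of $Y$ over $X$. *)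

theory Defs
  imports "HOL-Analysis.Analysis" "HOL-Algebra.Group_Action" "HOL-Algebra.Product_Groups" "HOL-Algebra.Left_Coset"
begin

record ('o, 'm) cat =
  Ob :: "'o set"
  Arr :: "'o \<Rightarrow> 'o \<Rightarrow> 'm set"
  Ident :: "'o \<Rightarrow> 'm"
  Cmp :: "'o \<Rightarrow> 'o \<Rightarrow> 'o \<Rightarrow> 'm \<Rightarrow> 'm \<Rightarrow> 'm"

text \<open>\<open>Cmp C A B D g f\<close> is the composite of \<open>f : A \<rightarrow> B\<close> followed by \<open>g : B \<rightarrow> D\<close>.
  Hom-sets of different pairs of objects need not be disjoint, so composition receives the objects.\<close>

definition category :: "('o, 'm) cat \<Rightarrow> bool" where
  "category C \<longleftrightarrow>
     (\<forall>A\<in>Ob C. Ident C A \<in> Arr C A A) \<and>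
     (\<forall>A\<in>Ob C. \<forall>B\<in>Ob C. \<forall>D\<in>Ob C. \<forall>f\<in>Arr C A B. \<forall>g\<in>Arr C B D. Cmp C A B D g f \<in> Arr C A D) \<and>
     (\<forall>A\<in>Ob C. \<forall>B\<in>Ob C. \<forall>f\<in>Arr C A B.
        Cmp C A B B (Ident C B) f = f \<and> Cmp C A A B f (Ident C A) = f) \<and>
     (\<forall>A\<in>Ob C. \<forall>B\<in>Ob C. \<forall>D\<in>Ob C. \<forall>E\<in>Ob C.
        \<forall>f\<in>Arr C A B. \<forall>g\<in>Arr C B D. \<forall>h\<in>Arr C D E.
          Cmp C A D E h (Cmp C A B D g f) = Cmp C A B E (Cmp C B D E h g) f)"

record ('o, 'm, 'p, 'n) fctr =
  on_ob :: "'o \<Rightarrow> 'p"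
  on_arr :: "'o \<Rightarrow> 'o \<Rightarrow> 'm \<Rightarrow> 'n"

definition is_functor ::
    "('o, 'm) cat \<Rightarrow> ('p, 'n) cat \<Rightarrow> ('o, 'm, 'p, 'n) fctr \<Rightarrow> bool" where
  "is_functor C D F \<longleftrightarrow>
     category C \<and> category D \<and>
     (\<forall>A\<in>Ob C. on_ob F A \<in> Ob D) \<and>
     (\<forall>A\<in>Ob C. \<forall>B\<in>Ob C. \<forall>f\<in>Arr C A B. on_arr F A B f \<in> Arr D (on_ob F A) (on_ob F B)) \<and>
     (\<forall>A\<in>Ob C. on_arr F A A (Ident C A) = Ident D (on_ob F A)) \<and>
     (\<forall>A\<in>Ob C. \<forall>B\<in>Ob C. \<forall>E\<in>Ob C. \<forall>f\<in>Arr C A B. \<forall>g\<in>Arr C B E.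
        on_arr F A E (Cmp C A B E g f) =
        Cmp D (on_ob F A) (on_ob F B) (on_ob F E) (on_arr F B E g) (on_arr F A B f))"

definition id_fctr :: "('o, 'm, 'o, 'm) fctr" where
  "id_fctr = \<lparr>on_ob = (\<lambda>A. A), on_arr = (\<lambda>A B f. f)\<rparr>"

definition comp_fctr ::
    "('p, 'n, 'q, 'k) fctr \<Rightarrow> ('o, 'm, 'p, 'n) fctr \<Rightarrow> ('o, 'm, 'q, 'k) fctr" where
  "comp_fctr G F =
     \<lparr>on_ob = (\<lambda>A. on_ob G (on_ob F A)),
      on_arr = (\<lambda>A B f. on_arr G (on_ob F A) (on_ob F B) (on_arr F A B f))\<rparr>"

definition iso_arr :: "('o, 'm) cat \<Rightarrow> 'o \<Rightarrow> 'o \<Rightarrow> 'm \<Rightarrow> bool" where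
  "iso_arr C A B f \<longleftrightarrow>
     f \<in> Arr C A B \<and>
     (\<exists>g\<in>Arr C B A. Cmp C A B A g f = Ident C A \<and> Cmp C B A B f g = Ident C B)"

definition naturally_isomorphic ::
    "('o, 'm) cat \<Rightarrow> ('p, 'n) cat \<Rightarrow> ('o, 'm, 'p, 'n) fctr \<Rightarrow> ('o, 'm, 'p, 'n) fctr \<Rightarrow> bool" where
  "naturally_isomorphic C D F G \<longleftrightarrow>
     (\<exists>\<eta>. (\<forall>A\<in>Ob C. iso_arr D (on_ob F A) (on_ob G A) (\<eta> A)) \<and>
          (\<forall>A\<in>Ob C. \<forall>B\<in>Ob C. \<forall>f\<in>Arr C A B.
             Cmp D (on_ob F A) (on_ob F B) (on_ob G B) (\<eta> B) (on_arr F A B f) =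
             Cmp D (on_ob F A) (on_ob G A) (on_ob G B) (on_arr G A B f) (\<eta> A)))"

definition is_equivalence ::
    "('o, 'm) cat \<Rightarrow> ('p, 'n) cat \<Rightarrow> ('o, 'm, 'p, 'n) fctr \<Rightarrow> bool" where
  "is_equivalence C D F \<longleftrightarrow>
     is_functor C D F \<and>
     (\<exists>G. is_functor D C G \<and>
          naturally_isomorphic C C (comp_fctr G F) id_fctr \<and>
          naturally_isomorphic D D (comp_fctr F G) id_fctr)"

definition loops :: "'a topology \<Rightarrow> 'a \<Rightarrow> (real \<Rightarrow> 'a) set" where
  "loops X x = {\<gamma>. pathin X \<gamma> \<and> \<gamma> 0 = x \<and> \<gamma> 1 = x}"

definition path_homotopic :: "'a topology \<Rightarrow> (real \<Rightarrow> 'a) \<Rightarrow> (real \<Rightarrow> 'a) \<Rightarrow> bool" where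
  "path_homotopic X \<gamma> \<delta> \<longleftrightarrow>
     homotopic_with (\<lambda>r. r 0 = \<gamma> 0 \<and> r 1 = \<gamma> 1) (top_of_set {0..1}) X \<gamma> \<delta>"

definition loop_rel :: "'a topology \<Rightarrow> 'a \<Rightarrow> ((real \<Rightarrow> 'a) \<times> (real \<Rightarrow> 'a)) set" where
  "loop_rel X x = {(\<gamma>, \<delta>). \<gamma> \<in> loops X x \<and> \<delta> \<in> loops X x \<and> path_homotopic X \<gamma> \<delta>}"

text \<open>First \<open>\<gamma>\<close>, then \<open>\<delta>\<close>. The library's \<open>+++\<close> is restricted to spaces given by the type class.\<close>

definition path_join :: "(real \<Rightarrow> 'a) \<Rightarrow> (real \<Rightarrow> 'a) \<Rightarrow> real \<Rightarrow> 'a" where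
  "path_join \<gamma> \<delta> = (\<lambda>t. if t \<le> 1/2 then \<gamma> (2 * t) else \<delta> (2 * t - 1))"

text \<open>The product \<open>[\<delta>][\<gamma>]\<close> is the class of \<open>path_join \<gamma> \<delta>\<close>, so that monodromy is a left action.\<close>

definition fundamental_group :: "'a topology \<Rightarrow> 'a \<Rightarrow> (real \<Rightarrow> 'a) set monoid" where
  "fundamental_group X x =
     \<lparr>carrier = loops X x // loop_rel X x,
      mult = (\<lambda>a b. \<Union>\<delta>\<in>a. \<Union>\<gamma>\<in>b. loop_rel X x `` {path_join \<gamma> \<delta>}),
      one = loop_rel X x `` {\<lambda>t. x}\<rparr>"

definition semilocally_simply_connected :: "'a topology \<Rightarrow> bool" where
  "semilocally_simply_connected X \<longleftrightarrow>
     (\<forall>y\<in>topspace X. \<exists>U. openin X U \<and> y \<in> U \<and>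
        (\<forall>\<gamma>\<in>loops (subtopology X U) y. path_homotopic X \<gamma> (\<lambda>t. y)))"

definition fin_index_normals :: "('g, 'b) monoid_scheme \<Rightarrow> 'g set set" where
  "fin_index_normals G = {N. N \<lhd> G \<and> finite (rcosets\<^bsub>G\<^esub> N)}"

text \<open>For normal subgroups \<open>N \<subseteq> M\<close>, the projection \<open>G/N \<rightarrow> G/M\<close> sends a coset \<open>A = Ng\<close> to
  \<open>Mg = MA\<close>. The inverse limit consists of the families compatible with these projections.\<close>

definition profinite_completion :: "('g, 'b) monoid_scheme \<Rightarrow> ('g set \<Rightarrow> 'g set) monoid" where
  "profinite_completion G =
     (product_group (fin_index_normals G) (\<lambda>N. G Mod N))
       \<lparr>carrier := {\<xi> \<in> carrier (product_group (fin_index_normals G) (\<lambda>N. G Mod N)).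
          \<forall>N\<in>fin_index_normals G. \<forall>M\<in>fin_index_normals G. N \<subseteq> M \<longrightarrow> M <#>\<^bsub>G\<^esub> \<xi> N = \<xi> M}\<rparr>"

definition profinite_topology :: "('g, 'b) monoid_scheme \<Rightarrow> ('g set \<Rightarrow> 'g set) topology" where
  "profinite_topology G =
     subtopology (product_topology (\<lambda>N. discrete_topology (carrier (G Mod N))) (fin_index_normals G))
       (carrier (profinite_completion G))"

text \<open>An action is a pair of a set and a homomorphism into its permutation group.\<close>

type_synonym ('h, 's) gset = "'s set \<times> ('h \<Rightarrow> 's \<Rightarrow> 's)"

definition finite_cont_gset :: "('g, 'b) monoid_scheme \<Rightarrow> ('g set \<Rightarrow> 'g set, 's) gset \<Rightarrow> bool" where
  "finite_cont_gset G = (\<lambda>(S, \<phi>).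
     finite S \<and> group_action (profinite_completion G) S \<phi> \<and>
     continuous_map (prod_topology (profinite_topology G) (discrete_topology S))
       (discrete_topology S) (\<lambda>(\<xi>, s). \<phi> \<xi> s))"

definition equivariant_maps ::
    "('h, 'b) monoid_scheme \<Rightarrow> ('h, 's) gset \<Rightarrow> ('h, 't) gset \<Rightarrow> ('s \<Rightarrow> 't) set" where
  "equivariant_maps H = (\<lambda>(S, \<phi>) (T, \<psi>).
     {f \<in> S \<rightarrow>\<^sub>E T. \<forall>h\<in>carrier H. \<forall>s\<in>S. f (\<phi> h s) = \<psi> h (f s)})"

definition gset_isomorphic ::
    "('h, 'b) monoid_scheme \<Rightarrow> ('h, 's) gset \<Rightarrow> ('h, 't) gset \<Rightarrow> bool" where
  "gset_isomorphic H A B \<longleftrightarrow> (\<exists>f\<in>equivariant_maps H A B. bij_betw f (fst A) (fst B))"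

definition coset_space :: "('h, 'b) monoid_scheme \<Rightarrow> 'h set \<Rightarrow> ('h, 'h set) gset" where
  "coset_space H N = (lcosets\<^bsub>H\<^esub> N, \<lambda>h. \<lambda>A\<in>lcosets\<^bsub>H\<^esub> N. h <#\<^bsub>H\<^esub> A)"

definition open_normal_subgroup :: "('g, 'b) monoid_scheme \<Rightarrow> ('g set \<Rightarrow> 'g set) set \<Rightarrow> bool" where
  "open_normal_subgroup G N \<longleftrightarrow>
     N \<lhd> profinite_completion G \<and> openin (profinite_topology G) N"

text \<open>Finite sets with a continuous left action of the profinite completion of \<open>G\<close>; the sets are
  taken from the type \<open>'s\<close>.\<close>

definition finite_gsets ::
    "('g, 'b) monoid_scheme \<Rightarrow> (('g set \<Rightarrow> 'g set, 's) gset, 's \<Rightarrow> 's) cat" where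
  "finite_gsets G =
     \<lparr>Ob = {A. finite_cont_gset G A},
      Arr = equivariant_maps (profinite_completion G),
      Ident = (\<lambda>A. \<lambda>s\<in>fst A. s),
      Cmp = (\<lambda>A B D g f. compose (fst A) g f)\<rparr>"

type_synonym ('y, 'a) space_over = "'y topology \<times> ('y \<Rightarrow> 'a)"

definition fibre :: "('y, 'a) space_over \<Rightarrow> 'a \<Rightarrow> 'y set" where
  "fibre = (\<lambda>(Y, p) x. {y \<in> topspace Y. p y = x})"

text \<open>Fibres may be empty. The library's \<open>covering_space\<close> is restricted to spaces given by the
  type class and demands surjectivity.\<close>

definition is_cover :: "'a topology \<Rightarrow> ('y, 'a) space_over \<Rightarrow> bool" where
  "is_cover X = (\<lambda>(Y, p).
     continuous_map Y X p \<and>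
     (\<forall>x\<in>topspace X. \<exists>U. openin X U \<and> x \<in> U \<and>
        (\<exists>V. {z \<in> topspace Y. p z \<in> U} = (\<Union>y\<in>fibre (Y, p) x. V y) \<and>
             disjoint_family_on V (fibre (Y, p) x) \<and>
             (\<forall>y\<in>fibre (Y, p) x. y \<in> V y \<and> openin Y (V y) \<and>
                homeomorphic_map (subtopology Y (V y)) (subtopology X U) p))))"

definition is_finite_cover :: "'a topology \<Rightarrow> ('y, 'a) space_over \<Rightarrow> bool" where
  "is_finite_cover X c \<longleftrightarrow> is_cover X c \<and> (\<forall>x\<in>topspace X. finite (fibre c x))"

definition cover_maps :: "('y, 'a) space_over \<Rightarrow> ('z, 'a) space_over \<Rightarrow> ('y \<Rightarrow> 'z) set" where
  "cover_maps = (\<lambda>(Y, p) (Z, q).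
     {f \<in> extensional (topspace Y). continuous_map Y Z f \<and> (\<forall>y\<in>topspace Y. q (f y) = p y)})"

text \<open>Finite covers of \<open>X\<close>; the points of the covering spaces are taken from the type \<open>'y\<close>.\<close>

definition finite_covers :: "'a topology \<Rightarrow> (('y, 'a) space_over, 'y \<Rightarrow> 'y) cat" where
  "finite_covers X =
     \<lparr>Ob = {c. is_finite_cover X c},
      Arr = cover_maps,
      Ident = (\<lambda>c. \<lambda>y\<in>topspace (fst c). y),
      Cmp = (\<lambda>c d e g f. compose (topspace (fst c)) g f)\<rparr>"

definition quotient_topology :: "'a topology \<Rightarrow> ('a \<Rightarrow> 'b) \<Rightarrow> 'b topology" where
  "quotient_topology Y q =
     topology (\<lambda>W. W \<subseteq> q ` topspace Y \<and> openin Y {y \<in> topspace Y. q y \<in> W})"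

lemma openin_quotient_topology:
  "openin (quotient_topology Y q) W \<longleftrightarrow> W \<subseteq> q ` topspace Y \<and> openin Y {y \<in> topspace Y. q y \<in> W}"
proof -
  have "istopology (\<lambda>W. W \<subseteq> q ` topspace Y \<and> openin Y {y \<in> topspace Y. q y \<in> W})"
    unfolding istopology_def
  proof (intro conjI allI impI)
    fix S T
    assume "S \<subseteq> q ` topspace Y \<and> openin Y {y \<in> topspace Y. q y \<in> S}"
      and "T \<subseteq> q ` topspace Y \<and> openin Y {y \<in> topspace Y. q y \<in> T}"
    moreover have "{y \<in> topspace Y. q y \<in> S \<inter> T} =
        {y \<in> topspace Y. q y \<in> S} \<inter> {y \<in> topspace Y. q y \<in> T}"
      by blast
    ultimately show "S \<inter> T \<subseteq> q ` topspace Y" "openin Y {y \<in> topspace Y. q y \<in> S \<inter> T}"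
      by auto
  next
    fix K
    assume K: "\<forall>S\<in>K. S \<subseteq> q ` topspace Y \<and> openin Y {y \<in> topspace Y. q y \<in> S}"
    then show "\<Union>K \<subseteq> q ` topspace Y"
      by blast
    have "{y \<in> topspace Y. q y \<in> \<Union>K} = (\<Union>S\<in>K. {y \<in> topspace Y. q y \<in> S})"
      by blast
    then show "openin Y {y \<in> topspace Y. q y \<in> \<Union>K}"
      using K by auto
  qed
  then show ?thesis
    by (simp add: quotient_topology_def)
qed

lemma topspace_quotient_topology: "topspace (quotient_topology Y q) = q ` topspace Y"
proof -
  have "{y \<in> topspace Y. q y \<in> q ` topspace Y} = topspace Y"
    by blast
  then have "openin (quotient_topology Y q) (q ` topspace Y)"
    by (simp add: openin_quotient_topology)
  then show ?thesis
    by (metis openin_quotient_topology openin_subset openin_topspace subset_antisym)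
qed

lemma quotient_map_quotient_topology: "quotient_map Y (quotient_topology Y q) q"
  by (simp add: quotient_map_def topspace_quotient_topology openin_quotient_topology)

definition cover_aut :: "('y, 'a) space_over \<Rightarrow> ('y \<Rightarrow> 'y) monoid" where
  "cover_aut = (\<lambda>(Y, p).
     (BijGroup (topspace Y))
       \<lparr>carrier := {f \<in> Bij (topspace Y). homeomorphic_map Y Y f \<and> (\<forall>y\<in>topspace Y. p (f y) = p y)}\<rparr>)"

text \<open>The points of \<open>Y/Aut(Y|X)\<close> are the orbits \<open>A\<close>; \<open>p\<close> is constant on each of them.\<close>

definition is_galois_cover :: "'a topology \<Rightarrow> ('y, 'a) space_over \<Rightarrow> bool" where
  "is_galois_cover X = (\<lambda>(Y, p).
     is_cover X (Y, p) \<and> connected_space Y \<and>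
     homeomorphic_map (quotient_topology Y (orbit (cover_aut (Y, p)) (\<lambda>f. f))) X
       (\<lambda>A. the_elem (p ` A)))"

text \<open>The endpoint of the lift starting at \<open>y\<close> is unique, and the same for every loop in the
  class \<open>a\<close>.\<close>

definition monodromy ::
    "('y, 'a) space_over \<Rightarrow> 'a \<Rightarrow> (real \<Rightarrow> 'a) set \<Rightarrow> 'y \<Rightarrow> 'y" where
  "monodromy = (\<lambda>(Y, p) x a. \<lambda>y\<in>fibre (Y, p) x.
     THE z. \<exists>\<gamma>\<in>a. \<exists>\<gamma>'. pathin Y \<gamma>' \<and> \<gamma>' 0 = y \<and> (\<forall>t\<in>{0..1}. p (\<gamma>' t) = \<gamma> t) \<and> \<gamma>' 1 = z)"

text \<open>An action \<open>\<mu>\<close> of \<open>G\<close> on a finite set \<open>S\<close> factors through the finite quotient by its kernel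
  \<open>K\<close>; an element \<open>\<xi>\<close> of the completion acts as any representative of its component in \<open>G/K\<close>.\<close>

definition completed_action ::
    "('g, 'b) monoid_scheme \<Rightarrow> 's set \<Rightarrow> ('g \<Rightarrow> 's \<Rightarrow> 's) \<Rightarrow> ('g set \<Rightarrow> 'g set) \<Rightarrow> 's \<Rightarrow> 's" where
  "completed_action G S \<mu> \<xi> = (\<lambda>s\<in>S. the_elem ((\<lambda>a. \<mu> a s) ` \<xi> (kernel G (BijGroup S) \<mu>)))"

definition Fib ::
    "'a topology \<Rightarrow> 'a \<Rightarrow>
      (('y, 'a) space_over, 'y \<Rightarrow> 'y, ((real \<Rightarrow> 'a) set set \<Rightarrow> (real \<Rightarrow> 'a) set set, 'y) gset, 'y \<Rightarrow> 'y) fctr" where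
  "Fib X x =
     \<lparr>on_ob = (\<lambda>c. (fibre c x, completed_action (fundamental_group X x) (fibre c x) (monodromy c x))),
      on_arr = (\<lambda>c d f. restrict f (fibre c x))\<rparr>"

end

theory Submission
  imports Defs
begin

text \<open>Lifting of paths along a cover is unique and homotopy invariant, so a cover is the same as an
  action of the path groupoid of \<open>X\<close> on its fibres. Since \<open>X\<close> is path connected, equivariant maps of the
  fibres over \<open>x\<close> extend uniquely to maps commuting with all lifts, and these are continuous because
  \<open>X\<close> is locally path connected. Conversely, an action of \<open>\<pi>\<^sub>1(X, x)\<close> on a finite set \<open>S\<close> is extended to the
  path groupoid along chosen paths from \<open>x\<close> to all points; the total space is then the set \<open>X \<times> S\<close>,
  where a set is open if with a point it contains the endpoints of all short lifts that start there.
  Finally, a continuous action of the profinite completion on a finite set factors through a finite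
  quotient of \<open>\<pi>\<^sub>1(X, x)\<close>, so it is determined by the action of \<open>\<pi>\<^sub>1(X, x)\<close>.\<close>

section \<open>Paths up to homotopy\<close>

text \<open>A category here takes its objects from one type, so essential surjectivity needs room in
  that type. A finite set embeds into the natural numbers, and hence a single injection
  \<open>\<iota>\<close> of \<open>X\<close> times \<open>nat\<close> into the universe makes room
  for the total spaces of all finite actions. Placing a copy of \<open>S\<close> over every point
  avoids quotients of a universal cover; the price is that the topology must be recovered from
  transport along paths. Semilocal simple connectedness enters exactly there: transport along paths
  inside a small open set depends only on the end of the path, so the ends of short lifts form a
  sheet. Compactness of the interval is always used as bisection (\<open>Bolzano\<close>), for a
  property of subintervals that is additive and holds on all short ones. On the profinite side,
  finiteness acts twice: the permutation group is finite, so kernels have finite index, and finitely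
  many open conditions have a common level. Approximating an element of the completion at such a
  level by a group element settles every comparison of the two kinds of action.\<close>

abbreviation unit_interval :: "real topology" where
  "unit_interval \<equiv> top_of_set {0..1}"

text \<open>The endpoint condition only looks at 0 and 1, which lie in the interval, so
  \<open>homotopic_with\<close> unfolds to a map of the square. The first coordinate of
  \<open>h\<close> is the deformation parameter, the second runs along the path; later homotopies
  keep this order.\<close>

lemma path_homotopic_iff:
  "path_homotopic X \<gamma> \<delta> \<longleftrightarrow>
     (\<exists>h. continuous_map (prod_topology unit_interval unit_interval) X h \<and>
          (\<forall>s\<in>{0..1}. h (0, s) = \<gamma> s) \<and> (\<forall>s\<in>{0..1}. h (1, s) = \<delta> s) \<and>
          (\<forall>t\<in>{0..1}. h (t, 0) = \<gamma> 0 \<and> h (t, 1) = \<gamma> 1))"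
proof -
  have *: "h 0 = \<gamma> 0 \<and> h 1 = \<gamma> 1 \<longleftrightarrow> k 0 = \<gamma> 0 \<and> k 1 = \<gamma> 1"
    if "\<And>x. x \<in> topspace unit_interval \<Longrightarrow> h x = k x" for h k :: "real \<Rightarrow> 'a"
    using that[of 0] that[of 1] by simp
  show ?thesis
    unfolding path_homotopic_def by (subst homotopic_with) (use * in \<open>auto simp del: prod_topology_subtopology_eu\<close>)
qed

lemma path_homotopic_imp:
  assumes "path_homotopic X \<gamma> \<delta>"
  shows "pathin X \<gamma>" "pathin X \<delta>" "\<delta> 0 = \<gamma> 0" "\<delta> 1 = \<gamma> 1"
  using assms homotopic_with_imp_continuous_maps homotopic_with_imp_property
  unfolding path_homotopic_def pathin_def by blast+

lemma path_homotopic_refl: "pathin X \<gamma> \<Longrightarrow> path_homotopic X \<gamma> \<gamma>"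
  by (simp add: path_homotopic_def pathin_def)

lemma path_homotopic_sym: "path_homotopic X \<gamma> \<delta> \<Longrightarrow> path_homotopic X \<delta> \<gamma>"
  using path_homotopic_imp[of X \<gamma> \<delta>] homotopic_with_symD
  by (metis (mono_tags, lifting) homotopic_with_mono path_homotopic_def)

lemma path_homotopic_trans [trans]:
  "path_homotopic X \<gamma> \<delta> \<Longrightarrow> path_homotopic X \<delta> \<epsilon> \<Longrightarrow> path_homotopic X \<gamma> \<epsilon>"
  using path_homotopic_imp[of X \<gamma> \<delta>] homotopic_with_trans
  unfolding path_homotopic_def by fastforce

text \<open>All groupoid laws for paths are instances of this one, because the two sides are
  reparametrisations of a single path.\<close>

lemma path_homotopic_reparametrize:
  assumes \<gamma>: "pathin X \<gamma>"
    and u: "continuous_on {0..1} u" "u \<in> {0..1} \<rightarrow> {0..1}"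
    and v: "continuous_on {0..1} v" "v \<in> {0..1} \<rightarrow> {0..1}"
    and uv: "u 0 = v 0" "u 1 = v 1"
    and \<delta>: "\<And>s. s \<in> {0..1} \<Longrightarrow> \<delta> s = \<gamma> (u s)" and \<epsilon>: "\<And>s. s \<in> {0..1} \<Longrightarrow> \<epsilon> s = \<gamma> (v s)"
  shows "path_homotopic X \<delta> \<epsilon>"
proof -
  \<comment> \<open>The straight-line homotopy from \<open>u\<close> to \<open>v\<close>. It stays
    in the interval by convexity, and it is constant at both ends because \<open>u\<close> and
    \<open>v\<close> agree there.\<close>
  define w where "w = (\<lambda>p :: real \<times> real. (1 - fst p) * u (snd p) + fst p * v (snd p))"
  have "continuous_on ({0..1} \<times> {0..1}) w"
    unfolding w_def
    by (intro continuous_intros continuous_on_compose2[OF u(1)] continuous_on_compose2[OF v(1)]) auto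
  moreover have "w p \<in> {0..1}" if "p \<in> {0..1} \<times> {0..1}" for p
  proof -
    have "u (snd p) \<in> {0..1}" "v (snd p) \<in> {0..1}" "fst p \<in> {0..1}"
      using that u(2) v(2) by auto
    then show ?thesis
      using convex_bound_le[of "u (snd p)" 1 "v (snd p)" "1 - fst p" "fst p"] by (simp add: w_def)
  qed
  ultimately have "continuous_map (prod_topology unit_interval unit_interval) unit_interval w"
    by auto
  then have "continuous_map (prod_topology unit_interval unit_interval) X (\<gamma> \<circ> w)"
    using \<gamma> continuous_map_compose unfolding pathin_def by blast
  then show ?thesis
    unfolding path_homotopic_iff
    by (intro exI[of _ "\<gamma> \<circ> w"]) (use uv \<delta> \<epsilon> in \<open>auto simp: w_def algebra_simps simp flip: distrib_left\<close>)
qed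

section \<open>Reversal and concatenation of paths\<close>

definition path_rev :: "(real \<Rightarrow> 'a) \<Rightarrow> real \<Rightarrow> 'a" where
  "path_rev \<gamma> = (\<lambda>t. \<gamma> (1 - t))"

lemma path_rev_ends [simp]: "path_rev \<gamma> 0 = \<gamma> 1" "path_rev \<gamma> 1 = \<gamma> 0"
  by (simp_all add: path_rev_def)

lemma path_join_ends [simp]: "path_join \<gamma> \<delta> 0 = \<gamma> 0" "path_join \<gamma> \<delta> 1 = \<delta> 1"
  by (simp_all add: path_join_def)

lemma pathin_reparametrize:
  assumes "pathin X \<gamma>" "continuous_on {0..1} u" "u \<in> {0..1} \<rightarrow> {0..1}"
  shows "pathin X (\<lambda>t. \<gamma> (u t))"
proof -
  have "continuous_map unit_interval unit_interval u"
    using assms by (auto simp: continuous_map_in_subtopology)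
  from continuous_map_compose[OF this, of X \<gamma>] assms(1) show ?thesis
    by (simp add: pathin_def o_def)
qed

lemma pathin_rev: "pathin X \<gamma> \<Longrightarrow> pathin X (path_rev \<gamma>)"
  unfolding path_rev_def by (rule pathin_reparametrize) (auto intro!: continuous_intros)

lemma continuous_map_affine_snd:
  assumes f: "continuous_map (prod_topology Z unit_interval) X f"
    and S: "\<And>s. s \<in> S \<Longrightarrow> a * s + b \<in> {0..1::real}"
  shows "continuous_map (prod_topology Z (top_of_set S)) X (\<lambda>p. f (fst p, a * snd p + b))"
proof -
  have "continuous_map (prod_topology Z (top_of_set S)) unit_interval (\<lambda>p. a * snd p + b)"
  proof -
    have "continuous_map (top_of_set S) unit_interval (\<lambda>s. a * s + b)"
      using S by (auto simp: continuous_map_in_subtopology intro!: continuous_intros)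
    then show ?thesis
      using continuous_map_compose[OF continuous_map_snd, of "top_of_set S" unit_interval _ Z]
      by (simp add: o_def)
  qed
  then have "continuous_map (prod_topology Z (top_of_set S)) (prod_topology Z unit_interval)
      (\<lambda>p. (fst p, a * snd p + b))"
    by (intro continuous_map_pairedI continuous_map_fst)
  from continuous_map_compose[OF this f] show ?thesis
    by (simp add: o_def)
qed

text \<open>Pasting with a parameter space \<open>Z\<close>; with \<open>Z\<close> the deformation
  interval it joins two homotopies side by side.\<close>

lemma continuous_map_join_snd:
  assumes f: "continuous_map (prod_topology Z unit_interval) X f"
    and g: "continuous_map (prod_topology Z unit_interval) X g"
    and fg: "\<And>z. z \<in> topspace Z \<Longrightarrow> f (z, 1) = g (z, 0)"
  shows "continuous_map (prod_topology Z unit_interval) X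
    (\<lambda>p. if snd p \<le> 1/2 then f (fst p, 2 * snd p) else g (fst p, 2 * snd p - 1))"
proof (rule continuous_map_cases_le)
  show "continuous_map (prod_topology Z unit_interval) euclideanreal snd"
    by (rule continuous_map_into_fulltopology[OF continuous_map_snd])
  have sub: "subtopology (prod_topology Z unit_interval) {x \<in> topspace (prod_topology Z unit_interval). snd x \<in> T}
      = prod_topology Z (top_of_set ({0..1} \<inter> T))" for T
  proof -
    have "{x \<in> topspace (prod_topology Z unit_interval). snd x \<in> T} = topspace Z \<times> ({0..1} \<inter> T)"
      by auto
    then show ?thesis
      using subtopology_Times[of Z unit_interval "topspace Z" "{0..1} \<inter> T"]
      by (simp add: subtopology_subtopology Int_absorb1)
  qed
  show "continuous_map (subtopology (prod_topology Z unit_interval)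
      {x \<in> topspace (prod_topology Z unit_interval). snd x \<le> 1/2}) X (\<lambda>p. f (fst p, 2 * snd p))"
    using sub[of "{..1/2}"] continuous_map_affine_snd[OF f, of "{0..1} \<inter> {..1/2}" 2 0] by simp
  show "continuous_map (subtopology (prod_topology Z unit_interval)
      {x \<in> topspace (prod_topology Z unit_interval). 1/2 \<le> snd x}) X (\<lambda>p. g (fst p, 2 * snd p - 1))"
    using sub[of "{1/2..}"] continuous_map_affine_snd[OF g, of "{0..1} \<inter> {1/2..}" 2 "-1"] by simp
next
  show "f (fst p, 2 * snd p) = g (fst p, 2 * snd p - 1)"
    if "p \<in> topspace (prod_topology Z unit_interval)" "snd p = 1/2" for p
  proof -
    have "2 * snd p = 1"
      using that(2) by simp
    then show ?thesis
      using that(1) fg[of "fst p"] by (simp add: mem_Times_iff)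
  qed
qed simp

lemma path_homotopic_join:
  assumes \<gamma>: "path_homotopic X \<gamma> \<gamma>'" and \<delta>: "path_homotopic X \<delta> \<delta>'" and "\<gamma> 1 = \<delta> 0"
  shows "path_homotopic X (path_join \<gamma> \<delta>) (path_join \<gamma>' \<delta>')"
proof -
  obtain h k
    where h: "continuous_map (prod_topology unit_interval unit_interval) X h"
        "\<forall>s\<in>{0..1}. h (0, s) = \<gamma> s" "\<forall>s\<in>{0..1}. h (1, s) = \<gamma>' s"
        "\<forall>t\<in>{0..1}. h (t, 0) = \<gamma> 0 \<and> h (t, 1) = \<gamma> 1"
      and k: "continuous_map (prod_topology unit_interval unit_interval) X k"
        "\<forall>s\<in>{0..1}. k (0, s) = \<delta> s" "\<forall>s\<in>{0..1}. k (1, s) = \<delta>' s"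
        "\<forall>t\<in>{0..1}. k (t, 0) = \<delta> 0 \<and> k (t, 1) = \<delta> 1"
    using \<gamma> \<delta> unfolding path_homotopic_iff by (elim exE conjE) blast
  show ?thesis
    unfolding path_homotopic_iff
  proof (intro exI conjI)
    show "continuous_map (prod_topology unit_interval unit_interval) X
      (\<lambda>p. if snd p \<le> 1/2 then h (fst p, 2 * snd p) else k (fst p, 2 * snd p - 1))"
      using h k assms(3) by (intro continuous_map_join_snd) auto
  qed (use h k in \<open>auto simp: path_join_def\<close>)
qed

text \<open>Trivial homotopies join to a homotopy, and the ends of a homotopy are paths.\<close>

lemma pathin_join:
  assumes "pathin X \<gamma>" "pathin X \<delta>" "\<gamma> 1 = \<delta> 0"
  shows "pathin X (path_join \<gamma> \<delta>)"
  using path_homotopic_imp(1)[OF path_homotopic_join] path_homotopic_refl assms by metis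

lemma path_homotopic_join_assoc:
  assumes "pathin X \<alpha>" "pathin X \<beta>" "pathin X \<gamma>" "\<alpha> 1 = \<beta> 0" "\<beta> 1 = \<gamma> 0"
  shows "path_homotopic X (path_join (path_join \<alpha> \<beta>) \<gamma>) (path_join \<alpha> (path_join \<beta> \<gamma>))"
proof -
  \<comment> \<open>\<open>v\<close> moves the break points 1/2 and 3/4 of the right bracketing to
    the break points 1/4 and 1/2 of the left one. Its slopes 1/2, 1 and 2 increase, so it is convex
    and equals the maximum of its three linear pieces.\<close>
  define v :: "real \<Rightarrow> real" where
    "v = (\<lambda>s. max (s / 2) (max (s - 1/4) (2 * s - 1)))"
  have "continuous_on {0..1} v"
    unfolding v_def by (intro continuous_intros) auto
  moreover have "path_join \<alpha> (path_join \<beta> \<gamma>) s = path_join (path_join \<alpha> \<beta>) \<gamma> (v s)" for s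
  proof -
    consider "s \<le> 1/2" | "1/2 < s" "s \<le> 3/4" | "3/4 < s"
      by linarith
    then show ?thesis
    proof cases
      case 1
      then have "v s = s / 2" by (simp add: v_def)
      from this 1 show ?thesis unfolding path_join_def by (simp only:) simp
    next
      case 2
      then have "v s = s - 1/4" by (simp add: v_def)
      from this 2 show ?thesis unfolding path_join_def by (simp only:) (simp add: algebra_simps)
    next
      case 3
      then have "v s = 2 * s - 1" by (simp add: v_def)
      from this 3 show ?thesis unfolding path_join_def by (simp only:) simp
    qed
  qed
  ultimately show ?thesis
    by (intro path_homotopic_reparametrize[where u = id and v = v
          and \<gamma> = "path_join (path_join \<alpha> \<beta>) \<gamma>"] pathin_join)
      (use assms in \<open>auto simp: v_def le_max_iff_disj\<close>)
qed

lemma path_homotopic_join_const: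
  assumes "pathin X \<gamma>"
  shows "path_homotopic X (path_join \<gamma> (\<lambda>t. \<gamma> 1)) \<gamma>"
    and "path_homotopic X (path_join (\<lambda>t. \<gamma> 0) \<gamma>) \<gamma>"
proof -
  \<comment> \<open>The reparametrisation runs through \<open>\<gamma>\<close> in the first half and
    then rests at 1; its counterpart below first rests at 0.\<close>
  show "path_homotopic X (path_join \<gamma> (\<lambda>t. \<gamma> 1)) \<gamma>"
    by (rule path_homotopic_reparametrize[OF assms, where u = "\<lambda>s. min (2 * s) 1" and v = id])
      (auto intro!: continuous_intros simp: path_join_def)
  show "path_homotopic X (path_join (\<lambda>t. \<gamma> 0) \<gamma>) \<gamma>"
    by (rule path_homotopic_reparametrize[OF assms, where u = "\<lambda>s. max (2 * s - 1) 0" and v = id])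
      (auto intro!: continuous_intros simp: path_join_def)
qed

lemma path_homotopic_join_rev:
  assumes "pathin X \<gamma>"
  shows "path_homotopic X (path_join \<gamma> (path_rev \<gamma>)) (\<lambda>t. \<gamma> 0)"
    and "path_homotopic X (path_join (path_rev \<gamma>) \<gamma>) (\<lambda>t. \<gamma> 1)"
proof -
  \<comment> \<open>The tent function climbs from 0 to 1 and returns; it has the same end values as
    the constant 0.\<close>
  show "path_homotopic X (path_join \<gamma> (path_rev \<gamma>)) (\<lambda>t. \<gamma> 0)"
    by (rule path_homotopic_reparametrize[OF assms, where u = "\<lambda>s. 1 - \<bar>2 * s - 1\<bar>" and v = "\<lambda>s. 0"])
      (auto intro!: continuous_intros simp: path_join_def path_rev_def)
  show "path_homotopic X (path_join (path_rev \<gamma>) \<gamma>) (\<lambda>t. \<gamma> 1)"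
    by (rule path_homotopic_reparametrize[OF assms, where u = "\<lambda>s. \<bar>2 * s - 1\<bar>" and v = "\<lambda>s. 1"])
      (auto intro!: continuous_intros simp: path_join_def path_rev_def)
qed

section \<open>The fundamental group\<close>

abbreviation loop_class :: "'a topology \<Rightarrow> 'a \<Rightarrow> (real \<Rightarrow> 'a) \<Rightarrow> (real \<Rightarrow> 'a) set" where
  "loop_class X x \<gamma> \<equiv> loop_rel X x `` {\<gamma>}"

lemma equiv_loop_rel: "equiv (loops X x) (loop_rel X x)"
  by (auto simp: equiv_def refl_on_def sym_def trans_def loop_rel_def loops_def
      intro: path_homotopic_refl path_homotopic_sym path_homotopic_trans)

lemma in_loop_class_iff:
  "\<gamma> \<in> loops X x \<Longrightarrow> \<delta> \<in> loop_class X x \<gamma> \<longleftrightarrow> path_homotopic X \<gamma> \<delta>"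
  using path_homotopic_imp[of X \<gamma> \<delta>] by (auto simp: loop_rel_def loops_def)

lemma loop_class_eq:
  assumes "path_homotopic X \<gamma> \<delta>" "\<gamma> \<in> loops X x"
  shows "loop_class X x \<gamma> = loop_class X x \<delta>"
  using assms path_homotopic_imp[OF assms(1)]
  by (intro equiv_class_eq[OF equiv_loop_rel]) (auto simp: loop_rel_def loops_def)

lemma loop_class_in_carrier:
  "\<gamma> \<in> loops X x \<Longrightarrow> loop_class X x \<gamma> \<in> carrier (fundamental_group X x)"
  by (simp add: fundamental_group_def quotientI)

lemma carrier_fundamental_groupE:
  assumes "a \<in> carrier (fundamental_group X x)"
  obtains \<gamma> where "\<gamma> \<in> loops X x" "a = loop_class X x \<gamma>"
  using assms by (auto simp: fundamental_group_def elim: quotientE)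

lemma loops_join: "\<gamma> \<in> loops X x \<Longrightarrow> \<delta> \<in> loops X x \<Longrightarrow> path_join \<gamma> \<delta> \<in> loops X x"
  by (simp add: loops_def pathin_join)

text \<open>The product of loop classes is a union over all representatives; it collapses to one
  class once the summands are known to coincide.\<close>

lemma UN_UN_constant:
  assumes "\<And>a b. a \<in> A \<Longrightarrow> b \<in> B \<Longrightarrow> f b a = C" "a \<in> A" "b \<in> B"
  shows "(\<Union>a\<in>A. \<Union>b\<in>B. f b a) = C"
  using assms by auto

lemma mult_loop_class:
  assumes "\<delta> \<in> loops X x" "\<gamma> \<in> loops X x"
  shows "loop_class X x \<delta> \<otimes>\<^bsub>fundamental_group X x\<^esub> loop_class X x \<gamma> = loop_class X x (path_join \<gamma> \<delta>)"
proof -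
  have "loop_class X x (path_join \<gamma>' \<delta>') = loop_class X x (path_join \<gamma> \<delta>)"
    if "\<delta>' \<in> loop_class X x \<delta>" "\<gamma>' \<in> loop_class X x \<gamma>" for \<gamma>' \<delta>'
  proof (rule loop_class_eq[symmetric])
    show "path_homotopic X (path_join \<gamma> \<delta>) (path_join \<gamma>' \<delta>')"
      using that assms
      by (intro path_homotopic_join) (simp_all only: in_loop_class_iff, simp_all add: loops_def)
  qed (rule loops_join[OF assms(2,1)])
  moreover have "\<delta> \<in> loop_class X x \<delta>" "\<gamma> \<in> loop_class X x \<gamma>"
    using assms equiv_class_self[OF equiv_loop_rel] by auto
  ultimately have "(\<Union>\<delta>'\<in>loop_class X x \<delta>. \<Union>\<gamma>'\<in>loop_class X x \<gamma>. loop_class X x (path_join \<gamma>' \<delta>')) =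
      loop_class X x (path_join \<gamma> \<delta>)"
    by (rule UN_UN_constant)
  then show ?thesis
    by (simp only: fundamental_group_def monoid.simps)
qed

lemma one_fundamental_group: "\<one>\<^bsub>fundamental_group X x\<^esub> = loop_class X x (\<lambda>t. x)"
  by (simp add: fundamental_group_def)

lemma group_fundamental_group:
  assumes "x \<in> topspace X"
  shows "group (fundamental_group X x)"
proof (rule groupI)
  let ?G = "fundamental_group X x"
  have const: "(\<lambda>t. x) \<in> loops X x"
    using assms by (simp add: loops_def)
  then show "\<one>\<^bsub>?G\<^esub> \<in> carrier ?G"
    by (simp add: one_fundamental_group loop_class_in_carrier)
  show "a \<otimes>\<^bsub>?G\<^esub> b \<in> carrier ?G" if ab: "a \<in> carrier ?G" "b \<in> carrier ?G" for a b
    using ab by (elim carrier_fundamental_groupE)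
      (simp add: mult_loop_class loop_class_in_carrier loops_join)
  show "a \<otimes>\<^bsub>?G\<^esub> b \<otimes>\<^bsub>?G\<^esub> c = a \<otimes>\<^bsub>?G\<^esub> (b \<otimes>\<^bsub>?G\<^esub> c)"
    if abc: "a \<in> carrier ?G" "b \<in> carrier ?G" "c \<in> carrier ?G" for a b c
  proof -
    obtain \<alpha> where \<alpha>: "\<alpha> \<in> loops X x" "a = loop_class X x \<alpha>"
      using abc(1) by (rule carrier_fundamental_groupE)
    obtain \<beta> where \<beta>: "\<beta> \<in> loops X x" "b = loop_class X x \<beta>"
      using abc(2) by (rule carrier_fundamental_groupE)
    obtain \<gamma> where \<gamma>: "\<gamma> \<in> loops X x" "c = loop_class X x \<gamma>"
      using abc(3) by (rule carrier_fundamental_groupE)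
    note l = \<alpha>(1) \<beta>(1) \<gamma>(1) and eq = \<alpha>(2) \<beta>(2) \<gamma>(2)
    have "path_homotopic X (path_join \<gamma> (path_join \<beta> \<alpha>)) (path_join (path_join \<gamma> \<beta>) \<alpha>)"
      using l by (intro path_homotopic_sym[OF path_homotopic_join_assoc]) (auto simp: loops_def)
    then have "loop_class X x (path_join \<gamma> (path_join \<beta> \<alpha>)) =
        loop_class X x (path_join (path_join \<gamma> \<beta>) \<alpha>)"
      using l by (intro loop_class_eq) (simp_all only: loops_join)
    then show ?thesis
      unfolding eq using l by (simp only: mult_loop_class loops_join)
  qed
  show "\<one>\<^bsub>?G\<^esub> \<otimes>\<^bsub>?G\<^esub> a = a" if a: "a \<in> carrier ?G" for a
  proof -
    obtain \<alpha> where \<alpha>: "\<alpha> \<in> loops X x" "a = loop_class X x \<alpha>"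
      using a by (rule carrier_fundamental_groupE)
    \<comment> \<open>Products are reversed: a left factor is a path appended at the end. The same
      holds for the inverse below.\<close>
    then have "path_homotopic X (path_join \<alpha> (\<lambda>t. x)) \<alpha>"
      using path_homotopic_join_const(1)[of X \<alpha>] by (simp add: loops_def)
    then show ?thesis
      using \<alpha> const loop_class_eq[of X "path_join \<alpha> (\<lambda>t. x)" \<alpha> x]
      by (simp add: one_fundamental_group mult_loop_class loops_join)
  qed
  show "\<exists>b\<in>carrier ?G. b \<otimes>\<^bsub>?G\<^esub> a = \<one>\<^bsub>?G\<^esub>" if a: "a \<in> carrier ?G" for a
  proof -
    obtain \<alpha> where \<alpha>: "\<alpha> \<in> loops X x" "a = loop_class X x \<alpha>"
      using a by (rule carrier_fundamental_groupE)
    then have r: "path_rev \<alpha> \<in> loops X x"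
      by (simp add: loops_def pathin_rev)
    have "path_homotopic X (path_join \<alpha> (path_rev \<alpha>)) (\<lambda>t. x)"
      using \<alpha> path_homotopic_join_rev(1)[of X \<alpha>] by (simp add: loops_def)
    then have "loop_class X x (path_rev \<alpha>) \<otimes>\<^bsub>?G\<^esub> a = \<one>\<^bsub>?G\<^esub>"
      using \<alpha> r loop_class_eq[of X "path_join \<alpha> (path_rev \<alpha>)" "\<lambda>t. x" x]
      by (simp add: one_fundamental_group mult_loop_class loops_join)
    then show ?thesis
      by (rule bexI[OF _ loop_class_in_carrier[OF r]])
  qed
qed

section \<open>Lifting along covers\<close>

text \<open>A sheet over \<open>U\<close>, recorded by the inverse of \<open>p\<close> on it.
  Sections with open image are easier to compose with paths than a decomposition of the preimage of
  \<open>U\<close>.\<close>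

definition local_section :: "'a topology \<Rightarrow> ('y, 'a) space_over \<Rightarrow> 'a set \<Rightarrow> ('a \<Rightarrow> 'y) \<Rightarrow> bool" where
  "local_section X = (\<lambda>(Y, p) U \<sigma>. continuous_map (subtopology X U) Y \<sigma> \<and>
     (\<forall>u\<in>U. p (\<sigma> u) = u) \<and> openin Y (\<sigma> ` U))"

lemma cover_continuous: "is_cover X (Y, p) \<Longrightarrow> continuous_map Y X p"
  by (simp add: is_cover_def)

text \<open>One \<open>U\<close> serves all points above it: the section through \<open>y\<close>
  inverts \<open>p\<close> on the sheet that contains \<open>y\<close>. Lifting a path over
  \<open>U\<close> relies on this, since its starting point is arbitrary.\<close>

lemma cover_local_sections:
  assumes c: "is_cover X (Y, p)" and x: "x \<in> topspace X"
  obtains U where "openin X U" "x \<in> U"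
    "\<And>y. y \<in> topspace Y \<Longrightarrow> p y \<in> U \<Longrightarrow> \<exists>\<sigma>. local_section X (Y, p) U \<sigma> \<and> \<sigma> (p y) = y"
proof -
  obtain U V where U: "openin X U" "x \<in> U"
    and eq: "{z \<in> topspace Y. p z \<in> U} = (\<Union>y\<in>fibre (Y, p) x. V y)"
    and V: "\<forall>y\<in>fibre (Y, p) x. y \<in> V y \<and> openin Y (V y) \<and>
                homeomorphic_map (subtopology Y (V y)) (subtopology X U) p"
    using c x by (auto simp: is_cover_def)
  have "\<exists>\<sigma>. local_section X (Y, p) U \<sigma> \<and> \<sigma> (p y) = y" if y: "y \<in> topspace Y" "p y \<in> U" for y
  proof -
    obtain y0 where y0: "y0 \<in> fibre (Y, p) x" "y \<in> V y0"
      using eq y by blast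
    then have o: "openin Y (V y0)" and "homeomorphic_map (subtopology Y (V y0)) (subtopology X U) p"
      using V by auto
    then obtain \<sigma> where \<sigma>: "homeomorphic_maps (subtopology Y (V y0)) (subtopology X U) p \<sigma>"
      by (auto simp: homeomorphic_map_maps)
    have ts: "topspace (subtopology Y (V y0)) = V y0" "topspace (subtopology X U) = U"
      using openin_subset[OF o] openin_subset[OF U(1)] by auto
    have "\<sigma> ` U = V y0"
      using homeomorphic_imp_surjective_map[of "subtopology X U" "subtopology Y (V y0)" \<sigma>] \<sigma> ts
      by (metis homeomorphic_map_maps homeomorphic_maps_sym)
    moreover have "continuous_map (subtopology X U) Y \<sigma>" "\<forall>u\<in>U. p (\<sigma> u) = u" "\<sigma> (p y) = y"
      using \<sigma> ts y0 unfolding homeomorphic_maps_def by (auto simp: continuous_map_in_subtopology)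
    ultimately show ?thesis
      using o by (auto simp: local_section_def)
  qed
  with U that show thesis by blast
qed

lemma cover_section_at:
  assumes c: "is_cover X (Y, p)" and y: "y \<in> topspace Y"
  obtains U \<sigma> where "openin X U" "p y \<in> U" "local_section X (Y, p) U \<sigma>" "\<sigma> (p y) = y"
proof -
  have "p y \<in> topspace X"
    using cover_continuous[OF c] y by (auto simp: continuous_map_def Pi_iff)
  then show thesis
    by (rule cover_local_sections[OF c]) (use y that in blast)
qed

lemma openin_section_preimage:
  assumes "local_section X (Y, p) U \<sigma>" "openin X U" "openin Y V"
  shows "openin X {u \<in> U. \<sigma> u \<in> V}"
proof -
  have "openin (subtopology X U) {u \<in> topspace (subtopology X U). \<sigma> u \<in> V}"
    using assms by (intro openin_continuous_map_preimage) (auto simp: local_section_def)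
  moreover have "topspace (subtopology X U) = U"
    using openin_subset[OF assms(2)] by (simp add: Int_absorb1)
  ultimately show ?thesis
    using assms(2) openin_trans_full by fastforce
qed

text \<open>Disjointness of the sheets stands in for a Hausdorff condition on \<open>Y\<close>; it
  makes the set where two lifts agree closed.\<close>

lemma cover_separated:
  assumes c: "is_cover X (Y, p)" and y: "y \<in> topspace Y" "y' \<in> topspace Y" "p y = p y'" "y \<noteq> y'"
  obtains V V' where "openin Y V" "openin Y V'" "y \<in> V" "y' \<in> V'" "V \<inter> V' = {}"
proof -
  have "p y \<in> topspace X"
    using cover_continuous[OF c] y by (auto simp: continuous_map_def)
  then obtain V where "disjoint_family_on V (fibre (Y, p) (p y))"
    and "\<forall>z\<in>fibre (Y, p) (p y). z \<in> V z \<and> openin Y (V z)"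
    using c by (fastforce simp: is_cover_def)
  then show thesis
    using y that[of "V y" "V y'"] by (auto simp: fibre_def disjoint_family_on_def)
qed

text \<open>The set where two lifts agree is open, because \<open>p\<close> is injective on a sheet,
  and closed, because different points of a fibre can be separated. On a connected space it is
  everything as soon as it contains \<open>z0\<close>.\<close>

lemma lift_unique:
  assumes c: "is_cover X (Y, p)" and Z: "connected_space Z"
    and f: "continuous_map Z Y f" and g: "continuous_map Z Y g"
    and pfg: "\<And>z. z \<in> topspace Z \<Longrightarrow> p (f z) = p (g z)"
    and z0: "z0 \<in> topspace Z" "f z0 = g z0" and z: "z \<in> topspace Z"
  shows "f z = g z"
proof -
  let ?E = "{z \<in> topspace Z. f z = g z}"
  have "openin Z ?E"
  proof (subst openin_subopen, intro ballI)
    fix w assume w: "w \<in> ?E"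
    then have fw: "f w \<in> topspace Y"
      using f by (intro funcset_mem[of f "topspace Z"]) (simp_all add: continuous_map_def)
    obtain U \<sigma> where U: "p (f w) \<in> U" and \<sigma>: "local_section X (Y, p) U \<sigma>" "\<sigma> (p (f w)) = f w"
      using cover_section_at[OF c fw] .
    let ?T = "{z \<in> topspace Z. f z \<in> \<sigma> ` U} \<inter> {z \<in> topspace Z. g z \<in> \<sigma> ` U}"
    have "openin Z ?T"
      using \<sigma> by (intro openin_Int openin_continuous_map_preimage[OF f] openin_continuous_map_preimage[OF g])
        (auto simp: local_section_def)
    moreover have "f w \<in> \<sigma> ` U"
      using \<sigma>(2) U by (metis imageI)
    then have "w \<in> ?T"
      using w by auto
    moreover have "?T \<subseteq> ?E"
    proof
      fix v assume v: "v \<in> ?T"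
      then obtain a b where ab: "a \<in> U" "f v = \<sigma> a" "b \<in> U" "g v = \<sigma> b"
        by auto
      then have "a = b"
        using \<sigma>(1) pfg[of v] v by (simp add: local_section_def)
      then show "v \<in> ?E"
        using ab v by auto
    qed
    ultimately show "\<exists>T. openin Z T \<and> w \<in> T \<and> T \<subseteq> ?E"
      by blast
  qed
  moreover have "openin Z (topspace Z - ?E)"
  proof (subst openin_subopen, intro ballI)
    fix w assume w: "w \<in> topspace Z - ?E"
    then have "f w \<in> topspace Y" "g w \<in> topspace Y" "p (f w) = p (g w)" "f w \<noteq> g w"
      using f g pfg by (auto simp: continuous_map_def)
    then obtain V V' where V: "openin Y V" "openin Y V'" "f w \<in> V" "g w \<in> V'" "V \<inter> V' = {}"
      by (rule cover_separated[OF c])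
    let ?T = "{z \<in> topspace Z. f z \<in> V} \<inter> {z \<in> topspace Z. g z \<in> V'}"
    have "openin Z ?T"
      using V f g by (intro openin_Int openin_continuous_map_preimage)
    moreover have "w \<in> ?T" "?T \<subseteq> topspace Z - ?E"
      using V w by auto
    ultimately show "\<exists>T. openin Z T \<and> w \<in> T \<and> T \<subseteq> topspace Z - ?E"
      by blast
  qed
  then have "closedin Z ?E"
    by (auto simp: closedin_def)
  ultimately have "?E = {} \<or> ?E = topspace Z"
    using Z unfolding connected_space_clopen_in by blast
  then show ?thesis
    using z0 z by blast
qed

section \<open>Existence of path lifts\<close>

lemma connected_space_interval: "connected_space (top_of_set {a..b::real})"
proof -
  have "connectedin euclidean {a..b}"
    by simp
  then show ?thesis
    by (simp only: connectedin_def)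
qed

lemma open_preimage_interval:
  assumes "continuous_map (top_of_set {a..b}) X \<gamma>" "openin X U" "s \<in> {a..b::real}" "\<gamma> s \<in> U"
  obtains d where "d > 0" "\<And>t. t \<in> {a..b} \<Longrightarrow> \<bar>t - s\<bar> < d \<Longrightarrow> \<gamma> t \<in> U"
proof -
  have "openin (top_of_set {a..b}) {t \<in> {a..b}. \<gamma> t \<in> U}"
    using openin_continuous_map_preimage[OF assms(1,2)] by simp
  then show thesis
    using assms(3,4) that by (force simp: openin_euclidean_subtopology_iff dist_real_def)
qed

lemma path_lift_interval:
  fixes a b :: real
  assumes c: "is_cover X (Y, p)" and \<gamma>: "continuous_map (top_of_set {a..b}) X \<gamma>" and ab: "a \<le> b"
    and y: "y \<in> topspace Y" "p y = \<gamma> a"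
  obtains g where "continuous_map (top_of_set {a..b}) Y g" "\<And>t. t \<in> {a..b} \<Longrightarrow> p (g t) = \<gamma> t" "g a = y"
proof -
  \<comment> \<open>The starting point is quantified inside \<open>P\<close>, so that a lift over
    the second interval can start where the first one ends. The bounds \<open>a \<le> c\<close> and
    \<open>d \<le> b\<close> guard against the intervals around a point that stick out of the
    domain, which the local hypothesis of \<open>Bolzano\<close> also includes.\<close>
  define P where "P c d \<longleftrightarrow> (a \<le> c \<longrightarrow> d \<le> b \<longrightarrow> (\<forall>y\<in>topspace Y. p y = \<gamma> c \<longrightarrow>
      (\<exists>g. continuous_map (top_of_set {c..d}) Y g \<and> (\<forall>t\<in>{c..d}. p (g t) = \<gamma> t) \<and> g c = y)))" for c d
  have "P a b"
  proof (rule Bolzano[OF ab])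
    fix c d e assume P: "P c d" "P d e" and cde: "c \<le> d" "d \<le> e"
    show "P c e"
      unfolding P_def
    proof (intro impI ballI)
      fix y assume le: "a \<le> c" "e \<le> b" and y: "y \<in> topspace Y" "p y = \<gamma> c"
      obtain g where g: "continuous_map (top_of_set {c..d}) Y g" "\<forall>t\<in>{c..d}. p (g t) = \<gamma> t" "g c = y"
        using P(1) le cde y unfolding P_def by (meson order_trans)
      then have "g d \<in> topspace Y" "p (g d) = \<gamma> d"
        using cde by (auto simp: continuous_map_def Pi_iff)
      then obtain k where k: "continuous_map (top_of_set {d..e}) Y k" "\<forall>t\<in>{d..e}. p (k t) = \<gamma> t" "k d = g d"
        using P(2) le cde unfolding P_def by (meson order_trans)
      have "continuous_map (top_of_set {c..e}) Y (\<lambda>t. if t \<le> d then g t else k t)"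
      proof (rule continuous_map_cases_le)
        have "{x \<in> topspace (top_of_set {c..e}). x \<le> d} = {c..d}" "{x \<in> topspace (top_of_set {c..e}). d \<le> x} = {d..e}"
          using cde by auto
        then show "continuous_map (subtopology (top_of_set {c..e}) {x \<in> topspace (top_of_set {c..e}). x \<le> d}) Y g"
          "continuous_map (subtopology (top_of_set {c..e}) {x \<in> topspace (top_of_set {c..e}). d \<le> x}) Y k"
          using g k cde by (simp_all add: subtopology_subtopology Int_absorb1)
      qed (use k in auto)
      then show "\<exists>g. continuous_map (top_of_set {c..e}) Y g \<and> (\<forall>t\<in>{c..e}. p (g t) = \<gamma> t) \<and> g c = y"
        by (intro exI[of _ "\<lambda>t. if t \<le> d then g t else k t"]) (use g k cde in auto)
    qed
  next
    fix s assume s: "a \<le> s" "s \<le> b"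
    then have "\<gamma> s \<in> topspace X"
      using \<gamma> by (auto simp: continuous_map_def Pi_iff)
    then obtain U where U: "openin X U" "\<gamma> s \<in> U"
      "\<And>y. y \<in> topspace Y \<Longrightarrow> p y \<in> U \<Longrightarrow> \<exists>\<sigma>. local_section X (Y, p) U \<sigma> \<and> \<sigma> (p y) = y"
      by (rule cover_local_sections[OF c]) blast
    obtain \<delta> where \<delta>: "\<delta> > 0" "\<And>t. t \<in> {a..b} \<Longrightarrow> \<bar>t - s\<bar> < \<delta> \<Longrightarrow> \<gamma> t \<in> U"
      using open_preimage_interval[OF \<gamma> U(1), of s] s U(2) by auto
    have "P c d" if cd: "c \<le> s" "s \<le> d" "d - c < \<delta>" for c d
      unfolding P_def
    proof (intro impI ballI)
      fix y assume le: "a \<le> c" "d \<le> b" and y: "y \<in> topspace Y" "p y = \<gamma> c"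
      have inU: "\<gamma> t \<in> U" if "t \<in> {c..d}" for t
        using that cd le by (intro \<delta>(2)) auto
      then obtain \<sigma> where \<sigma>: "local_section X (Y, p) U \<sigma>" "\<sigma> (\<gamma> c) = y"
        using U(3)[OF y(1)] y(2) cd by force
      have "continuous_map (top_of_set {c..d}) (subtopology X U) \<gamma>"
        using inU continuous_map_from_subtopology_mono[OF \<gamma>, of "{c..d}"] le
        by (auto simp: continuous_map_in_subtopology)
      then have "continuous_map (top_of_set {c..d}) Y (\<sigma> \<circ> \<gamma>)"
        using \<sigma> continuous_map_compose by (fastforce simp: local_section_def)
      then show "\<exists>g. continuous_map (top_of_set {c..d}) Y g \<and> (\<forall>t\<in>{c..d}. p (g t) = \<gamma> t) \<and> g c = y"
        using \<sigma> inU by (intro exI[of _ "\<sigma> \<circ> \<gamma>"]) (auto simp: local_section_def)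
    qed
    then show "\<exists>\<delta>>0. \<forall>c d. c \<le> s \<and> s \<le> d \<and> d - c < \<delta> \<longrightarrow> P c d"
      using \<delta>(1) by blast
  qed
  then show thesis
    using that ab y unfolding P_def by auto
qed

text \<open>A relation instead of an endpoint function: concatenation, reversal and images under
  cover maps then need neither existence nor uniqueness of lifts. The body is the formula inside the
  definition of \<open>monodromy\<close>.\<close>

definition lifts_from_to :: "('y, 'a) space_over \<Rightarrow> (real \<Rightarrow> 'a) \<Rightarrow> 'y \<Rightarrow> 'y \<Rightarrow> bool" where
  "lifts_from_to = (\<lambda>(Y, p) \<gamma> y z.
     \<exists>\<gamma>'. pathin Y \<gamma>' \<and> \<gamma>' 0 = y \<and> (\<forall>t\<in>{0..1}. p (\<gamma>' t) = \<gamma> t) \<and> \<gamma>' 1 = z)"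

lemma lifts_from_to_ends:
  assumes "lifts_from_to (Y, p) \<gamma> y z"
  shows "y \<in> topspace Y" "z \<in> topspace Y" "p y = \<gamma> 0" "p z = \<gamma> 1"
  using assms path_start_in_topspace path_finish_in_topspace by (fastforce simp: lifts_from_to_def)+

lemma lifts_from_to_exists:
  assumes "is_cover X (Y, p)" "pathin X \<gamma>" "y \<in> topspace Y" "p y = \<gamma> 0"
  obtains z where "lifts_from_to (Y, p) \<gamma> y z"
proof -
  obtain g where "continuous_map unit_interval Y g" "\<And>t. t \<in> {0..1} \<Longrightarrow> p (g t) = \<gamma> t" "g 0 = y"
    using path_lift_interval[OF assms(1), of 0 1 \<gamma> y] assms by (auto simp: pathin_def)
  then have "lifts_from_to (Y, p) \<gamma> y (g 1)"
    unfolding lifts_from_to_def pathin_def prod.case by blast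
  then show thesis
    by (rule that)
qed

lemma lifts_from_to_unique:
  assumes "is_cover X (Y, p)" "lifts_from_to (Y, p) \<gamma> y z" "lifts_from_to (Y, p) \<gamma> y z'"
  shows "z = z'"
proof -
  obtain g k where "pathin Y g" "g 0 = y" "\<forall>t\<in>{0..1}. p (g t) = \<gamma> t" "g 1 = z"
    "pathin Y k" "k 0 = y" "\<forall>t\<in>{0..1}. p (k t) = \<gamma> t" "k 1 = z'"
    using assms(2,3) by (auto simp: lifts_from_to_def)
  then show ?thesis
    using lift_unique[OF assms(1) connected_space_interval, of 0 1 g k 0 1] by (auto simp: pathin_def)
qed

lemma lifts_from_to_join:
  assumes "lifts_from_to (Y, p) \<gamma> y z" "lifts_from_to (Y, p) \<delta> z w"
  shows "lifts_from_to (Y, p) (path_join \<gamma> \<delta>) y w"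
proof -
  obtain g k where g: "pathin Y g" "g 0 = y" "\<forall>t\<in>{0..1}. p (g t) = \<gamma> t" "g 1 = z"
    and k: "pathin Y k" "k 0 = z" "\<forall>t\<in>{0..1}. p (k t) = \<delta> t" "k 1 = w"
    using assms by (auto simp: lifts_from_to_def)
  have "p (path_join g k t) = path_join \<gamma> \<delta> t" if "t \<in> {0..1}" for t
    using g k that by (auto simp: path_join_def)
  then show ?thesis
    using g k pathin_join[of Y g k] by (auto simp: lifts_from_to_def intro!: exI[of _ "path_join g k"])
qed

lemma lifts_from_to_rev:
  assumes "lifts_from_to (Y, p) \<gamma> y z"
  shows "lifts_from_to (Y, p) (path_rev \<gamma>) z y"
proof -
  obtain g where g: "pathin Y g" "g 0 = y" "\<forall>t\<in>{0..1}. p (g t) = \<gamma> t" "g 1 = z"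
    using assms by (auto simp: lifts_from_to_def)
  then have "\<forall>t\<in>{0..1}. p (path_rev g t) = path_rev \<gamma> t"
    by (auto simp: path_rev_def)
  then show ?thesis
    using g pathin_rev[of Y g] by (auto simp: lifts_from_to_def intro!: exI[of _ "path_rev g"])
qed

lemma lifts_from_to_const: "y \<in> topspace Y \<Longrightarrow> lifts_from_to (Y, p) (\<lambda>t. p y) y y"
  by (auto simp: lifts_from_to_def intro!: exI[of _ "\<lambda>t. y"])

lemma lifts_from_to_map:
  assumes "f \<in> cover_maps (Y, p) (Z, q)" "lifts_from_to (Y, p) \<gamma> y z"
  shows "lifts_from_to (Z, q) \<gamma> (f y) (f z)"
proof -
  obtain g where g: "pathin Y g" "g 0 = y" "\<forall>t\<in>{0..1}. p (g t) = \<gamma> t" "g 1 = z"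
    using assms by (auto simp: lifts_from_to_def)
  then have "g \<in> {0..1} \<rightarrow> topspace Y"
    by (simp add: path_image_subset_topspace)
  then have "\<forall>t\<in>{0..1}. q (f (g t)) = \<gamma> t"
    using g assms(1) by (auto simp: cover_maps_def Pi_iff)
  then show ?thesis
    using g assms(1) pathin_compose[of Y g Z f]
    by (auto simp: lifts_from_to_def cover_maps_def intro!: exI[of _ "f \<circ> g"])
qed

text \<open>By uniqueness of lifts: over \<open>U\<close> the composite of \<open>\<sigma>\<close>
  and \<open>\<gamma>\<close> is a lift with the same start.\<close>

lemma lift_in_section:
  fixes a b :: real
  assumes c: "is_cover X (Y, p)" and \<sigma>: "local_section X (Y, p) U \<sigma>"
    and \<gamma>: "continuous_map (top_of_set {a..b}) X \<gamma>" "\<And>t. t \<in> {a..b} \<Longrightarrow> \<gamma> t \<in> U"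
    and g: "continuous_map (top_of_set {a..b}) Y g" "\<And>t. t \<in> {a..b} \<Longrightarrow> p (g t) = \<gamma> t"
    and ga: "g a = \<sigma> (\<gamma> a)" and t: "t \<in> {a..b}"
  shows "g t = \<sigma> (\<gamma> t)"
proof -
  have "continuous_map (top_of_set {a..b}) (subtopology X U) \<gamma>"
    using \<gamma> by (auto simp: continuous_map_in_subtopology)
  then have \<sigma>\<gamma>: "continuous_map (top_of_set {a..b}) Y (\<sigma> \<circ> \<gamma>)"
    using \<sigma> continuous_map_compose by (fastforce simp: local_section_def)
  have "g t = (\<sigma> \<circ> \<gamma>) t"
  proof (rule lift_unique[OF c connected_space_interval g(1) \<sigma>\<gamma>])
    show "p (g s) = p ((\<sigma> \<circ> \<gamma>) s)" if "s \<in> topspace (top_of_set {a..b})" for s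
      using that \<gamma>(2)[of s] g(2)[of s] \<sigma> by (simp add: local_section_def)
    show "a \<in> topspace (top_of_set {a..b})" "t \<in> topspace (top_of_set {a..b})" "g a = (\<sigma> \<circ> \<gamma>) a"
      using t ga by auto
  qed
  then show ?thesis by simp
qed

section \<open>Homotopy invariance of lifting\<close>

lemma continuous_map_slice:
  assumes h: "continuous_map (prod_topology unit_interval unit_interval) X h"
  shows "t \<in> {0..1} \<Longrightarrow> {a..b} \<subseteq> {0..1} \<Longrightarrow> continuous_map (top_of_set {a..b}) X (\<lambda>s. h (t, s))"
    and "s \<in> {0..1} \<Longrightarrow> continuous_map unit_interval X (\<lambda>t. h (t, s))"
proof -
  show "continuous_map (top_of_set {a..b}) X (\<lambda>s. h (t, s))" if t: "t \<in> {0..1}" "{a..b} \<subseteq> {0..1}"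
  proof -
    have "continuous_map (top_of_set {a..b}) (prod_topology unit_interval unit_interval) (\<lambda>s. (t, s))"
      using t by (intro continuous_map_pairedI) (auto simp: continuous_map_in_subtopology)
    from continuous_map_compose[OF this h] show ?thesis
      by (simp add: o_def)
  qed
  show "continuous_map unit_interval X (\<lambda>t. h (t, s))" if s: "s \<in> {0..1}"
  proof -
    have "continuous_map unit_interval (prod_topology unit_interval unit_interval) (\<lambda>t. (t, s))"
      using s by (intro continuous_map_pairedI) (auto simp: continuous_map_in_subtopology)
    from continuous_map_compose[OF this h] show ?thesis
      by (simp add: o_def)
  qed
qed

lemma open_preimage_square:
  assumes h: "continuous_map (prod_topology unit_interval unit_interval) X h" and U: "openin X U"
    and ts: "t \<in> {0..1}" "s \<in> {0..1}" "h (t, s) \<in> U"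
  obtains d where "d > 0"
    "\<And>t' s'. t' \<in> {0..1} \<Longrightarrow> s' \<in> {0..1} \<Longrightarrow> \<bar>t' - t\<bar> < d \<Longrightarrow> \<bar>s' - s\<bar> < d \<Longrightarrow> h (t', s') \<in> U"
proof -
  have "openin (prod_topology unit_interval unit_interval)
      {q \<in> topspace (prod_topology unit_interval unit_interval). h q \<in> U}"
    by (rule openin_continuous_map_preimage[OF h U])
  moreover have "(t, s) \<in> {q \<in> topspace (prod_topology unit_interval unit_interval). h q \<in> U}"
    using ts by simp
  ultimately obtain A B where AB: "openin unit_interval A" "openin unit_interval B" "t \<in> A" "s \<in> B"
    "A \<times> B \<subseteq> {q \<in> topspace (prod_topology unit_interval unit_interval). h q \<in> U}"
    unfolding openin_prod_topology_alt by (elim allE impE exE conjE)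
  obtain d where d: "d > 0" "\<And>t'. t' \<in> {0..1} \<Longrightarrow> \<bar>t' - t\<bar> < d \<Longrightarrow> t' \<in> A"
    using open_preimage_interval[of 0 1 unit_interval id A t] AB ts by auto
  obtain e where e: "e > 0" "\<And>s'. s' \<in> {0..1} \<Longrightarrow> \<bar>s' - s\<bar> < e \<Longrightarrow> s' \<in> B"
    using open_preimage_interval[of 0 1 unit_interval id B s] AB ts by auto
  show thesis
  proof (rule that[of "min d e"])
    fix t' s' assume "t' \<in> {0..1}" "s' \<in> {0..1}" "\<bar>t' - t\<bar> < min d e" "\<bar>s' - s\<bar> < min d e"
    then have "(t', s') \<in> A \<times> B"
      using d e by auto
    then show "h (t', s') \<in> U"
      using AB(5) by blast
  qed (use d e in auto)
qed

text \<open>The end of a lift depends continuously on both the slice \<open>t\<close> of the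
  homotopy and the start of the lift. Over a short piece of the path the lift lies in a single
  section, where this is clear; bisection along the path then chains the pieces.\<close>

lemma lift_end_continuous:
  fixes h :: "real \<times> real \<Rightarrow> 'a"
  assumes c: "is_cover X (Y, p)" and h: "continuous_map (prod_topology unit_interval unit_interval) X h"
    and t0: "t0 \<in> {0..1}"
    and g0: "pathin Y g0" "\<And>s. s \<in> {0..1} \<Longrightarrow> p (g0 s) = h (t0, s)" and W: "openin Y W" "g0 1 \<in> W"
  obtains e W' where "e > 0" "openin Y W'" "g0 0 \<in> W'"
    "\<And>t g. t \<in> {0..1} \<Longrightarrow> \<bar>t - t0\<bar> < e \<Longrightarrow> pathin Y g \<Longrightarrow>
      (\<And>s. s \<in> {0..1} \<Longrightarrow> p (g s) = h (t, s)) \<Longrightarrow> g 0 \<in> W' \<Longrightarrow> g 1 \<in> W"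
proof -
  define lift where "lift t a b g \<longleftrightarrow> continuous_map (top_of_set {a..b}) Y g \<and> (\<forall>s\<in>{a..b}. p (g s) = h (t, s))"
    for t a b :: real and g
  \<comment> \<open>\<open>W\<close> is quantified inside \<open>Q\<close> because neighbourhoods
    are pulled back from right to left: the neighbourhood found at the start of the second piece is
    the target for the first.\<close>
  define Q where "Q a b \<longleftrightarrow> (0 \<le> a \<longrightarrow> b \<le> 1 \<longrightarrow> a \<le> b \<longrightarrow> (\<forall>g0 W. lift t0 a b g0 \<longrightarrow> openin Y W \<longrightarrow> g0 b \<in> W \<longrightarrow>
     (\<exists>e>0. \<exists>W'. openin Y W' \<and> g0 a \<in> W' \<and>
        (\<forall>t\<in>{0..1}. \<bar>t - t0\<bar> < e \<longrightarrow> (\<forall>g. lift t a b g \<longrightarrow> g a \<in> W' \<longrightarrow> g b \<in> W)))))" for a b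
  have lift_mono: "lift t a b g" if "lift t c d g" "{a..b} \<subseteq> {c..d}" for t a b c d g
    using that continuous_map_from_subtopology_mono by (fastforce simp: lift_def)
  have "Q 0 1"
  proof (rule Bolzano)
    fix a b d assume Q: "Q a b" "Q b d" and ab: "a \<le> b" "b \<le> d"
    show "Q a d"
      unfolding Q_def
    proof (intro impI allI)
      fix g0 W assume le: "0 \<le> a" "d \<le> 1" "a \<le> d" and g0: "lift t0 a d g0" and W: "openin Y W" "g0 d \<in> W"
      have sub: "{a..b} \<subseteq> {a..d}" "{b..d} \<subseteq> {a..d}"
        using ab by auto
      have "0 \<le> b" "b \<le> 1"
        using le ab by auto
      then obtain e W' where e: "e > 0" "openin Y W'" "g0 b \<in> W'"
        "\<forall>t\<in>{0..1}. \<bar>t - t0\<bar> < e \<longrightarrow> (\<forall>g. lift t b d g \<longrightarrow> g b \<in> W' \<longrightarrow> g d \<in> W)"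
        using Q(2) le ab W lift_mono[OF g0 sub(2)] unfolding Q_def by blast
      obtain e' W'' where e': "e' > 0" "openin Y W''" "g0 a \<in> W''"
        "\<forall>t\<in>{0..1}. \<bar>t - t0\<bar> < e' \<longrightarrow> (\<forall>g. lift t a b g \<longrightarrow> g a \<in> W'' \<longrightarrow> g b \<in> W')"
        using Q(1) le ab \<open>b \<le> 1\<close> e(2,3) lift_mono[OF g0 sub(1)] unfolding Q_def by blast
      have "\<forall>t\<in>{0..1}. \<bar>t - t0\<bar> < min e e' \<longrightarrow> (\<forall>g. lift t a d g \<longrightarrow> g a \<in> W'' \<longrightarrow> g d \<in> W)"
        using e(4) e'(4) lift_mono[OF _ sub(1)] lift_mono[OF _ sub(2)] by (metis min_less_iff_conj)
      then show "\<exists>e>0. \<exists>W'. openin Y W' \<and> g0 a \<in> W' \<and>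
          (\<forall>t\<in>{0..1}. \<bar>t - t0\<bar> < e \<longrightarrow> (\<forall>g. lift t a d g \<longrightarrow> g a \<in> W' \<longrightarrow> g d \<in> W))"
        using e' e by (intro exI[of _ "min e e'"]) auto
    qed
  next
    fix s0 :: real assume s0: "0 \<le> s0" "s0 \<le> 1"
    then have "h (t0, s0) \<in> topspace X"
      using continuous_map_slice(1)[OF h t0, of 0 1] by (auto simp: continuous_map_def Pi_iff)
    then obtain U where U: "openin X U" "h (t0, s0) \<in> U"
      "\<And>y. y \<in> topspace Y \<Longrightarrow> p y \<in> U \<Longrightarrow> \<exists>\<sigma>. local_section X (Y, p) U \<sigma> \<and> \<sigma> (p y) = y"
      by (rule cover_local_sections[OF c]) blast
    obtain d where d: "d > 0"
      "\<And>t s. t \<in> {0..1} \<Longrightarrow> s \<in> {0..1} \<Longrightarrow> \<bar>t - t0\<bar> < d \<Longrightarrow> \<bar>s - s0\<bar> < d \<Longrightarrow> h (t, s) \<in> U"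
      using open_preimage_square[OF h U(1) t0 _ U(2)] s0 by auto
    have "Q a b" if ab: "a \<le> s0" "s0 \<le> b" "b - a < d" for a b
      unfolding Q_def
    proof (intro impI allI)
      fix g0 W assume le: "0 \<le> a" "b \<le> 1" "a \<le> b" and g0: "lift t0 a b g0" and W: "openin Y W" "g0 b \<in> W"
      have sub: "{a..b} \<subseteq> {0..1}"
        using le by auto
      have inU: "h (t, s) \<in> U" if "t \<in> {0..1}" "\<bar>t - t0\<bar> < d" "s \<in> {a..b}" for t s
        using that ab le by (intro d(2)) auto
      have "g0 a \<in> topspace Y" "p (g0 a) = h (t0, a)"
        using g0 le by (auto simp: lift_def continuous_map_def Pi_iff)
      then obtain \<sigma> where \<sigma>: "local_section X (Y, p) U \<sigma>" "\<sigma> (h (t0, a)) = g0 a"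
        using U(3)[of "g0 a"] inU[of t0 a] t0 le d(1) by auto
      have end_eq: "g b = \<sigma> (h (t, b))"
        if "t \<in> {0..1}" "\<bar>t - t0\<bar> < d" "lift t a b g" "g a = \<sigma> (h (t, a))" for t g
        by (rule lift_in_section[OF c \<sigma>(1) continuous_map_slice(1)[OF h that(1) sub], of g b])
          (use that le(3) inU in \<open>simp_all add: lift_def\<close>)
      have "g0 b = \<sigma> (h (t0, b))"
        using end_eq[of t0 g0] t0 d(1) g0 \<sigma>(2) by simp
      let ?T = "{u \<in> U. \<sigma> u \<in> W}"
      have "openin X ?T"
        using \<sigma>(1) U(1) W(1) by (rule openin_section_preimage)
      moreover have "h (t0, b) \<in> ?T"
        using inU[of t0 b] t0 d(1) le W(2) \<open>g0 b = _\<close> by auto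
      ultimately obtain e where e: "e > 0" "\<And>t. t \<in> {0..1} \<Longrightarrow> \<bar>t - t0\<bar> < e \<Longrightarrow> h (t, b) \<in> ?T"
        using open_preimage_interval[OF continuous_map_slice(2)[OF h, of b], of ?T t0] t0 le
        by auto
      have "g b \<in> W" if t: "t \<in> {0..1}" "\<bar>t - t0\<bar> < min d e" and g: "lift t a b g" "g a \<in> \<sigma> ` U" for t g
      proof -
        obtain u where u: "u \<in> U" "g a = \<sigma> u"
          using g(2) by blast
        have "u = p (g a)"
          using \<sigma>(1) u by (simp add: local_section_def)
        also have "\<dots> = h (t, a)"
          using g(1) le by (simp add: lift_def)
        finally have "g a = \<sigma> (h (t, a))"
          using u(2) by simp
        then show ?thesis
          using end_eq[of t g] e(2)[of t] t g(1) by auto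
      qed
      moreover have "openin Y (\<sigma> ` U)" "g0 a \<in> \<sigma> ` U"
        using \<sigma> inU[of t0 a] t0 d(1) le by (auto simp: local_section_def image_iff intro!: bexI[of _ "h (t0, a)"])
      ultimately show "\<exists>e>0. \<exists>W'. openin Y W' \<and> g0 a \<in> W' \<and>
          (\<forall>t\<in>{0..1}. \<bar>t - t0\<bar> < e \<longrightarrow> (\<forall>g. lift t a b g \<longrightarrow> g a \<in> W' \<longrightarrow> g b \<in> W))"
        using d(1) e(1) by (intro exI[of _ "min d e"] conjI exI[of _ "\<sigma> ` U"]) auto
    qed
    then show "\<exists>d>0. \<forall>a b. a \<le> s0 \<and> s0 \<le> b \<and> b - a < d \<longrightarrow> Q a b"
      using d(1) by blast
  qed simp
  moreover have "lift t0 0 1 g0"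
    using g0 by (auto simp: lift_def pathin_def)
  ultimately obtain e W' where "e > 0" "openin Y W'" "g0 0 \<in> W'"
    "\<forall>t\<in>{0..1}. \<bar>t - t0\<bar> < e \<longrightarrow> (\<forall>g. lift t 0 1 g \<longrightarrow> g 0 \<in> W' \<longrightarrow> g 1 \<in> W)"
    using W unfolding Q_def by (metis order_refl zero_le_one)
  then show thesis
    by (intro that[of e W']) (auto simp: lift_def pathin_def)
qed

text \<open>Lifts of all slices from \<open>y\<close> end in one fibre, where each sheet has only
  one point. As their ends vary continuously, they are locally constant in \<open>t\<close>, hence
  constant by bisection.\<close>

theorem lifts_from_to_homotopic:
  assumes c: "is_cover X (Y, p)" and hom: "path_homotopic X \<gamma> \<delta>" and \<gamma>: "lifts_from_to (Y, p) \<gamma> y z"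
  shows "lifts_from_to (Y, p) \<delta> y z"
proof -
  obtain h where h: "continuous_map (prod_topology unit_interval unit_interval) X h"
      "\<forall>s\<in>{0..1}. h (0, s) = \<gamma> s" "\<forall>s\<in>{0..1}. h (1, s) = \<delta> s"
      "\<forall>t\<in>{0..1}. h (t, 0) = \<gamma> 0 \<and> h (t, 1) = \<gamma> 1"
    using hom unfolding path_homotopic_iff by (elim exE conjE)
  note y = lifts_from_to_ends[OF \<gamma>]
  have "\<forall>t\<in>{0..1}. \<exists>g. pathin Y g \<and> g 0 = y \<and> (\<forall>s\<in>{0..1}. p (g s) = h (t, s))"
  proof
    fix t :: real assume t: "t \<in> {0..1}"
    then have "pathin X (\<lambda>s. h (t, s))"
      using continuous_map_slice(1)[OF h(1) t, of 0 1] by (simp add: pathin_def)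
    then obtain w where "lifts_from_to (Y, p) (\<lambda>s. h (t, s)) y w"
      using lifts_from_to_exists[OF c, of "\<lambda>s. h (t, s)" y] y h(4) t by auto
    then show "\<exists>g. pathin Y g \<and> g 0 = y \<and> (\<forall>s\<in>{0..1}. p (g s) = h (t, s))"
      by (auto simp: lifts_from_to_def)
  qed
  then obtain g where g: "\<And>t. t \<in> {0..1} \<Longrightarrow> pathin Y (g t)" "\<And>t. t \<in> {0..1} \<Longrightarrow> g t 0 = y"
    "\<And>t s. t \<in> {0..1} \<Longrightarrow> s \<in> {0..1} \<Longrightarrow> p (g t s) = h (t, s)"
    by (metis (no_types, lifting) bchoice)
  have pg: "p (g t 1) = \<gamma> 1" if "t \<in> {0..1}" for t
    using g(3)[OF that, of 1] h(4) that by simp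
  have "0 \<le> (0::real) \<longrightarrow> 1 \<le> (1::real) \<longrightarrow> g 0 1 = g 1 1"
  proof (rule Bolzano[where P = "\<lambda>a b. 0 \<le> a \<longrightarrow> b \<le> 1 \<longrightarrow> g a 1 = g b 1"])
    fix t0 :: real assume "0 \<le> t0" "t0 \<le> 1"
    then have t0: "t0 \<in> {0..1}" by simp
    then have gt: "g t0 1 \<in> topspace Y" "p (g t0 1) = \<gamma> 1"
      using path_finish_in_topspace g(1) pg by auto
    obtain U \<sigma> where U: "\<gamma> 1 \<in> U" and \<sigma>: "local_section X (Y, p) U \<sigma>" "\<sigma> (\<gamma> 1) = g t0 1"
      using cover_section_at[OF c gt(1)] unfolding gt(2) .
    then have W: "openin Y (\<sigma> ` U)" "g t0 1 \<in> \<sigma> ` U"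
      using U by (auto simp: local_section_def image_iff intro!: bexI[of _ "\<gamma> 1"])
    obtain e W' where e: "e > 0" "openin Y W'" "g t0 0 \<in> W'"
      "\<And>t f. t \<in> {0..1} \<Longrightarrow> \<bar>t - t0\<bar> < e \<Longrightarrow> pathin Y f \<Longrightarrow>
        (\<And>s. s \<in> {0..1} \<Longrightarrow> p (f s) = h (t, s)) \<Longrightarrow> f 0 \<in> W' \<Longrightarrow> f 1 \<in> \<sigma> ` U"
      using lift_end_continuous[OF c h(1) t0 g(1)[OF t0] g(3)[OF t0] W] by metis
    have near: "g t 1 = g t0 1" if t: "t \<in> {0..1}" "\<bar>t - t0\<bar> < e" for t
    proof -
      have "g t 1 \<in> \<sigma> ` U"
        using e(3) g(2)[OF t0] g(2)[OF t(1)] by (intro e(4)[OF t g(1)[OF t(1)] g(3)[OF t(1)]]) auto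
      then show ?thesis
        using \<sigma> pg[OF t(1)] by (auto simp: local_section_def)
    qed
    have "0 \<le> a \<longrightarrow> b \<le> 1 \<longrightarrow> g a 1 = g b 1" if "a \<le> t0" "t0 \<le> b" "b - a < e" for a b
    proof (intro impI)
      assume "0 \<le> a" "b \<le> 1"
      then have "g a 1 = g t0 1" "g b 1 = g t0 1"
        using that t0 by (auto intro!: near)
      then show "g a 1 = g b 1" by simp
    qed
    then show "\<exists>d>0. \<forall>a b. a \<le> t0 \<and> t0 \<le> b \<and> b - a < d \<longrightarrow> 0 \<le> a \<longrightarrow> b \<le> 1 \<longrightarrow> g a 1 = g b 1"
      using e(1) by blast
  qed auto
  moreover have "lifts_from_to (Y, p) \<gamma> y (g 0 1)" "lifts_from_to (Y, p) \<delta> y (g 1 1)"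
    using g[of 0] g[of 1] h(2,3) by (auto simp: lifts_from_to_def)
  ultimately show ?thesis
    using lifts_from_to_unique[OF c \<gamma>] by auto
qed

section \<open>Continuity of maps that respect lifts\<close>

lemma section_lifts_from_to:
  assumes "local_section X (Y, p) U \<sigma>" "pathin (subtopology X U) \<beta>"
  shows "lifts_from_to (Y, p) \<beta> (\<sigma> (\<beta> 0)) (\<sigma> (\<beta> 1))"
proof -
  have "pathin Y (\<sigma> \<circ> \<beta>)"
    using assms pathin_compose by (auto simp: local_section_def)
  moreover have "\<forall>t\<in>{0..1}. p (\<sigma> (\<beta> t)) = \<beta> t"
    using assms by (auto simp: local_section_def pathin_subtopology)
  ultimately show ?thesis
    unfolding lifts_from_to_def by (auto intro!: exI[of _ "\<sigma> \<circ> \<beta>"])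
qed

lemma openin_section_image:
  assumes p: "continuous_map Y X p" and \<sigma>: "local_section X (Y, p) U \<sigma>" and V: "openin X V" "V \<subseteq> U"
  shows "openin Y (\<sigma> ` V)"
proof -
  have "\<sigma> ` V = \<sigma> ` U \<inter> {y \<in> topspace Y. p y \<in> V}"
    using \<sigma> V(2) openin_subset[of Y "\<sigma> ` U"] by (auto simp: local_section_def)
  then show ?thesis
    using \<sigma> openin_continuous_map_preimage[OF p V(1)] by (auto simp: local_section_def)
qed

text \<open>Sections carry small path connected open sets up to \<open>Y\<close>. The purpose is
  that connected covers become path connected.\<close>

lemma locally_path_connected_cover:
  assumes X: "locally_path_connected_space X" and c: "is_cover X (Y, p)"
  shows "locally_path_connected_space Y"
  unfolding locally_path_connected_space
proof (intro allI impI)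
  fix V y assume V: "openin Y V \<and> y \<in> V"
  then have y: "y \<in> topspace Y"
    using openin_subset by blast
  obtain U \<sigma> where U: "openin X U" "p y \<in> U" and \<sigma>: "local_section X (Y, p) U \<sigma>" "\<sigma> (p y) = y"
    using cover_section_at[OF c y] .
  let ?T = "{u \<in> U. \<sigma> u \<in> V}"
  have \<sigma>_cont: "continuous_map (subtopology X U) Y \<sigma>"
    using \<sigma>(1) by (simp add: local_section_def)
  have "openin X ?T" "p y \<in> ?T"
    using openin_section_preimage[OF \<sigma>(1) U(1)] V U(2) \<sigma>(2) by auto
  then obtain T where T: "openin X T" "path_connectedin X T" "p y \<in> T" "T \<subseteq> ?T"
    using X unfolding locally_path_connected_space by meson
  then have TU: "T \<subseteq> U" by auto
  have "path_connectedin (subtopology X U) T"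
    using T(2) TU by (simp add: path_connectedin_subtopology)
  then have "path_connectedin Y (\<sigma> ` T)"
    by (rule path_connectedin_continuous_map_image[OF \<sigma>_cont])
  moreover have "openin Y (\<sigma> ` T)"
    using openin_section_image[OF cover_continuous[OF c] \<sigma>(1) T(1) TU] .
  moreover have "y \<in> \<sigma> ` T" "\<sigma> ` T \<subseteq> V"
    using \<sigma>(2) T by (force, auto)
  ultimately show "\<exists>U. openin Y U \<and> path_connectedin Y U \<and> y \<in> U \<and> U \<subseteq> V"
    by blast
qed

text \<open>Near \<open>y\<close> the map \<open>F\<close> equals the section \<open>\<tau>\<close>
  through \<open>F y\<close> after \<open>p\<close>: a nearby point is the end of the lift of a path
  in a small path connected set \<open>T\<close>, and \<open>F\<close> must send it to the end of
  the lift of the same path to \<open>Z\<close>.\<close>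

lemma continuous_map_if_lifts_from_to:
  assumes X: "locally_path_connected_space X" and c: "is_cover X (Y, p)" and d: "is_cover X (Z, q)"
    and F: "\<And>y. y \<in> topspace Y \<Longrightarrow> F y \<in> topspace Z \<and> q (F y) = p y"
    and lifts: "\<And>\<beta> y y'. lifts_from_to (Y, p) \<beta> y y' \<Longrightarrow> pathin X \<beta> \<Longrightarrow> lifts_from_to (Z, q) \<beta> (F y) (F y')"
  shows "continuous_map Y Z F"
  unfolding continuous_map
proof (intro conjI allI impI)
  fix W assume W: "openin Z W"
  show "openin Y {y \<in> topspace Y. F y \<in> W}"
  proof (subst openin_subopen, intro ballI)
    fix y assume "y \<in> {y \<in> topspace Y. F y \<in> W}"
    then have y: "y \<in> topspace Y" "F y \<in> W" by auto
    obtain U \<sigma> where U: "openin X U" "p y \<in> U" and \<sigma>: "local_section X (Y, p) U \<sigma>" "\<sigma> (p y) = y"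
      using cover_section_at[OF c y(1)] .
    have Fy: "F y \<in> topspace Z" "q (F y) = p y"
      using F[OF y(1)] by auto
    obtain U' \<tau> where U': "openin X U'" "p y \<in> U'" and \<tau>: "local_section X (Z, q) U' \<tau>" "\<tau> (p y) = F y"
      using cover_section_at[OF d Fy(1)] unfolding Fy(2) .
    let ?T = "{u \<in> U'. \<tau> u \<in> W}"
    have "openin X ?T"
      using \<tau>(1) U'(1) W by (rule openin_section_preimage)
    then have "openin X (U \<inter> ?T)"
      using U(1) by blast
    moreover have "p y \<in> U \<inter> ?T"
      using U U' y \<tau>(2) by auto
    ultimately obtain T where T: "openin X T" "path_connectedin X T" "p y \<in> T" "T \<subseteq> U \<inter> ?T"
      using X unfolding locally_path_connected_space by meson
    have TU: "T \<subseteq> U" "T \<subseteq> U'"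
      using T(4) by auto
    have "openin Y (\<sigma> ` T)"
      using openin_section_image[OF cover_continuous[OF c] \<sigma>(1) T(1) TU(1)] .
    moreover have "y \<in> \<sigma> ` T"
      using \<sigma>(2) T(3) by force
    moreover have "\<sigma> ` T \<subseteq> {y \<in> topspace Y. F y \<in> W}"
    proof
      fix w assume "w \<in> \<sigma> ` T"
      then obtain u where u: "u \<in> T" "w = \<sigma> u" by blast
      then obtain \<beta> where \<beta>: "pathin X \<beta>" "\<beta> \<in> {0..1} \<rightarrow> T" "\<beta> 0 = p y" "\<beta> 1 = u"
        using T(2,3) unfolding path_connectedin by blast
      then have "pathin (subtopology X U) \<beta>" "pathin (subtopology X U') \<beta>"
        using TU by (auto simp: pathin_subtopology Pi_iff)
      then have "lifts_from_to (Y, p) \<beta> y w" "lifts_from_to (Z, q) \<beta> (F y) (\<tau> u)"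
        using section_lifts_from_to[OF \<sigma>(1)] section_lifts_from_to[OF \<tau>(1)] \<beta> \<sigma>(2) \<tau>(2) u by metis+
      then have "F w = \<tau> u"
        using lifts_from_to_unique[OF d lifts] \<beta>(1) by blast
      moreover have "w \<in> topspace Y"
        using \<open>lifts_from_to (Y, p) \<beta> y w\<close> lifts_from_to_ends by metis
      ultimately show "w \<in> {y \<in> topspace Y. F y \<in> W}"
        using T(4) u by auto
    qed
    ultimately show "\<exists>T. openin Y T \<and> y \<in> T \<and> T \<subseteq> {y \<in> topspace Y. F y \<in> W}"
      by blast
  qed
qed (use F in auto)

section \<open>The monodromy action\<close>

text \<open>The action of the inverse element inverts \<open>\<phi> g\<close>, so bijectivity
  follows from the two action laws.\<close>

lemma group_actionI:
  assumes "group G"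
    and "\<And>g. g \<in> carrier G \<Longrightarrow> \<phi> g \<in> extensional E"
    and closed: "\<And>g s. g \<in> carrier G \<Longrightarrow> s \<in> E \<Longrightarrow> \<phi> g s \<in> E"
    and one: "\<And>s. s \<in> E \<Longrightarrow> \<phi> \<one>\<^bsub>G\<^esub> s = s"
    and mult: "\<And>g h s. g \<in> carrier G \<Longrightarrow> h \<in> carrier G \<Longrightarrow> s \<in> E \<Longrightarrow> \<phi> (g \<otimes>\<^bsub>G\<^esub> h) s = \<phi> g (\<phi> h s)"
  shows "group_action G E \<phi>"
proof -
  interpret group G by fact
  have Bij: "\<phi> g \<in> Bij E" if g: "g \<in> carrier G" for g
  proof -
    have "bij_betw (\<phi> g) E E"
      by (rule bij_betw_byWitness[where f' = "\<phi> (inv\<^bsub>G\<^esub> g)"])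
        (use g closed one in \<open>auto simp flip: mult\<close>)
    then show ?thesis
      using assms(2)[OF g] by (simp add: Bij_def)
  qed
  have "\<phi> (g \<otimes>\<^bsub>G\<^esub> h) = compose E (\<phi> g) (\<phi> h)" if gh: "g \<in> carrier G" "h \<in> carrier G" for g h
    using gh assms(2) mult by (intro extensionalityI[of _ E]) (auto simp: compose_def)
  then have "\<phi> \<in> hom G (BijGroup E)"
    using Bij by (auto simp: hom_def BijGroup_def)
  then show ?thesis
    by (auto intro!: group_action.intro group_hom.intro group_hom_axioms.intro group_BijGroup assms(1))
qed

text \<open>Homotopy invariance and uniqueness of lifts resolve the definite description: every
  representative of the class leads to the same end.\<close>

lemma monodromy_eq:
  assumes c: "is_cover X (Y, p)" and \<gamma>: "\<gamma> \<in> loops X x" and l: "lifts_from_to (Y, p) \<gamma> y z"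
  shows "monodromy (Y, p) x (loop_class X x \<gamma>) y = z"
proof -
  have "y \<in> fibre (Y, p) x"
    using lifts_from_to_ends[OF l] \<gamma> by (auto simp: fibre_def loops_def)
  moreover have "(THE z. \<exists>\<gamma>'\<in>loop_class X x \<gamma>. lifts_from_to (Y, p) \<gamma>' y z) = z"
  proof (rule the_equality)
    show "\<exists>\<gamma>'\<in>loop_class X x \<gamma>. lifts_from_to (Y, p) \<gamma>' y z"
      using l equiv_class_self[OF equiv_loop_rel \<gamma>] by blast
  next
    fix w assume "\<exists>\<gamma>'\<in>loop_class X x \<gamma>. lifts_from_to (Y, p) \<gamma>' y w"
    then obtain \<gamma>' where "\<gamma>' \<in> loop_class X x \<gamma>" "lifts_from_to (Y, p) \<gamma>' y w"
      by blast
    then show "w = z"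
      unfolding in_loop_class_iff[OF \<gamma>]
      using lifts_from_to_unique[OF c] lifts_from_to_homotopic[OF c _ l] by blast
  qed
  ultimately show ?thesis
    by (simp add: monodromy_def lifts_from_to_def)
qed

lemma lifts_from_to_monodromy:
  assumes c: "is_cover X (Y, p)" and \<gamma>: "\<gamma> \<in> loops X x" and y: "y \<in> fibre (Y, p) x"
  shows "lifts_from_to (Y, p) \<gamma> y (monodromy (Y, p) x (loop_class X x \<gamma>) y)"
proof -
  obtain z where "lifts_from_to (Y, p) \<gamma> y z"
    using lifts_from_to_exists[OF c, of \<gamma> y] \<gamma> y by (auto simp: fibre_def loops_def)
  then show ?thesis
    using monodromy_eq[OF c \<gamma>] by metis
qed

lemma monodromy_in_fibre:
  assumes "is_cover X (Y, p)" "\<gamma> \<in> loops X x" "y \<in> fibre (Y, p) x"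
  shows "monodromy (Y, p) x (loop_class X x \<gamma>) y \<in> fibre (Y, p) x"
  using lifts_from_to_ends[OF lifts_from_to_monodromy[OF assms]] assms(2)
  by (simp add: fibre_def loops_def)

lemma group_action_monodromy:
  assumes c: "is_cover X (Y, p)" and x: "x \<in> topspace X"
  shows "group_action (fundamental_group X x) (fibre (Y, p) x) (monodromy (Y, p) x)"
proof (rule group_actionI[OF group_fundamental_group[OF x]])
  let ?G = "fundamental_group X x" and ?F = "fibre (Y, p) x" and ?\<mu> = "monodromy (Y, p) x"
  show "?\<mu> a \<in> extensional ?F" for a
    by (simp add: monodromy_def)
  show "?\<mu> a s \<in> ?F" if "a \<in> carrier ?G" "s \<in> ?F" for a s
    using that monodromy_in_fibre[OF c] by (elim carrier_fundamental_groupE) auto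
  show "?\<mu> \<one>\<^bsub>?G\<^esub> s = s" if "s \<in> ?F" for s
  proof -
    have "lifts_from_to (Y, p) (\<lambda>t. x) s s" "(\<lambda>t. x) \<in> loops X x"
      using lifts_from_to_const[of s Y p] that x by (auto simp: fibre_def loops_def)
    then show ?thesis
      using monodromy_eq[OF c] by (metis one_fundamental_group)
  qed
  show "?\<mu> (a \<otimes>\<^bsub>?G\<^esub> b) s = ?\<mu> a (?\<mu> b s)" if ab: "a \<in> carrier ?G" "b \<in> carrier ?G" and s: "s \<in> ?F" for a b s
  proof -
    obtain \<alpha> where \<alpha>: "\<alpha> \<in> loops X x" "a = loop_class X x \<alpha>"
      using ab(1) by (rule carrier_fundamental_groupE)
    obtain \<beta> where \<beta>: "\<beta> \<in> loops X x" "b = loop_class X x \<beta>"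
      using ab(2) by (rule carrier_fundamental_groupE)
    \<comment> \<open>The product of \<open>a\<close> and \<open>b\<close> is the class of
      \<open>\<beta>\<close> followed by \<open>\<alpha>\<close>, so \<open>b\<close> acts first and
      the action is a left action.\<close>
    have "lifts_from_to (Y, p) (path_join \<beta> \<alpha>) s (?\<mu> a (?\<mu> b s))"
      unfolding \<alpha>(2) \<beta>(2) using lifts_from_to_monodromy[OF c \<beta>(1) s]
        lifts_from_to_monodromy[OF c \<alpha>(1) monodromy_in_fibre[OF c \<beta>(1) s]]
      by (rule lifts_from_to_join)
    from monodromy_eq[OF c loops_join[OF \<beta>(1) \<alpha>(1)] this] show ?thesis
      unfolding \<alpha>(2) \<beta>(2) mult_loop_class[OF \<alpha>(1) \<beta>(1)] .
  qed
qed

definition monodromy_equivariant ::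
    "'a topology \<Rightarrow> 'a \<Rightarrow> ('y, 'a) space_over \<Rightarrow> ('z, 'a) space_over \<Rightarrow> ('y \<Rightarrow> 'z) \<Rightarrow> bool" where
  "monodromy_equivariant X x c d f \<longleftrightarrow> f \<in> fibre c x \<rightarrow> fibre d x \<and>
     (\<forall>a\<in>carrier (fundamental_group X x). \<forall>s\<in>fibre c x. f (monodromy c x a s) = monodromy d x a (f s))"

lemma monodromy_equivariant_cover_map:
  assumes c: "is_cover X (Y, p)" and d: "is_cover X (Z, q)" and f: "f \<in> cover_maps (Y, p) (Z, q)"
  shows "monodromy_equivariant X x (Y, p) (Z, q) f"
  unfolding monodromy_equivariant_def
proof (intro conjI ballI)
  show "f \<in> fibre (Y, p) x \<rightarrow> fibre (Z, q) x"
    using f by (auto simp: fibre_def cover_maps_def continuous_map_def Pi_iff)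
  fix a s assume a: "a \<in> carrier (fundamental_group X x)" and s: "s \<in> fibre (Y, p) x"
  obtain \<alpha> where \<alpha>: "\<alpha> \<in> loops X x" "a = loop_class X x \<alpha>"
    using a by (rule carrier_fundamental_groupE)
  from monodromy_eq[OF d \<alpha>(1) lifts_from_to_map[OF f lifts_from_to_monodromy[OF c \<alpha>(1) s]]]
  show "f (monodromy (Y, p) x a s) = monodromy (Z, q) x a (f s)"
    unfolding \<alpha>(2) ..
qed

section \<open>Cover maps and their restrictions to the fibre over the base point\<close>

lemma path_rev_path_rev [simp]: "path_rev (path_rev \<gamma>) = \<gamma>"
  by (simp add: path_rev_def)

text \<open>The start \<open>s\<close> is not known in advance, so a path from \<open>p y\<close>
  back to \<open>x\<close> is lifted from \<open>y\<close>, and the lift is then reversed.\<close>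

lemma path_lift_from_fibre:
  assumes X: "path_connected_space X" and x: "x \<in> topspace X" and c: "is_cover X (Y, p)" and y: "y \<in> topspace Y"
  obtains \<alpha> s where "pathin X \<alpha>" "\<alpha> 0 = x" "\<alpha> 1 = p y" "s \<in> fibre (Y, p) x" "lifts_from_to (Y, p) \<alpha> s y"
proof -
  have "p y \<in> topspace X"
    using cover_continuous[OF c] y by (auto simp: continuous_map_def Pi_iff)
  then obtain \<alpha> where \<alpha>: "pathin X \<alpha>" "\<alpha> 0 = p y" "\<alpha> 1 = x"
    using X x by (auto simp: path_connected_space_def)
  then obtain s where s: "lifts_from_to (Y, p) \<alpha> y s"
    using lifts_from_to_exists[OF c, of \<alpha> y] y by auto
  show thesis
  proof (rule that[of "path_rev \<alpha>" s])
    show "s \<in> fibre (Y, p) x"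
      using lifts_from_to_ends[OF s] \<alpha>(3) by (simp add: fibre_def)
  qed (simp_all add: \<alpha> pathin_rev lifts_from_to_rev[OF s])
qed

text \<open>Every point of \<open>Y\<close> ends a lift that starts in the fibre, and a cover map
  carries it to the lift of the same path, whose end is determined by its start. This is
  faithfulness of the fibre functor.\<close>

lemma cover_map_eq:
  assumes X: "path_connected_space X" and x: "x \<in> topspace X"
    and c: "is_cover X (Y, p)" and d: "is_cover X (Z, q)"
    and f: "f \<in> cover_maps (Y, p) (Z, q)" and g: "g \<in> cover_maps (Y, p) (Z, q)"
    and fg: "\<And>s. s \<in> fibre (Y, p) x \<Longrightarrow> f s = g s"
  shows "f = g"
proof (rule extensionalityI)
  show "f \<in> extensional (topspace Y)" "g \<in> extensional (topspace Y)"
    using f g by (auto simp: cover_maps_def)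
  fix y assume "y \<in> topspace Y"
  then obtain \<alpha> s where "s \<in> fibre (Y, p) x" "lifts_from_to (Y, p) \<alpha> s y"
    by (rule path_lift_from_fibre[OF X x c])
  then show "f y = g y"
    using lifts_from_to_map[OF f] lifts_from_to_map[OF g] fg lifts_from_to_unique[OF d] by metis
qed

text \<open>This is fullness. The value at \<open>y\<close> is forced: if \<open>y\<close> ends the
  lift of \<open>\<alpha>\<close> from \<open>s\<close>, its image ends the lift of
  \<open>\<alpha>\<close> from \<open>f s\<close>. Equivariance makes this independent of
  \<open>\<alpha>\<close> and \<open>s\<close>.\<close>

theorem extend_equivariant_to_cover_map:
  assumes X: "path_connected_space X" "locally_path_connected_space X" and x: "x \<in> topspace X"
    and c: "is_cover X (Y, p)" and d: "is_cover X (Z, q)"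
    and f: "monodromy_equivariant X x (Y, p) (Z, q) f"
  obtains F where "F \<in> cover_maps (Y, p) (Z, q)" "\<And>s. s \<in> fibre (Y, p) x \<Longrightarrow> F s = f s"
proof -
  define R where "R y z \<longleftrightarrow> (\<exists>\<alpha> s. pathin X \<alpha> \<and> s \<in> fibre (Y, p) x \<and> \<alpha> 0 = x \<and>
    lifts_from_to (Y, p) \<alpha> s y \<and> lifts_from_to (Z, q) \<alpha> (f s) z)" for y z
  have f_fibre: "f s \<in> fibre (Z, q) x" if "s \<in> fibre (Y, p) x" for s
    using f that by (auto simp: monodromy_equivariant_def)
  have R_ex: "\<exists>z. R y z" if y: "y \<in> topspace Y" for y
  proof -
    obtain \<alpha> s where \<alpha>: "pathin X \<alpha>" "\<alpha> 0 = x" "s \<in> fibre (Y, p) x" "lifts_from_to (Y, p) \<alpha> s y"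
      using y by (rule path_lift_from_fibre[OF X(1) x c])
    moreover obtain z where "lifts_from_to (Z, q) \<alpha> (f s) z"
      using lifts_from_to_exists[OF d \<alpha>(1), of "f s"] f_fibre[OF \<alpha>(3)] \<alpha>(2) by (auto simp: fibre_def)
    ultimately show ?thesis
      unfolding R_def by blast
  qed
  have R_unique: "z = z'" if R: "R y z" "R y z'" for y z z'
  proof -
    obtain \<alpha> s where \<alpha>: "pathin X \<alpha>" "s \<in> fibre (Y, p) x" "\<alpha> 0 = x"
        "lifts_from_to (Y, p) \<alpha> s y" "lifts_from_to (Z, q) \<alpha> (f s) z"
      using R(1) unfolding R_def by blast
    obtain \<alpha>' s' where \<alpha>': "pathin X \<alpha>'" "s' \<in> fibre (Y, p) x" "\<alpha>' 0 = x"
        "lifts_from_to (Y, p) \<alpha>' s' y" "lifts_from_to (Z, q) \<alpha>' (f s') z'"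
      using R(2) unfolding R_def by blast
    \<comment> \<open>The loop compares two choices: its class sends \<open>s\<close> to
      \<open>s'\<close>, hence by equivariance \<open>f s\<close> to \<open>f s'\<close>. So going
      back from \<open>z\<close> along \<open>\<alpha>'\<close> ends in \<open>f s'\<close>, which
      says that \<open>z\<close> also ends the lift of \<open>\<alpha>'\<close> from
      \<open>f s'\<close>.\<close>
    define \<gamma> where "\<gamma> = path_join \<alpha> (path_rev \<alpha>')"
    have ends: "\<alpha> 1 = \<alpha>' 1"
      using lifts_from_to_ends[OF \<alpha>(4)] lifts_from_to_ends[OF \<alpha>'(4)] by simp
    then have \<gamma>: "\<gamma> \<in> loops X x"
      using \<alpha> \<alpha>' by (simp add: loops_def \<gamma>_def pathin_join pathin_rev)
    have "lifts_from_to (Y, p) \<gamma> s s'"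
      unfolding \<gamma>_def using \<alpha>(4) lifts_from_to_rev[OF \<alpha>'(4)] by (rule lifts_from_to_join)
    then have "monodromy (Y, p) x (loop_class X x \<gamma>) s = s'"
      by (rule monodromy_eq[OF c \<gamma>])
    then have fs': "f s' = monodromy (Z, q) x (loop_class X x \<gamma>) (f s)"
      using f \<alpha>(2) loop_class_in_carrier[OF \<gamma>] by (auto simp: monodromy_equivariant_def)
    have "lifts_from_to (Z, q) \<gamma> (f s) (f s')"
      unfolding fs' by (rule lifts_from_to_monodromy[OF d \<gamma> f_fibre[OF \<alpha>(2)]])
    moreover obtain w where w: "lifts_from_to (Z, q) (path_rev \<alpha>') z w"
      using lifts_from_to_exists[OF d pathin_rev[OF \<alpha>'(1)], of z] lifts_from_to_ends[OF \<alpha>(5)] ends by auto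
    moreover have "lifts_from_to (Z, q) \<gamma> (f s) w"
      unfolding \<gamma>_def using \<alpha>(5) w by (rule lifts_from_to_join)
    ultimately have "w = f s'"
      using lifts_from_to_unique[OF d] by blast
    then show ?thesis
      using lifts_from_to_rev[OF w] \<alpha>'(5) lifts_from_to_unique[OF d] by fastforce
  qed
  define F where "F = (\<lambda>y\<in>topspace Y. SOME z. R y z)"
  have RF: "R y (F y)" if "y \<in> topspace Y" for y
    using someI_ex[OF R_ex[OF that]] that by (simp add: F_def)
  have F: "F y \<in> topspace Z \<and> q (F y) = p y" if y: "y \<in> topspace Y" for y
  proof -
    obtain \<alpha> s where "lifts_from_to (Y, p) \<alpha> s y" "lifts_from_to (Z, q) \<alpha> (f s) (F y)"
      using RF[OF y] unfolding R_def by blast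
    then show ?thesis
      using lifts_from_to_ends by metis
  qed
  have "continuous_map Y Z F"
  proof (rule continuous_map_if_lifts_from_to[OF X(2) c d F])
    fix \<beta> y y' assume \<beta>: "lifts_from_to (Y, p) \<beta> y y'" "pathin X \<beta>"
    note y = lifts_from_to_ends[OF \<beta>(1)]
    obtain \<alpha> s where \<alpha>: "pathin X \<alpha>" "s \<in> fibre (Y, p) x" "\<alpha> 0 = x"
        "lifts_from_to (Y, p) \<alpha> s y" "lifts_from_to (Z, q) \<alpha> (f s) (F y)"
      using RF[OF y(1)] unfolding R_def by blast
    have ends: "\<alpha> 1 = \<beta> 0"
      using y lifts_from_to_ends[OF \<alpha>(4)] by simp
    obtain z where z: "lifts_from_to (Z, q) \<beta> (F y) z"
      using lifts_from_to_exists[OF d \<beta>(2), of "F y"] F[OF y(1)] y by auto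
    \<comment> \<open>A path admissible for \<open>y\<close>, followed by \<open>\<beta>\<close>, is
      admissible for \<open>y'\<close>.\<close>
    have "R y' z"
      unfolding R_def using \<alpha> \<beta> ends lifts_from_to_join[OF \<alpha>(4) \<beta>(1)] lifts_from_to_join[OF \<alpha>(5) z]
      by (intro exI[of _ "path_join \<alpha> \<beta>"] exI[of _ s]) (auto simp: pathin_join)
    then have "z = F y'"
      using R_unique RF[OF y(2)] by blast
    then show "lifts_from_to (Z, q) \<beta> (F y) (F y')"
      using z by simp
  qed auto
  then have "F \<in> cover_maps (Y, p) (Z, q)"
    using F by (auto simp: cover_maps_def F_def)
  moreover have "F s = f s" if s: "s \<in> fibre (Y, p) x" for s
  proof -
    have "lifts_from_to (Y, p) (\<lambda>t. x) s s" "lifts_from_to (Z, q) (\<lambda>t. x) (f s) (f s)"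
      using lifts_from_to_const[of s Y p] lifts_from_to_const[of "f s" Z q] s f_fibre[OF s]
      by (auto simp: fibre_def)
    then have "R s (f s)"
      unfolding R_def using x s by (intro exI[of _ "\<lambda>t. x"] exI[of _ s]) auto
    then show ?thesis
      using R_unique RF s by (auto simp: fibre_def)
  qed
  ultimately show thesis
    by (rule that)
qed

section \<open>The profinite completion\<close>

lemma (in group) rcoset_eq_iff:
  assumes "subgroup N G" "A \<in> rcosets N" "B \<in> rcosets N" "g \<in> A" "g \<in> B"
  shows "A = B"
  using rcos_disjoint[OF assms(1)] assms(2-) by (auto simp: pairwise_def disjnt_def)

lemma (in group) rcoset_of_member:
  assumes "subgroup N G" "A \<in> rcosets N" "g \<in> A"
  shows "A = N #> g" "g \<in> carrier G"
proof -
  obtain a where "a \<in> carrier G" "A = N #> a"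
    using assms(2) by (auto simp: RCOSETS_def)
  then show "A = N #> g" "g \<in> carrier G"
    using assms repr_independence r_coset_subset_G[OF subgroup.subset[OF assms(1)], of a] by auto
qed

lemma (in group) rcoset_nonempty:
  assumes "subgroup N G" "A \<in> rcosets N"
  obtains g where "g \<in> A" "g \<in> carrier G"
  using assms rcos_self by (auto simp: RCOSETS_def)

section \<open>Normal subgroups of finite index and compatible families of cosets\<close>

lemma fin_index_normalsD:
  assumes "N \<in> fin_index_normals G"
  shows "N \<lhd> G" "subgroup N G" "finite (rcosets\<^bsub>G\<^esub> N)"
  using assms by (auto simp: fin_index_normals_def normal_def)

lemma (in group) fin_index_normals_carrier: "carrier G \<in> fin_index_normals G"
proof -
  have "carrier G \<lhd> G"
    by (simp add: normal_inv_iff subgroup_self)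
  moreover have "rcosets (carrier G) \<subseteq> {carrier G}"
    using coset_join2 subgroup_self by (auto simp: RCOSETS_def)
  ultimately show ?thesis
    unfolding fin_index_normals_def using finite_subset by blast
qed

text \<open>A coset of the intersection is the intersection of a coset of \<open>N\<close> with one
  of \<open>M\<close>, and there are finitely many such pairs.\<close>

lemma (in group) fin_index_normals_Int:
  assumes "N \<in> fin_index_normals G" "M \<in> fin_index_normals G"
  shows "N \<inter> M \<in> fin_index_normals G"
proof -
  note N = fin_index_normalsD[OF assms(1)] and M = fin_index_normalsD[OF assms(2)]
  have "N \<inter> M \<lhd> G"
    using N(1) M(1) subgroups_Inter_pair[OF N(2) M(2)] unfolding normal_inv_iff by auto
  moreover have "finite (rcosets (N \<inter> M))"
  proof (rule finite_surj)
    show "finite ((rcosets N) \<times> (rcosets M))"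
      using N M by simp
    have "(N \<inter> M) #> g = (N #> g) \<inter> (M #> g)" if "g \<in> carrier G" for g
      using that subgroup.mem_carrier[OF N(2)] subgroup.mem_carrier[OF M(2)] by (auto simp: r_coset_def)
    then show "rcosets (N \<inter> M) \<subseteq> (\<lambda>(A, B). A \<inter> B) ` ((rcosets N) \<times> (rcosets M))"
      by (force simp: RCOSETS_def)
  qed
  ultimately show ?thesis
    by (simp add: fin_index_normals_def)
qed

lemma (in group) fin_index_normals_INT:
  assumes "finite J" "\<And>j. j \<in> J \<Longrightarrow> N j \<in> fin_index_normals G"
  obtains M where "M \<in> fin_index_normals G" "\<And>j. j \<in> J \<Longrightarrow> M \<subseteq> N j"
proof -
  have "\<exists>M\<in>fin_index_normals G. \<forall>j\<in>J. M \<subseteq> N j"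
    using assms
  proof (induction J rule: finite_induct)
    case empty
    then show ?case
      using fin_index_normals_carrier by blast
  next
    case (insert j J)
    then obtain M where "M \<in> fin_index_normals G" "\<forall>j\<in>J. M \<subseteq> N j"
      by auto
    then show ?case
      using insert.prems fin_index_normals_Int[of M "N j"] by (intro bexI[of _ "M \<inter> N j"]) auto
  qed
  then show thesis
    using that by blast
qed

lemma (in group) normal_set_mult_rcoset:
  assumes "subgroup N G" "subgroup M G" "N \<subseteq> M" "g \<in> carrier G"
  shows "M <#> (N #> g) = M #> g"
proof -
  have "M <#> (N #> g) = (M <#> N) #> g"
    using assms by (simp add: setmult_rcos_assoc subgroup.subset)
  also have "M <#> N = M"
  proof
    show "M <#> N \<subseteq> M"
      using assms by (auto simp: set_mult_def subgroup.m_closed)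
    show "M \<subseteq> M <#> N"
      using assms subgroup.one_closed[OF assms(1)] subgroup.mem_carrier[OF assms(2)]
      by (force simp: set_mult_def)
  qed
  finally show ?thesis .
qed

text \<open>The product of \<open>M\<close> with a coset of \<open>N\<close> is the coset of
  \<open>M\<close> that contains it, and cosets of \<open>M\<close> are disjoint; so compatibility
  is plain inclusion. In this form it passes at once to products and inverses.\<close>

lemma (in group) carrier_profinite_completion:
  "\<xi> \<in> carrier (profinite_completion G) \<longleftrightarrow>
     \<xi> \<in> (\<Pi>\<^sub>E N\<in>fin_index_normals G. rcosets N) \<and>
     (\<forall>N\<in>fin_index_normals G. \<forall>M\<in>fin_index_normals G. N \<subseteq> M \<longrightarrow> \<xi> N \<subseteq> \<xi> M)"
proof -
  have *: "M <#> \<xi> N = \<xi> M \<longleftrightarrow> \<xi> N \<subseteq> \<xi> M"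
    if \<xi>: "\<xi> \<in> (\<Pi>\<^sub>E N\<in>fin_index_normals G. rcosets N)"
      and NM: "N \<in> fin_index_normals G" "M \<in> fin_index_normals G" "N \<subseteq> M" for N M
  proof -
    note sub = fin_index_normalsD(2)[OF NM(1)] fin_index_normalsD(2)[OF NM(2)]
    have cos: "\<xi> N \<in> rcosets N" "\<xi> M \<in> rcosets M"
      using \<xi> NM by auto
    obtain g where g: "g \<in> \<xi> N" "g \<in> carrier G"
      using rcoset_nonempty[OF sub(1) cos(1)] .
    have N: "\<xi> N = N #> g"
      using rcoset_of_member[OF sub(1) cos(1) g(1)] by simp
    have M: "M <#> \<xi> N = M #> g"
      unfolding N by (rule normal_set_mult_rcoset[OF sub NM(3) g(2)])
    show ?thesis
    proof
      assume "M <#> \<xi> N = \<xi> M"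
      then have "\<xi> M = M #> g"
        using M by simp
      then show "\<xi> N \<subseteq> \<xi> M"
        unfolding N using NM(3) by (auto simp: r_coset_def)
    next
      assume "\<xi> N \<subseteq> \<xi> M"
      then have "\<xi> M = M #> g"
        using rcoset_of_member[OF sub(2) cos(2)] g by blast
      then show "M <#> \<xi> N = \<xi> M"
        using M by simp
    qed
  qed
  have C: "\<xi> \<in> carrier (profinite_completion G) \<longleftrightarrow>
      \<xi> \<in> (\<Pi>\<^sub>E N\<in>fin_index_normals G. rcosets N) \<and>
      (\<forall>N\<in>fin_index_normals G. \<forall>M\<in>fin_index_normals G. N \<subseteq> M \<longrightarrow> M <#> \<xi> N = \<xi> M)"
    by (simp add: profinite_completion_def FactGroup_def)
  show ?thesis
    unfolding C by (intro conj_cong ball_cong imp_cong refl *)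
qed

lemma (in group) profinite_component:
  assumes "\<xi> \<in> carrier (profinite_completion G)" "N \<in> fin_index_normals G"
  shows "\<xi> N \<in> rcosets N"
  using assms by (auto simp: carrier_profinite_completion)

lemma mult_profinite_completion:
  "N \<in> fin_index_normals G \<Longrightarrow> (\<xi> \<otimes>\<^bsub>profinite_completion G\<^esub> \<zeta>) N = \<xi> N <#>\<^bsub>G\<^esub> \<zeta> N"
  by (simp add: profinite_completion_def)

lemma one_profinite_completion:
  "N \<in> fin_index_normals G \<Longrightarrow> \<one>\<^bsub>profinite_completion G\<^esub> N = N"
  by (simp add: profinite_completion_def)

text \<open>The compatible families form a subgroup of the product of the quotients, since products
  and inverses of sets are monotone under inclusion.\<close>

lemma (in group) group_profinite_completion: "group (profinite_completion G)"
proof -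
  let ?P = "product_group (fin_index_normals G) (\<lambda>N. G Mod N)"
  let ?C = "carrier (profinite_completion G)"
  have Mod: "group (G Mod N)" if "N \<in> fin_index_normals G" for N
    using normal.factorgroup_is_group fin_index_normalsD(1)[OF that] by blast
  interpret P: group ?P
    using Mod by simp
  have C_sub: "?C \<subseteq> carrier ?P"
    by (auto simp: profinite_completion_def)
  have C: "\<xi> \<in> ?C \<longleftrightarrow> \<xi> \<in> carrier ?P \<and>
      (\<forall>N\<in>fin_index_normals G. \<forall>M\<in>fin_index_normals G. N \<subseteq> M \<longrightarrow> \<xi> N \<subseteq> \<xi> M)" for \<xi>
    by (simp add: carrier_profinite_completion FactGroup_def)
  have "subgroup ?C ?P"
  proof (rule P.subgroupI[OF C_sub])
    have "\<one>\<^bsub>?P\<^esub> \<in> ?C"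
      unfolding C using P.one_closed by auto
    then show "?C \<noteq> {}" by blast
  next
    fix \<xi> assume \<xi>: "\<xi> \<in> ?C"
    then have \<xi>P: "\<xi> \<in> carrier ?P"
      using C_sub by blast
    have "inv\<^bsub>?P\<^esub> \<xi> = (\<lambda>N\<in>fin_index_normals G. inv\<^bsub>G Mod N\<^esub> \<xi> N)"
      using \<xi>P Mod by (intro inv_product_group) auto
    moreover have "inv\<^bsub>G Mod N\<^esub> \<xi> N = set_inv (\<xi> N)" if "N \<in> fin_index_normals G" for N
      using normal.inv_FactGroup[OF fin_index_normalsD(1)[OF that], of "\<xi> N"] \<xi>P that by auto
    ultimately have "(inv\<^bsub>?P\<^esub> \<xi>) N = set_inv (\<xi> N)" if "N \<in> fin_index_normals G" for N
      using that by simp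
    then show "inv\<^bsub>?P\<^esub> \<xi> \<in> ?C"
      unfolding C using P.inv_closed[OF \<xi>P] \<xi>[unfolded C] by (simp add: SET_INV_def) blast
  next
    fix \<xi> \<zeta> assume \<xi>: "\<xi> \<in> ?C" and \<zeta>: "\<zeta> \<in> ?C"
    have "(\<xi> \<otimes>\<^bsub>?P\<^esub> \<zeta>) N \<subseteq> (\<xi> \<otimes>\<^bsub>?P\<^esub> \<zeta>) M"
      if "N \<in> fin_index_normals G" "M \<in> fin_index_normals G" "N \<subseteq> M" for N M
      using that \<xi>[unfolded C] \<zeta>[unfolded C] by (simp add: mono_set_mult)
    then show "\<xi> \<otimes>\<^bsub>?P\<^esub> \<zeta> \<in> ?C"
      unfolding C using P.m_closed[of \<xi> \<zeta>] \<xi> \<zeta> C_sub by blast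
  qed
  then have "group (?P\<lparr>carrier := ?C\<rparr>)"
    using P.group_axioms by (rule subgroup.subgroup_is_group)
  moreover have "?P\<lparr>carrier := ?C\<rparr> = profinite_completion G"
    by (simp add: profinite_completion_def)
  ultimately show ?thesis by simp
qed

text \<open>The canonical homomorphism from \<open>G\<close> to its completion.\<close>

definition to_completion :: "('g, 'b) monoid_scheme \<Rightarrow> 'g \<Rightarrow> 'g set \<Rightarrow> 'g set" where
  "to_completion G g = (\<lambda>N\<in>fin_index_normals G. N #>\<^bsub>G\<^esub> g)"

lemma (in group) to_completion_closed:
  assumes "g \<in> carrier G"
  shows "to_completion G g \<in> carrier (profinite_completion G)"
  unfolding carrier_profinite_completion to_completion_def
  using assms fin_index_normalsD(2) rcosetsI[OF subgroup.subset] by (auto simp: r_coset_def)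

lemma (in group) profinite_completion_eqI:
  assumes "\<xi> \<in> carrier (profinite_completion G)" "\<zeta> \<in> carrier (profinite_completion G)"
    "\<And>N. N \<in> fin_index_normals G \<Longrightarrow> \<xi> N = \<zeta> N"
  shows "\<xi> = \<zeta>"
  using assms by (intro extensionalityI[of _ "fin_index_normals G"]) (auto simp: carrier_profinite_completion PiE_def)

lemma (in group) to_completion_mult:
  assumes "g \<in> carrier G" "h \<in> carrier G"
  shows "to_completion G (g \<otimes> h) = to_completion G g \<otimes>\<^bsub>profinite_completion G\<^esub> to_completion G h"
proof (rule profinite_completion_eqI)
  interpret P: group "profinite_completion G"
    by (rule group_profinite_completion)
  show "to_completion G (g \<otimes> h) \<in> carrier (profinite_completion G)"
    "to_completion G g \<otimes>\<^bsub>profinite_completion G\<^esub> to_completion G h \<in> carrier (profinite_completion G)"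
    using assms to_completion_closed by auto
  show "to_completion G (g \<otimes> h) N = (to_completion G g \<otimes>\<^bsub>profinite_completion G\<^esub> to_completion G h) N"
    if "N \<in> fin_index_normals G" for N
    using that assms normal.rcos_sum[OF fin_index_normalsD(1)[OF that]]
    by (simp add: mult_profinite_completion to_completion_def)
qed

lemma (in group) to_completion_one: "to_completion G \<one> = \<one>\<^bsub>profinite_completion G\<^esub>"
proof (rule profinite_completion_eqI)
  show "to_completion G \<one> N = \<one>\<^bsub>profinite_completion G\<^esub> N" if "N \<in> fin_index_normals G" for N
    using that fin_index_normalsD(2)[OF that] coset_mult_one[OF subgroup.subset]
    by (simp add: to_completion_def one_profinite_completion)
qed (use to_completion_closed group.is_monoid[OF group_profinite_completion] in \<open>auto intro: monoid.one_closed\<close>)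

section \<open>The profinite topology\<close>

lemma topspace_profinite_topology: "topspace (profinite_topology G) = carrier (profinite_completion G)"
  by (auto simp: profinite_topology_def profinite_completion_def)

text \<open>The index set is directed downwards, so agreement in a single component gives a basis of
  neighbourhoods.\<close>

lemma (in group) openin_profinite_topology:
  "openin (profinite_topology G) W \<longleftrightarrow> W \<subseteq> carrier (profinite_completion G) \<and>
     (\<forall>\<xi>\<in>W. \<exists>N\<in>fin_index_normals G. \<forall>\<zeta>\<in>carrier (profinite_completion G). \<zeta> N = \<xi> N \<longrightarrow> \<zeta> \<in> W)"
  (is "?open W \<longleftrightarrow> _ \<and> ?nbhd W")
proof -
  let ?C = "carrier (profinite_completion G)"
  let ?I = "fin_index_normals G"
  let ?X = "\<lambda>N. discrete_topology (carrier (G Mod N))"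
  have nbhd: "?nbhd W" if W: "?open W"
  proof
    fix \<xi> assume \<xi>: "\<xi> \<in> W"
    obtain T where T: "openin (product_topology ?X ?I) T" "W = T \<inter> ?C"
      using W by (auto simp: profinite_topology_def openin_subtopology)
    have "\<exists>U. finite {N \<in> ?I. U N \<noteq> topspace (?X N)} \<and> (\<forall>N\<in>?I. openin (?X N) (U N)) \<and>
        \<xi> \<in> PiE ?I U \<and> PiE ?I U \<subseteq> T"
      using T(1)[unfolded openin_product_topology_alt] by (rule bspec) (use \<xi> T(2) in simp)
    then obtain U where U: "finite {N \<in> ?I. U N \<noteq> topspace (?X N)}" "\<xi> \<in> PiE ?I U" "PiE ?I U \<subseteq> T"
      by (elim exE conjE)
    \<comment> \<open>A basic open set constrains finitely many components, and \<open>N\<close>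
      lies below all of them. Families that agree at \<open>N\<close> share an element in each
      constrained component, and cosets with a common element are equal.\<close>
    obtain N where N: "N \<in> ?I" "\<And>M. M \<in> {N \<in> ?I. U N \<noteq> topspace (?X N)} \<Longrightarrow> N \<subseteq> M"
      using fin_index_normals_INT[OF U(1), of id] by auto
    have "\<zeta> \<in> W" if \<zeta>: "\<zeta> \<in> ?C" "\<zeta> N = \<xi> N" for \<zeta>
    proof -
      have "\<zeta> M \<in> U M" if M: "M \<in> ?I" for M
      proof (cases "U M = topspace (?X M)")
        case True
        then show ?thesis
          using \<zeta>(1) M by (auto simp: carrier_profinite_completion FactGroup_def)
      next
        case False
        then have "N \<subseteq> M"
          using N(2) M by blast
        then have sub: "\<zeta> N \<subseteq> \<zeta> M" "\<xi> N \<subseteq> \<xi> M"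
          using \<zeta>(1) \<xi> T(2) N(1) M by (auto simp: carrier_profinite_completion)
        obtain g where g: "g \<in> \<zeta> N"
          using rcoset_nonempty[OF fin_index_normalsD(2)[OF N(1)] profinite_component[OF \<zeta>(1) N(1)]] .
        have "\<xi> \<in> ?C"
          using \<xi> T(2) by blast
        have "\<zeta> M = \<xi> M"
          using g sub \<zeta>(2)
          by (intro rcoset_eq_iff[OF fin_index_normalsD(2)[OF M] profinite_component[OF \<zeta>(1) M]
                profinite_component[OF \<open>\<xi> \<in> ?C\<close> M], of g]) auto
        then show ?thesis
          using U(2) M by auto
      qed
      then have "\<zeta> \<in> PiE ?I U"
        using \<zeta>(1) by (auto simp: carrier_profinite_completion PiE_def)
      then show ?thesis
        using U(3) T(2) \<zeta>(1) by blast
    qed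
    then show "\<exists>N\<in>?I. \<forall>\<zeta>\<in>?C. \<zeta> N = \<xi> N \<longrightarrow> \<zeta> \<in> W"
      using N(1) by blast
  qed
  have basic: "?open {\<zeta> \<in> ?C. \<zeta> N = A}" if N: "N \<in> ?I" for N A
  proof -
    have "continuous_map (profinite_topology G) (?X N) (\<lambda>\<zeta>. \<zeta> N)"
      unfolding profinite_topology_def
      by (intro continuous_map_from_subtopology continuous_map_product_projection N)
    from openin_continuous_map_preimage[OF this, of "{A} \<inter> carrier (G Mod N)"]
    have "?open {\<zeta> \<in> ?C. \<zeta> N \<in> {A} \<inter> carrier (G Mod N)}"
      by (simp add: topspace_profinite_topology)
    moreover have "{\<zeta> \<in> ?C. \<zeta> N \<in> {A} \<inter> carrier (G Mod N)} = {\<zeta> \<in> ?C. \<zeta> N = A}"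
      using profinite_component[OF _ N] by (auto simp: FactGroup_def)
    ultimately show ?thesis by simp
  qed
  show ?thesis
  proof (intro iffI conjI)
    assume "W \<subseteq> ?C \<and> ?nbhd W"
    then have W: "W \<subseteq> ?C" "?nbhd W" by auto
    show "?open W"
    proof (subst openin_subopen, intro ballI)
      fix \<xi> assume \<xi>: "\<xi> \<in> W"
      then obtain N where N: "N \<in> ?I" "\<forall>\<zeta>\<in>?C. \<zeta> N = \<xi> N \<longrightarrow> \<zeta> \<in> W"
        using W(2) by blast
      then show "\<exists>T. ?open T \<and> \<xi> \<in> T \<and> T \<subseteq> W"
        using W(1) \<xi> basic[OF N(1), of "\<xi> N"] by (intro exI[of _ "{\<zeta> \<in> ?C. \<zeta> N = \<xi> N}"]) auto
    qed
  qed (use nbhd openin_subset topspace_profinite_topology in blast)+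
qed

section \<open>Continuous actions on finite sets\<close>

lemma group_action_closed: "group_action G S \<phi> \<Longrightarrow> g \<in> carrier G \<Longrightarrow> s \<in> S \<Longrightarrow> \<phi> g s \<in> S"
  using group_action.element_image by metis

lemma group_action_one: "group_action G S \<phi> \<Longrightarrow> s \<in> S \<Longrightarrow> \<phi> \<one>\<^bsub>G\<^esub> s = s"
  by (metis group_action.id_eq_one restrict_apply')

lemma group_action_mult:
  "group_action G S \<phi> \<Longrightarrow> g \<in> carrier G \<Longrightarrow> h \<in> carrier G \<Longrightarrow> s \<in> S \<Longrightarrow> \<phi> (g \<otimes>\<^bsub>G\<^esub> h) s = \<phi> g (\<phi> h s)"
  using group_action.composition_rule by metis

lemma group_action_extensional: "group_action G S \<phi> \<Longrightarrow> g \<in> carrier G \<Longrightarrow> \<phi> g \<in> extensional S"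
  using group_action.bij_prop0 Bij_imp_extensional by metis

text \<open>Density of the image of \<open>G\<close>: any element of the coset
  \<open>\<xi> N\<close> agrees with \<open>\<xi>\<close> at level \<open>N\<close>.\<close>

lemma (in group) profinite_approx:
  assumes "\<xi> \<in> carrier (profinite_completion G)" "N \<in> fin_index_normals G"
  obtains g where "g \<in> carrier G" "g \<in> \<xi> N" "to_completion G g N = \<xi> N"
proof -
  note N = fin_index_normalsD(2)[OF assms(2)] profinite_component[OF assms]
  obtain g where g: "g \<in> \<xi> N" "g \<in> carrier G"
    using N by (rule rcoset_nonempty)
  then show thesis
    using that rcoset_of_member(1)[OF N] assms(2) by (simp add: to_completion_def)
qed

lemma (in group) profinite_component_mono:
  assumes "\<xi> \<in> carrier (profinite_completion G)" "N \<in> fin_index_normals G" "M \<in> fin_index_normals G" "N \<subseteq> M"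
  shows "\<xi> N \<subseteq> \<xi> M"
  using assms by (simp add: carrier_profinite_completion)

lemma (in group) profinite_component_eq_mono:
  assumes \<xi>: "\<xi> \<in> carrier (profinite_completion G)" and \<zeta>: "\<zeta> \<in> carrier (profinite_completion G)"
    and NM: "N \<in> fin_index_normals G" "M \<in> fin_index_normals G" "N \<subseteq> M" and eq: "\<xi> N = \<zeta> N"
  shows "\<xi> M = \<zeta> M"
proof -
  obtain g where "g \<in> \<xi> N"
    using rcoset_nonempty[OF fin_index_normalsD(2)[OF NM(1)] profinite_component[OF \<xi> NM(1)]] .
  then show ?thesis
    using profinite_component_mono[OF \<xi> NM] profinite_component_mono[OF \<zeta> NM] eq
    by (intro rcoset_eq_iff[OF fin_index_normalsD(2)[OF NM(2)] profinite_component[OF \<xi> NM(2)]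
          profinite_component[OF \<zeta> NM(2)], of g]) auto
qed

text \<open>Continuity means that the action is determined by a single component. Each point has a
  level at which trivial elements fix it, and as \<open>S\<close> is finite, one level works for all
  points. Later proofs use continuity only in this form.\<close>

lemma (in group) finite_cont_gset_iff:
  "finite_cont_gset G (S, \<phi>) \<longleftrightarrow> finite S \<and> group_action (profinite_completion G) S \<phi> \<and>
     (\<exists>N\<in>fin_index_normals G. \<forall>\<xi>\<in>carrier (profinite_completion G). \<forall>\<zeta>\<in>carrier (profinite_completion G).
        \<xi> N = \<zeta> N \<longrightarrow> (\<forall>s\<in>S. \<phi> \<xi> s = \<phi> \<zeta> s))"
    (is "_ \<longleftrightarrow> _ \<and> _ \<and> ?unif")
proof -
  let ?H = "profinite_completion G"
  let ?T = "prod_topology (profinite_topology G) (discrete_topology S)"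
  interpret H: group ?H
    by (rule group_profinite_completion)
  have "?unif \<longleftrightarrow> continuous_map ?T (discrete_topology S) (\<lambda>(\<xi>, s). \<phi> \<xi> s)"
    if S: "finite S" and act: "group_action ?H S \<phi>"
  proof
    assume cont: "continuous_map ?T (discrete_topology S) (\<lambda>(\<xi>, s). \<phi> \<xi> s)"
    have "\<exists>N\<in>fin_index_normals G. \<forall>\<zeta>\<in>carrier ?H. \<zeta> N = N \<longrightarrow> \<phi> \<zeta> s = s" if s: "s \<in> S" for s
    proof -
      have "continuous_map (profinite_topology G) ?T (\<lambda>\<xi>. (\<xi>, s))"
        using s by (intro continuous_map_pairedI) auto
      from continuous_map_compose[OF this cont]
      have "continuous_map (profinite_topology G) (discrete_topology S) (\<lambda>\<xi>. \<phi> \<xi> s)"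
        by (simp add: o_def)
      from openin_continuous_map_preimage[OF this, of "{s}"] s
      have "openin (profinite_topology G) {\<xi> \<in> carrier ?H. \<phi> \<xi> s = s}"
        by (simp add: topspace_profinite_topology)
      moreover have "\<one>\<^bsub>?H\<^esub> \<in> {\<xi> \<in> carrier ?H. \<phi> \<xi> s = s}"
        using group_action_one[OF act s] by simp
      ultimately obtain N where "N \<in> fin_index_normals G"
        "\<forall>\<zeta>\<in>carrier ?H. \<zeta> N = \<one>\<^bsub>?H\<^esub> N \<longrightarrow> \<zeta> \<in> {\<xi> \<in> carrier ?H. \<phi> \<xi> s = s}"
        unfolding openin_profinite_topology by blast
      then show ?thesis
        using one_profinite_completion[of N G] by auto
    qed
    then obtain N where N: "\<And>s. s \<in> S \<Longrightarrow> N s \<in> fin_index_normals G"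
      "\<And>s \<zeta>. s \<in> S \<Longrightarrow> \<zeta> \<in> carrier ?H \<Longrightarrow> \<zeta> (N s) = N s \<Longrightarrow> \<phi> \<zeta> s = s"
      by metis
    obtain M where M: "M \<in> fin_index_normals G" "\<And>s. s \<in> S \<Longrightarrow> M \<subseteq> N s"
      using fin_index_normals_INT[OF S, of N] N(1) by blast
    have "\<phi> \<xi> s = \<phi> \<zeta> s" if \<xi>: "\<xi> \<in> carrier ?H" and \<zeta>: "\<zeta> \<in> carrier ?H" and eq: "\<xi> M = \<zeta> M" and s: "s \<in> S" for \<xi> \<zeta> s
    proof -
      \<comment> \<open>The quotient of \<open>\<xi>\<close> and \<open>\<zeta>\<close> is trivial
        at \<open>M\<close>, hence at every level above \<open>M\<close>, and so it fixes
        \<open>s\<close>.\<close>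
      define \<omega> where "\<omega> = inv\<^bsub>?H\<^esub> \<xi> \<otimes>\<^bsub>?H\<^esub> \<zeta>"
      have \<omega>: "\<omega> \<in> carrier ?H" "\<zeta> = \<xi> \<otimes>\<^bsub>?H\<^esub> \<omega>"
        using \<xi> \<zeta> by (auto simp: \<omega>_def simp flip: H.m_assoc)
      have "\<omega> M = (inv\<^bsub>?H\<^esub> \<xi> \<otimes>\<^bsub>?H\<^esub> \<xi>) M"
        using M(1) eq by (simp add: \<omega>_def mult_profinite_completion)
      then have "\<omega> M = \<one>\<^bsub>?H\<^esub> M"
        using \<xi> by simp
      then have "\<omega> (N s) = \<one>\<^bsub>?H\<^esub> (N s)"
        by (rule profinite_component_eq_mono[OF \<omega>(1) H.one_closed M(1) N(1)[OF s] M(2)[OF s]])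
      then have "\<phi> \<omega> s = s"
        using N(2)[OF s \<omega>(1)] one_profinite_completion[OF N(1)[OF s]] by simp
      then show ?thesis
        using group_action_mult[OF act \<xi> \<omega>(1) s] \<omega>(2) by simp
    qed
    then show ?unif
      using M(1) by blast
  next
    assume ?unif
    then obtain N where N: "N \<in> fin_index_normals G"
      "\<And>\<xi> \<zeta> s. \<xi> \<in> carrier ?H \<Longrightarrow> \<zeta> \<in> carrier ?H \<Longrightarrow> \<xi> N = \<zeta> N \<Longrightarrow> s \<in> S \<Longrightarrow> \<phi> \<xi> s = \<phi> \<zeta> s"
      by blast
    have "openin ?T {z \<in> topspace ?T. (case z of (\<xi>, s) \<Rightarrow> \<phi> \<xi> s) \<in> W}" for W
      unfolding openin_prod_topology_alt
    proof (intro allI impI)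
      fix \<xi> s assume "(\<xi>, s) \<in> {z \<in> topspace ?T. (case z of (\<xi>, s) \<Rightarrow> \<phi> \<xi> s) \<in> W}"
      then have \<xi>: "\<xi> \<in> carrier ?H" "s \<in> S" "\<phi> \<xi> s \<in> W"
        by (auto simp: topspace_profinite_topology)
      have "openin (profinite_topology G) {\<zeta> \<in> carrier ?H. \<zeta> N = \<xi> N}"
        unfolding openin_profinite_topology using N(1) by auto
      moreover have "{\<zeta> \<in> carrier ?H. \<zeta> N = \<xi> N} \<times> {s} \<subseteq>
          {z \<in> topspace ?T. (case z of (\<xi>, s) \<Rightarrow> \<phi> \<xi> s) \<in> W}"
      proof
        fix z assume z: "z \<in> {\<zeta> \<in> carrier ?H. \<zeta> N = \<xi> N} \<times> {s}"
        then obtain \<zeta> where \<zeta>: "z = (\<zeta>, s)" "\<zeta> \<in> carrier ?H" "\<zeta> N = \<xi> N"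
          by blast
        then show "z \<in> {z \<in> topspace ?T. (case z of (\<xi>, s) \<Rightarrow> \<phi> \<xi> s) \<in> W}"
          using N(2)[OF \<zeta>(2) \<xi>(1) \<zeta>(3) \<xi>(2)] \<xi> by (simp add: topspace_profinite_topology)
      qed
      moreover have "openin (discrete_topology S) {s}" "\<xi> \<in> {\<zeta> \<in> carrier ?H. \<zeta> N = \<xi> N}" "s \<in> {s}"
        using \<xi> by auto
      ultimately show "\<exists>U V. openin (profinite_topology G) U \<and> openin (discrete_topology S) V \<and> \<xi> \<in> U \<and> s \<in> V \<and>
          U \<times> V \<subseteq> {z \<in> topspace ?T. (case z of (\<xi>, s) \<Rightarrow> \<phi> \<xi> s) \<in> W}"
        by (intro exI conjI)
    qed
    then show "continuous_map ?T (discrete_topology S) (\<lambda>(\<xi>, s). \<phi> \<xi> s)"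
      unfolding continuous_map
      using group_action_closed[OF act] by (auto simp: topspace_profinite_topology)
  qed
  then show ?thesis
    unfolding finite_cont_gset_def by auto
qed

section \<open>Actions of a group and of its profinite completion\<close>

lemma kernel_BijGroup:
  assumes "group_action G S \<mu>"
  shows "g \<in> kernel G (BijGroup S) \<mu> \<longleftrightarrow> g \<in> carrier G \<and> (\<forall>s\<in>S. \<mu> g s = s)"
proof -
  have "\<mu> g = (\<lambda>s\<in>S. s) \<longleftrightarrow> (\<forall>s\<in>S. \<mu> g s = s)" if "g \<in> carrier G"
  proof
    assume "\<forall>s\<in>S. \<mu> g s = s"
    then show "\<mu> g = (\<lambda>s\<in>S. s)"
      using group_action_extensional[OF assms that] by (intro extensionalityI[of _ S]) auto
  qed simp
  then show ?thesis
    by (auto simp: kernel_def BijGroup_def)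
qed

text \<open>The quotient by the kernel injects into the permutations of \<open>S\<close>, of which
  there are finitely many.\<close>

lemma (in group) kernel_fin_index:
  assumes act: "group_action G S \<mu>" and S: "finite S"
  shows "kernel G (BijGroup S) \<mu> \<in> fin_index_normals G"
proof -
  interpret act: group_hom G "BijGroup S" \<mu>
    using act by (simp add: group_action_def)
  let ?K = "kernel G (BijGroup S) \<mu>"
  have "finite (S \<rightarrow>\<^sub>E S)"
    using S by (simp add: finite_PiE)
  then have fin: "finite (carrier (BijGroup S))"
    by (rule rev_finite_subset) (auto simp: BijGroup_def Bij_def bij_betw_def PiE_def)
  have "(\<lambda>X. the_elem (\<mu> ` X)) ` carrier (G Mod ?K) \<subseteq> carrier (BijGroup S)"
    using act.FactGroup_the_elem_mem by blast
  then have "finite (carrier (G Mod ?K))"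
    using fin act.FactGroup_inj_on inj_on_finite by blast
  then show ?thesis
    using act.normal_kernel by (simp add: fin_index_normals_def FactGroup_def)
qed

text \<open>Representatives of the component at the kernel differ by kernel elements, which act
  trivially; so the image in \<open>completed_action\<close> is a singleton.\<close>

lemma (in group) completed_action_eq:
  assumes act: "group_action G S \<mu>" and S: "finite S" and \<xi>: "\<xi> \<in> carrier (profinite_completion G)"
    and g: "g \<in> \<xi> (kernel G (BijGroup S) \<mu>)" and s: "s \<in> S"
  shows "completed_action G S \<mu> \<xi> s = \<mu> g s"
proof -
  let ?K = "kernel G (BijGroup S) \<mu>"
  note K = kernel_fin_index[OF act S]
  note KK = fin_index_normalsD(2)[OF K] profinite_component[OF \<xi> K]
  have g': "\<xi> ?K = ?K #> g" "g \<in> carrier G"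
    using rcoset_of_member[OF KK g] by auto
  have "\<mu> a s = \<mu> g s" if a: "a \<in> \<xi> ?K" for a
  proof -
    obtain k where k: "k \<in> ?K" "a = k \<otimes> g"
      using a unfolding g'(1) r_coset_def by blast
    then show ?thesis
      using act s g'(2) group_action_mult[OF act _ g'(2) s, of k] group_action_closed[OF act g'(2) s]
      by (simp add: kernel_BijGroup[OF act])
  qed
  then have "(\<lambda>a. \<mu> a s) ` \<xi> ?K = (\<lambda>a. \<mu> g s) ` \<xi> ?K"
    by (rule image_cong[OF refl])
  also have "\<dots> = {\<mu> g s}"
    using image_constant[OF g] .
  finally show ?thesis
    using s by (simp only: completed_action_def restrict_apply' the_elem_eq)
qed

lemma (in group) completed_action_ex:
  assumes act: "group_action G S \<mu>" and S: "finite S" and \<xi>: "\<xi> \<in> carrier (profinite_completion G)"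
  obtains g where "g \<in> carrier G" "g \<in> \<xi> (kernel G (BijGroup S) \<mu>)"
    "\<And>s. s \<in> S \<Longrightarrow> completed_action G S \<mu> \<xi> s = \<mu> g s"
  using profinite_approx[OF \<xi> kernel_fin_index[OF act S]] completed_action_eq[OF act S \<xi>] by metis

lemma (in group) completed_action_to_completion:
  assumes act: "group_action G S \<mu>" and S: "finite S" and g: "g \<in> carrier G" and s: "s \<in> S"
  shows "completed_action G S \<mu> (to_completion G g) s = \<mu> g s"
proof (rule completed_action_eq[OF act S to_completion_closed[OF g] _ s])
  show "g \<in> to_completion G g (kernel G (BijGroup S) \<mu>)"
    using kernel_fin_index[OF act S] fin_index_normalsD(2) rcos_self[OF g]
    by (auto simp: to_completion_def)
qed

text \<open>The kernel itself is the level of continuity. Multiplicativity holds because a product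
  of representatives represents the product.\<close>

lemma (in group) finite_cont_gset_completed_action:
  assumes act: "group_action G S \<mu>" and S: "finite S"
  shows "finite_cont_gset G (S, completed_action G S \<mu>)"
  unfolding finite_cont_gset_iff
proof (intro conjI S group_actionI[OF group_profinite_completion])
  let ?H = "profinite_completion G" and ?K = "kernel G (BijGroup S) \<mu>"
  interpret H: group ?H
    by (rule group_profinite_completion)
  note K = kernel_fin_index[OF act S]
  show "completed_action G S \<mu> \<xi> \<in> extensional S" for \<xi>
    by (simp add: completed_action_def)
  show "completed_action G S \<mu> \<xi> s \<in> S" if "\<xi> \<in> carrier ?H" "s \<in> S" for \<xi> s
    using completed_action_ex[OF act S that(1)] group_action_closed[OF act _ that(2)] that(2) by metis
  show "completed_action G S \<mu> \<one>\<^bsub>?H\<^esub> s = s" if "s \<in> S" for s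
    using completed_action_to_completion[OF act S one_closed that] group_action_one[OF act that]
    by (simp add: to_completion_one)
  show "completed_action G S \<mu> (\<xi> \<otimes>\<^bsub>?H\<^esub> \<zeta>) s = completed_action G S \<mu> \<xi> (completed_action G S \<mu> \<zeta> s)"
    if \<xi>: "\<xi> \<in> carrier ?H" and \<zeta>: "\<zeta> \<in> carrier ?H" and s: "s \<in> S" for \<xi> \<zeta> s
  proof -
    obtain g where g: "g \<in> carrier G" "g \<in> \<xi> ?K" "\<And>s. s \<in> S \<Longrightarrow> completed_action G S \<mu> \<xi> s = \<mu> g s"
      using completed_action_ex[OF act S \<xi>] by blast
    obtain h where h: "h \<in> carrier G" "h \<in> \<zeta> ?K" "\<And>s. s \<in> S \<Longrightarrow> completed_action G S \<mu> \<zeta> s = \<mu> h s"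
      using completed_action_ex[OF act S \<zeta>] by blast
    have "g \<otimes> h \<in> (\<xi> \<otimes>\<^bsub>?H\<^esub> \<zeta>) ?K"
      using g(2) h(2) by (auto simp: mult_profinite_completion[OF K] set_mult_def)
    then have "completed_action G S \<mu> (\<xi> \<otimes>\<^bsub>?H\<^esub> \<zeta>) s = \<mu> (g \<otimes> h) s"
      using completed_action_eq[OF act S _ _ s] \<xi> \<zeta> by simp
    then show ?thesis
      using g h s group_action_mult[OF act g(1) h(1) s] group_action_closed[OF act h(1) s] by simp
  qed
  show "\<exists>N\<in>fin_index_normals G. \<forall>\<xi>\<in>carrier ?H. \<forall>\<zeta>\<in>carrier ?H.
      \<xi> N = \<zeta> N \<longrightarrow> (\<forall>s\<in>S. completed_action G S \<mu> \<xi> s = completed_action G S \<mu> \<zeta> s)"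
    using K by (intro bexI[of _ ?K]) (auto simp: completed_action_def)
qed

section \<open>Comparison of actions of the group and of its completion\<close>

lemma (in group) group_action_restrict_completion:
  assumes act: "group_action (profinite_completion G) S \<phi>"
  shows "group_action G S (\<lambda>g. \<phi> (to_completion G g))"
  using group_action_closed[OF act] group_action_one[OF act] group_action_mult[OF act]
    group_action_extensional[OF act]
  by (intro group_actionI group_axioms) (simp_all add: to_completion_closed to_completion_one to_completion_mult)

text \<open>A continuous action is recovered from its restriction to \<open>G\<close>. The
  approximating \<open>g\<close> is taken below two levels at once: the level \<open>N\<close> of
  continuity of \<open>\<phi>\<close>, and the kernel that \<open>completed_action\<close> looks
  at.\<close>

lemma (in group) completed_action_restrict:
  assumes \<phi>: "finite_cont_gset G (S, \<phi>)" and \<xi>: "\<xi> \<in> carrier (profinite_completion G)" and s: "s \<in> S"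
  shows "completed_action G S (\<lambda>g. \<phi> (to_completion G g)) \<xi> s = \<phi> \<xi> s"
proof -
  let ?\<mu> = "\<lambda>g. \<phi> (to_completion G g)"
  obtain N where S: "finite S" and act': "group_action (profinite_completion G) S \<phi>"
    and N: "N \<in> fin_index_normals G"
      "\<And>\<xi> \<zeta> s. \<xi> \<in> carrier (profinite_completion G) \<Longrightarrow> \<zeta> \<in> carrier (profinite_completion G) \<Longrightarrow>
        \<xi> N = \<zeta> N \<Longrightarrow> s \<in> S \<Longrightarrow> \<phi> \<xi> s = \<phi> \<zeta> s"
    using \<phi> unfolding finite_cont_gset_iff by blast
  note act = group_action_restrict_completion[OF act']
  note K = kernel_fin_index[OF act S]
  note L = fin_index_normals_Int[OF N(1) K]
  obtain g where g: "g \<in> carrier G" "g \<in> \<xi> (N \<inter> kernel G (BijGroup S) ?\<mu>)"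
    "to_completion G g (N \<inter> kernel G (BijGroup S) ?\<mu>) = \<xi> (N \<inter> kernel G (BijGroup S) ?\<mu>)"
    by (rule profinite_approx[OF \<xi> L])
  have "to_completion G g N = \<xi> N"
    by (rule profinite_component_eq_mono[OF to_completion_closed[OF g(1)] \<xi> L N(1) _ g(3)]) blast
  then have "\<phi> \<xi> s = ?\<mu> g s"
    using N(2)[OF to_completion_closed[OF g(1)] \<xi>] s by simp
  moreover have "g \<in> \<xi> (kernel G (BijGroup S) ?\<mu>)"
    using profinite_component_mono[OF \<xi> L K] g(2) by auto
  ultimately show ?thesis
    using completed_action_eq[OF act S \<xi> _ s] by simp
qed

text \<open>The two completed actions look at different kernels; approximation at their intersection
  gives one \<open>g\<close> that represents \<open>\<xi>\<close> in both.\<close>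

lemma (in group) completed_equivariant_iff:
  assumes act: "group_action G S \<mu>" "group_action G T \<nu>" and fin: "finite S" "finite T" and f: "f \<in> S \<rightarrow> T"
  shows "(\<forall>\<xi>\<in>carrier (profinite_completion G). \<forall>s\<in>S.
      f (completed_action G S \<mu> \<xi> s) = completed_action G T \<nu> \<xi> (f s)) \<longleftrightarrow>
    (\<forall>g\<in>carrier G. \<forall>s\<in>S. f (\<mu> g s) = \<nu> g (f s))"
proof (intro iffI ballI)
  fix g s assume H: "\<forall>\<xi>\<in>carrier (profinite_completion G). \<forall>s\<in>S.
      f (completed_action G S \<mu> \<xi> s) = completed_action G T \<nu> \<xi> (f s)"
    and g: "g \<in> carrier G" and s: "s \<in> S"
  have "f s \<in> T"
    using f s by blast
  then show "f (\<mu> g s) = \<nu> g (f s)"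
    using H to_completion_closed[OF g] s completed_action_to_completion[OF act(1) fin(1) g s]
      completed_action_to_completion[OF act(2) fin(2) g] by metis
next
  fix \<xi> s assume H: "\<forall>g\<in>carrier G. \<forall>s\<in>S. f (\<mu> g s) = \<nu> g (f s)"
    and \<xi>: "\<xi> \<in> carrier (profinite_completion G)" and s: "s \<in> S"
  let ?K = "kernel G (BijGroup S) \<mu>" and ?K' = "kernel G (BijGroup T) \<nu>"
  note K = kernel_fin_index[OF act(1) fin(1)] kernel_fin_index[OF act(2) fin(2)]
  note L = fin_index_normals_Int[OF K]
  obtain g where g: "g \<in> carrier G" "g \<in> \<xi> (?K \<inter> ?K')"
    using profinite_approx[OF \<xi> L] by blast
  then have "g \<in> \<xi> ?K" "g \<in> \<xi> ?K'"
    using profinite_component_mono[OF \<xi> L K(1)] profinite_component_mono[OF \<xi> L K(2)] by auto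
  moreover have "f s \<in> T"
    using f s by blast
  ultimately show "f (completed_action G S \<mu> \<xi> s) = completed_action G T \<nu> \<xi> (f s)"
    using completed_action_eq[OF act(1) fin(1) \<xi>] completed_action_eq[OF act(2) fin(2) \<xi>] s H g(1) by simp
qed

text \<open>Each element of the completion acts as some element of \<open>G\<close>, so both have
  the same orbits.\<close>

lemma (in group) completed_transitive_iff:
  assumes act: "group_action G S \<mu>" and S: "finite S"
  shows "transitive_action (profinite_completion G) S (completed_action G S \<mu>) \<longleftrightarrow>
    (\<forall>s\<in>S. \<forall>t\<in>S. \<exists>g\<in>carrier G. \<mu> g s = t)"
proof -
  have "(\<exists>\<xi>\<in>carrier (profinite_completion G). completed_action G S \<mu> \<xi> s = t) \<longleftrightarrow> (\<exists>g\<in>carrier G. \<mu> g s = t)"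
    if "s \<in> S" for s t
    using that completed_action_ex[OF act S] completed_action_to_completion[OF act S] to_completion_closed
    by metis
  moreover have "group_action (profinite_completion G) S (completed_action G S \<mu>)"
    using finite_cont_gset_completed_action[OF act S] by (simp add: finite_cont_gset_iff)
  ultimately show ?thesis
    by (auto simp: transitive_action_def transitive_action_axioms_def)
qed

section \<open>Coset spaces\<close>

lemma (in group) lcoset_eq_iff:
  assumes N: "subgroup N G" and a: "a \<in> carrier G" and b: "b \<in> carrier G"
  shows "a <# N = b <# N \<longleftrightarrow> inv a \<otimes> b \<in> N"
proof
  assume "a <# N = b <# N"
  then have "b \<in> a <# N"
    using lcos_self[OF b N] by simp
  then show "inv a \<otimes> b \<in> N"
    using a subgroup.mem_carrier[OF N] by (auto simp: l_coset_def simp flip: m_assoc)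
next
  assume "inv a \<otimes> b \<in> N"
  then have "a \<otimes> (inv a \<otimes> b) \<in> a <# N"
    by (auto simp: l_coset_def)
  then have "b \<in> a <# N"
    using a b by (simp flip: m_assoc)
  then show "a <# N = b <# N"
    using l_repr_independence[OF _ a N] by blast
qed

lemma (in group) group_action_coset_space:
  assumes N: "subgroup N G"
  shows "group_action G (lcosets N) (snd (coset_space G N))"
proof (rule group_actionI[OF group_axioms])
  fix g h A assume g: "g \<in> carrier G" and A: "A \<in> lcosets N"
  obtain a where a: "a \<in> carrier G" "A = a <# N"
    using A by (auto simp: LCOSETS_def)
  show *: "snd (coset_space G N) g A \<in> lcosets N"
    using a g A by (auto simp: coset_space_def LCOSETS_def lcos_m_assoc subgroup.subset[OF N])
  assume h: "h \<in> carrier G"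
  have "h <# A \<in> lcosets N"
    using a h by (auto simp: LCOSETS_def lcos_m_assoc subgroup.subset[OF N])
  then show "snd (coset_space G N) (g \<otimes> h) A = snd (coset_space G N) g (snd (coset_space G N) h A)"
    using a g h A by (simp add: coset_space_def lcos_m_assoc l_coset_subset_G subgroup.subset[OF N] m_assoc)
next
  fix A assume A: "A \<in> lcosets N"
  then obtain a where a: "a \<in> carrier G" "A = a <# N"
    by (auto simp: LCOSETS_def)
  show "snd (coset_space G N) \<one> A = A"
    using A a by (simp add: coset_space_def lcos_m_assoc subgroup.subset[OF N])
qed (simp add: coset_space_def)

text \<open>An open \<open>N\<close> contains all elements that are trivial at some level
  \<open>M\<close>. Hence the left coset of \<open>\<xi>\<close> depends only on
  \<open>\<xi> M\<close>, which yields both finiteness and continuity.\<close>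

lemma (in group) finite_cont_gset_coset_space:
  assumes N: "open_normal_subgroup G N"
  shows "finite_cont_gset G (coset_space (profinite_completion G) N)"
proof -
  let ?H = "profinite_completion G"
  interpret H: group ?H
    by (rule group_profinite_completion)
  have N': "N \<lhd> ?H" "openin (profinite_topology G) N" and sub: "subgroup N ?H"
    using N by (auto simp: open_normal_subgroup_def normal_def)
  obtain M where M: "M \<in> fin_index_normals G" "\<And>\<zeta>. \<zeta> \<in> carrier ?H \<Longrightarrow> \<zeta> M = M \<Longrightarrow> \<zeta> \<in> N"
  proof -
    have "\<one>\<^bsub>?H\<^esub> \<in> N"
      by (rule subgroup.one_closed[OF sub])
    then show thesis
      using that N'(2) one_profinite_completion[of _ G] unfolding openin_profinite_topology by metis
  qed
  have eq: "\<xi> <#\<^bsub>?H\<^esub> N = \<zeta> <#\<^bsub>?H\<^esub> N"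
    if "\<xi> \<in> carrier ?H" "\<zeta> \<in> carrier ?H" "\<xi> M = \<zeta> M" for \<xi> \<zeta>
  proof -
    have "(inv\<^bsub>?H\<^esub> \<xi> \<otimes>\<^bsub>?H\<^esub> \<zeta>) M = (inv\<^bsub>?H\<^esub> \<xi> \<otimes>\<^bsub>?H\<^esub> \<xi>) M"
      using that(3) by (simp only: mult_profinite_completion[OF M(1)])
    then have "inv\<^bsub>?H\<^esub> \<xi> \<otimes>\<^bsub>?H\<^esub> \<zeta> \<in> N"
      using that M one_profinite_completion[OF M(1)] by simp
    then show ?thesis
      using H.lcoset_eq_iff[OF sub] that by simp
  qed
  \<comment> \<open>A chosen element of the completion with prescribed component at
    \<open>M\<close>; it exhibits the cosets of \<open>N\<close> as an image of the finitely many
    cosets of \<open>M\<close>.\<close>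
  define r where "r A = (SOME \<xi>. \<xi> \<in> carrier ?H \<and> \<xi> M = A)" for A
  have r: "r (\<xi> M) \<in> carrier ?H \<and> r (\<xi> M) M = \<xi> M" if "\<xi> \<in> carrier ?H" for \<xi>
    unfolding r_def by (rule someI[of _ \<xi>]) (use that in simp)
  have fin: "finite (lcosets\<^bsub>?H\<^esub> N)"
  proof (rule finite_surj[OF fin_index_normalsD(3)[OF M(1)]])
    show "lcosets\<^bsub>?H\<^esub> N \<subseteq> (\<lambda>A. r A <#\<^bsub>?H\<^esub> N) ` (rcosets M)"
    proof
      fix B assume "B \<in> lcosets\<^bsub>?H\<^esub> N"
      then obtain \<xi> where \<xi>: "\<xi> \<in> carrier ?H" "B = \<xi> <#\<^bsub>?H\<^esub> N"
        by (auto simp: LCOSETS_def)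
      then have "B = r (\<xi> M) <#\<^bsub>?H\<^esub> N"
        using eq[of \<xi> "r (\<xi> M)"] r by simp
      then show "B \<in> (\<lambda>A. r A <#\<^bsub>?H\<^esub> N) ` (rcosets M)"
        using profinite_component[OF \<xi>(1) M(1)] by blast
    qed
  qed
  have act_eq: "\<xi> <#\<^bsub>?H\<^esub> A = \<zeta> <#\<^bsub>?H\<^esub> A"
    if \<xi>: "\<xi> \<in> carrier ?H" "\<zeta> \<in> carrier ?H" "\<xi> M = \<zeta> M" and A: "A \<in> lcosets\<^bsub>?H\<^esub> N" for \<xi> \<zeta> A
  proof -
    obtain \<omega> where \<omega>: "\<omega> \<in> carrier ?H" "A = \<omega> <#\<^bsub>?H\<^esub> N"
      using A by (auto simp: LCOSETS_def)
    have "(\<xi> \<otimes>\<^bsub>?H\<^esub> \<omega>) M = (\<zeta> \<otimes>\<^bsub>?H\<^esub> \<omega>) M"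
      using \<xi>(3) M(1) by (simp add: mult_profinite_completion)
    then show ?thesis
      using eq[of "\<xi> \<otimes>\<^bsub>?H\<^esub> \<omega>" "\<zeta> \<otimes>\<^bsub>?H\<^esub> \<omega>"] \<xi> \<omega> by (simp add: H.lcos_m_assoc subgroup.subset[OF sub])
  qed
  have "snd (coset_space ?H N) \<xi> A = snd (coset_space ?H N) \<zeta> A"
    if "\<xi> \<in> carrier ?H" "\<zeta> \<in> carrier ?H" "\<xi> M = \<zeta> M" "A \<in> lcosets\<^bsub>?H\<^esub> N" for \<xi> \<zeta> A
    using act_eq[OF that] that(4) by (simp add: coset_space_def)
  then have "finite_cont_gset G (lcosets\<^bsub>?H\<^esub> N, snd (coset_space ?H N))"
    unfolding finite_cont_gset_iff
    by (intro conjI fin H.group_action_coset_space[OF sub] bexI[OF _ M(1)] ballI impI)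
  then show ?thesis
    by (simp add: coset_space_def)
qed

text \<open>Automorphisms preserve stabilisers, so if they act transitively, all stabilisers coincide.\<close>

lemma (in group) coset_space_of_regular_action:
  assumes act: "group_action G S \<phi>" and s0: "s0 \<in> S"
    and trans: "\<And>s. s \<in> S \<Longrightarrow> \<exists>g\<in>carrier G. \<phi> g s0 = s"
    and aut: "\<And>s. s \<in> S \<Longrightarrow> \<exists>f\<in>equivariant_maps G (S, \<phi>) (S, \<phi>). f s0 = s"
  shows "stabilizer G \<phi> s0 \<lhd> G"
    and "gset_isomorphic G (S, \<phi>) (coset_space G (stabilizer G \<phi> s0))"
proof -
  let ?N = "stabilizer G \<phi> s0"
  have sub: "subgroup ?N G"
    using group_action.stabilizer_subgroup[OF act s0] .
  have fixes_all: "\<phi> h s = s" if h: "h \<in> ?N" and s: "s \<in> S" for h s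
  proof -
    obtain f where f: "f \<in> equivariant_maps G (S, \<phi>) (S, \<phi>)" "f s0 = s"
      using aut[OF s] by blast
    then have "\<forall>h\<in>carrier G. \<forall>s\<in>S. f (\<phi> h s) = \<phi> h (f s)" "h \<in> carrier G"
      using h by (simp_all add: equivariant_maps_def stabilizer_def)
    then have "f (\<phi> h s0) = \<phi> h (f s0)"
      using s0 by blast
    then show ?thesis
      using h f(2) by (simp add: stabilizer_def)
  qed
  show normal: "?N \<lhd> G"
    unfolding normal_inv_iff
  proof (intro conjI sub ballI)
    fix g h assume g: "g \<in> carrier G" and h: "h \<in> ?N"
    have hG: "h \<in> carrier G"
      using h by (simp add: stabilizer_def)
    have "\<phi> (g \<otimes> h \<otimes> inv g) s0 = \<phi> g (\<phi> h (\<phi> (inv g) s0))"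
      using g hG s0 group_action_closed[OF act] by (simp add: group_action_mult[OF act])
    also have "\<dots> = \<phi> g (\<phi> (inv g) s0)"
      using fixes_all[OF h group_action_closed[OF act inv_closed[OF g] s0]] by simp
    also have "\<dots> = \<phi> (g \<otimes> inv g) s0"
      using group_action_mult[OF act g inv_closed[OF g] s0] by (rule sym)
    finally show "g \<otimes> h \<otimes> inv g \<in> ?N"
      using g hG s0 group_action_one[OF act] by (simp add: stabilizer_def)
  qed
  \<comment> \<open>The inverse of the orbit map: a point goes to the set of elements that carry
    \<open>s0\<close> to it, which is a left coset of the stabiliser.\<close>
  define F where "F = (\<lambda>s\<in>S. {g \<in> carrier G. \<phi> g s0 = s})"
  have F: "F (\<phi> g s0) = g <# ?N" if g: "g \<in> carrier G" for g
  proof -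
    have "\<phi> a s0 = \<phi> g s0 \<longleftrightarrow> inv g \<otimes> a \<in> ?N" if a: "a \<in> carrier G" for a
    proof
      assume "\<phi> a s0 = \<phi> g s0"
      then have "\<phi> (inv g \<otimes> a) s0 = \<phi> (inv g \<otimes> g) s0"
        using a g s0 by (simp only: group_action_mult[OF act] inv_closed)
      then show "inv g \<otimes> a \<in> ?N"
        using a g s0 group_action_one[OF act] by (simp add: stabilizer_def)
    next
      assume *: "inv g \<otimes> a \<in> ?N"
      have "\<phi> a s0 = \<phi> (g \<otimes> (inv g \<otimes> a)) s0"
        using a g by (simp flip: m_assoc)
      also have "\<dots> = \<phi> g s0"
        using * a g s0 group_action_mult[OF act g, of "inv g \<otimes> a" s0] by (simp add: stabilizer_def)
      finally show "\<phi> a s0 = \<phi> g s0" .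
    qed
    moreover have "a \<in> g <# ?N \<longleftrightarrow> a \<in> carrier G \<and> inv g \<otimes> a \<in> ?N" for a
    proof
      assume "a \<in> g <# ?N"
      then obtain n where "n \<in> ?N" "a = g \<otimes> n"
        by (auto simp: l_coset_def)
      then show "a \<in> carrier G \<and> inv g \<otimes> a \<in> ?N"
        using g subgroup.mem_carrier[OF sub] by (simp flip: m_assoc)
    next
      assume "a \<in> carrier G \<and> inv g \<otimes> a \<in> ?N"
      then show "a \<in> g <# ?N"
        using g by (auto simp: l_coset_def inv_solve_left' simp flip: m_assoc intro!: bexI[of _ "inv g \<otimes> a"])
    qed
    ultimately show ?thesis
      using group_action_closed[OF act g s0] by (auto simp: F_def)
  qed
  show "gset_isomorphic G (S, \<phi>) (coset_space G ?N)"
    unfolding gset_isomorphic_def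
  proof (intro bexI)
    show "bij_betw F (fst (S, \<phi>)) (fst (coset_space G ?N))"
      unfolding bij_betw_def
    proof
      have "s = t" if "s \<in> S" "t \<in> S" "F s = F t" for s t
        using that trans[OF that(1)] by (auto simp: F_def)
      then show "inj_on F (fst (S, \<phi>))"
        by (auto simp: inj_on_def)
      have "F ` S = (\<lambda>g. F (\<phi> g s0)) ` carrier G"
        using trans group_action_closed[OF act _ s0] by force
      also have "\<dots> = lcosets ?N"
        using F by (auto simp: LCOSETS_def)
      finally show "F ` fst (S, \<phi>) = fst (coset_space G ?N)"
        by (simp add: coset_space_def)
    qed
    have F_in: "F s \<in> lcosets ?N" if "s \<in> S" for s
      using trans[OF that] F by (auto simp: LCOSETS_def)
    have "F (\<phi> h s) = h <# F s" if h: "h \<in> carrier G" and s: "s \<in> S" for h s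
    proof -
      obtain g where g: "g \<in> carrier G" "\<phi> g s0 = s"
        using trans[OF s] by blast
      then have "F (\<phi> h s) = (h \<otimes> g) <# ?N"
        using F[of "h \<otimes> g"] h s0 by (simp add: group_action_mult[OF act])
      then show ?thesis
        using F[OF g(1)] g h by (simp add: lcos_m_assoc subgroup.subset[OF sub])
    qed
    then show "F \<in> equivariant_maps G (S, \<phi>) (coset_space G ?N)"
      using F_in by (auto simp: equivariant_maps_def coset_space_def F_def)
  qed
qed

text \<open>The maps in the last claim are right translations, which are well defined on the left cosets of
  a normal subgroup.\<close>

lemma (in group) regular_action_of_coset_space:
  assumes N: "N \<lhd> G" and act: "group_action G S \<phi>" and iso: "gset_isomorphic G (S, \<phi>) (coset_space G N)"
  shows "S \<noteq> {}"
    and "\<And>s t. s \<in> S \<Longrightarrow> t \<in> S \<Longrightarrow> \<exists>g\<in>carrier G. \<phi> g s = t"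
    and "\<And>s t. s \<in> S \<Longrightarrow> t \<in> S \<Longrightarrow> \<exists>f\<in>equivariant_maps G (S, \<phi>) (S, \<phi>). f s = t"
proof -
  have sub: "subgroup N G"
    using N by (simp add: normal_def)
  obtain F where F: "bij_betw F S (lcosets N)" "\<And>g s. g \<in> carrier G \<Longrightarrow> s \<in> S \<Longrightarrow> F (\<phi> g s) = g <# F s"
    using iso by (force simp: gset_isomorphic_def equivariant_maps_def coset_space_def)
  have F_in: "F s \<in> lcosets N" if "s \<in> S" for s
    using F(1) that by (auto simp: bij_betw_def)
  show "S \<noteq> {}"
    using F(1) by (auto simp: bij_betw_def LCOSETS_def)
  show "\<exists>g\<in>carrier G. \<phi> g s = t" if s: "s \<in> S" and t: "t \<in> S" for s t
  proof -
    obtain a b where ab: "a \<in> carrier G" "F s = a <# N" "b \<in> carrier G" "F t = b <# N"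
      using F_in[OF s] F_in[OF t] by (auto simp: LCOSETS_def)
    let ?g = "b \<otimes> inv a"
    have "F (\<phi> ?g s) = F t"
      using ab s by (simp add: F(2) lcos_m_assoc subgroup.subset[OF sub] m_assoc)
    then have "\<phi> ?g s = t"
      using F(1) t group_action_closed[OF act _ s, of ?g] ab by (auto simp: bij_betw_def inj_on_def)
    then show ?thesis
      using ab by blast
  qed
  show "\<exists>f\<in>equivariant_maps G (S, \<phi>) (S, \<phi>). f s = t" if s: "s \<in> S" and t: "t \<in> S" for s t
  proof -
    obtain a b where ab: "a \<in> carrier G" "F s = a <# N" "b \<in> carrier G" "F t = b <# N"
      using F_in[OF s] F_in[OF t] by (auto simp: LCOSETS_def)
    \<comment> \<open>Right translation by \<open>k\<close> takes the coset of \<open>a\<close> to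
      that of \<open>b\<close>; \<open>f\<close> below is this translation transported along
      \<open>F\<close>.\<close>
    define k where "k = inv a \<otimes> b"
    have k: "k \<in> carrier G"
      using ab by (simp add: k_def)
    have R: "(c <# N) #> k = (c \<otimes> k) <# N" if c: "c \<in> carrier G" for c
    proof -
      have "(c <# N) #> k = c <# (N #> k)"
        using c k subgroup.subset[OF sub] by (simp add: coset_assoc)
      also have "\<dots> = c <# (k <# N)"
        using normal.coset_eq[OF N] k by simp
      finally show ?thesis
        using c k by (simp add: lcos_m_assoc subgroup.subset[OF sub])
    qed
    define f where "f = (\<lambda>s\<in>S. inv_into S F (F s #> k))"
    have Rk: "F s #> k \<in> lcosets N" if "s \<in> S" for s
      using F_in[OF that] R k by (auto simp: LCOSETS_def)
    have f: "f s \<in> S" "F (f s) = F s #> k" if "s \<in> S" for s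
      using Rk[OF that] F(1) that unfolding f_def bij_betw_def by (auto intro: inv_into_into simp: f_inv_into_f)
    have "f (\<phi> g u) = \<phi> g (f u)" if g: "g \<in> carrier G" and u: "u \<in> S" for g u
    proof -
      obtain c where c: "c \<in> carrier G" "F u = c <# N"
        using F_in[OF u] by (auto simp: LCOSETS_def)
      have \<phi>: "\<phi> g u \<in> S" "\<phi> g (f u) \<in> S"
        using group_action_closed[OF act g] u f by auto
      have "F (f (\<phi> g u)) = (g <# (c <# N)) #> k"
        using f(2)[OF \<phi>(1)] F(2)[OF g u] c by simp
      also have "\<dots> = g <# ((c <# N) #> k)"
        using g c k by (simp add: R lcos_m_assoc subgroup.subset[OF sub] m_assoc)
      also have "\<dots> = F (\<phi> g (f u))"
        using F(2)[OF g f(1)[OF u]] f(2)[OF u] c by simp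
      finally show ?thesis
        using F(1) f(1)[OF \<phi>(1)] \<phi>(2) by (auto simp: bij_betw_def inj_on_def)
    qed
    moreover have "f s = t"
    proof -
      have "a \<otimes> k = b"
        using ab by (simp add: k_def flip: m_assoc)
      then have "F (f s) = F t"
        using f(2)[OF s] ab R by simp
      then show ?thesis
        using F(1) f(1)[OF s] t by (auto simp: bij_betw_def inj_on_def)
    qed
    ultimately show ?thesis
      using f(1) by (intro bexI[of _ f]) (auto simp: equivariant_maps_def f_def)
  qed
qed

lemma (in group) openin_stabilizer:
  assumes "finite_cont_gset G (S, \<phi>)" "s \<in> S"
  shows "openin (profinite_topology G) (stabilizer (profinite_completion G) \<phi> s)"
proof -
  obtain N where N: "N \<in> fin_index_normals G"
    and "\<And>\<xi> \<zeta> s. \<xi> \<in> carrier (profinite_completion G) \<Longrightarrow> \<zeta> \<in> carrier (profinite_completion G) \<Longrightarrow>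
        \<xi> N = \<zeta> N \<Longrightarrow> s \<in> S \<Longrightarrow> \<phi> \<xi> s = \<phi> \<zeta> s"
    using assms(1) unfolding finite_cont_gset_iff by blast
  then have "\<zeta> \<in> stabilizer (profinite_completion G) \<phi> s"
    if "\<xi> \<in> stabilizer (profinite_completion G) \<phi> s" "\<zeta> \<in> carrier (profinite_completion G)" "\<zeta> N = \<xi> N" for \<xi> \<zeta>
    using that assms(2) unfolding stabilizer_def by (metis (no_types, lifting) mem_Collect_eq)
  then show ?thesis
    using N unfolding openin_profinite_topology by (auto simp: stabilizer_def)
qed

section \<open>Equivalences of categories\<close>

lemma category_arrow_closed:
  assumes "category C" "A \<in> Ob C" "B \<in> Ob C" "D \<in> Ob C" "f \<in> Arr C A B" "g \<in> Arr C B D"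
  shows "Cmp C A B D g f \<in> Arr C A D"
  using assms unfolding category_def by blast

lemma category_assoc:
  assumes "category C" "A \<in> Ob C" "B \<in> Ob C" "D \<in> Ob C" "E \<in> Ob C"
    "f \<in> Arr C A B" "g \<in> Arr C B D" "h \<in> Arr C D E"
  shows "Cmp C A D E h (Cmp C A B D g f) = Cmp C A B E (Cmp C B D E h g) f"
  using assms unfolding category_def by blast

lemma category_ident:
  assumes "category C" "A \<in> Ob C"
  shows "Ident C A \<in> Arr C A A"
    and "\<And>B f. B \<in> Ob C \<Longrightarrow> f \<in> Arr C A B \<Longrightarrow> Cmp C A A B f (Ident C A) = f"
    and "\<And>B f. B \<in> Ob C \<Longrightarrow> f \<in> Arr C B A \<Longrightarrow> Cmp C B A A (Ident C A) f = f"
  using assms unfolding category_def by blast+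

text \<open>Choice gives for each \<open>P\<close> an object \<open>G0 P\<close> and an isomorphism
  \<open>e P\<close> from its image. Arrows of \<open>D\<close> are conjugated by these isomorphisms
  and lifted through \<open>F\<close>; equations in \<open>C\<close> are checked after applying
  \<open>F\<close>.\<close>

theorem is_equivalence_if_fully_faithful:
  assumes F: "is_functor C D F"
    and ff: "\<And>A B. A \<in> Ob C \<Longrightarrow> B \<in> Ob C \<Longrightarrow> bij_betw (on_arr F A B) (Arr C A B) (Arr D (on_ob F A) (on_ob F B))"
    and ess: "\<And>P. P \<in> Ob D \<Longrightarrow> \<exists>A\<in>Ob C. \<exists>f. iso_arr D (on_ob F A) P f"
  shows "is_equivalence C D F"
proof -
  have C: "category C" and D: "category D"
    and F_ob: "\<And>A. A \<in> Ob C \<Longrightarrow> on_ob F A \<in> Ob D"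
    and F_arr: "\<And>A B f. A \<in> Ob C \<Longrightarrow> B \<in> Ob C \<Longrightarrow> f \<in> Arr C A B \<Longrightarrow> on_arr F A B f \<in> Arr D (on_ob F A) (on_ob F B)"
    and F_id: "\<And>A. A \<in> Ob C \<Longrightarrow> on_arr F A A (Ident C A) = Ident D (on_ob F A)"
    and F_cmp: "\<And>A B E f g. A \<in> Ob C \<Longrightarrow> B \<in> Ob C \<Longrightarrow> E \<in> Ob C \<Longrightarrow> f \<in> Arr C A B \<Longrightarrow> g \<in> Arr C B E \<Longrightarrow>
        on_arr F A E (Cmp C A B E g f) =
        Cmp D (on_ob F A) (on_ob F B) (on_ob F E) (on_arr F B E g) (on_arr F A B f)"
    using F unfolding is_functor_def by blast+
  note Dc = category_arrow_closed[OF D] and Da = category_assoc[OF D] and Di = category_ident[OF D]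
  obtain G0 where G0: "\<And>P. P \<in> Ob D \<Longrightarrow> G0 P \<in> Ob C" "\<And>P. P \<in> Ob D \<Longrightarrow> \<exists>f. iso_arr D (on_ob F (G0 P)) P f"
    using ess by metis
  then obtain e where e: "\<And>P. P \<in> Ob D \<Longrightarrow> iso_arr D (on_ob F (G0 P)) P (e P)"
    by metis
  let ?FG = "\<lambda>P. on_ob F (G0 P)"
  have "\<forall>P\<in>Ob D. \<exists>d. d \<in> Arr D P (?FG P) \<and> Cmp D (?FG P) P (?FG P) d (e P) = Ident D (?FG P) \<and>
      Cmp D P (?FG P) P (e P) d = Ident D P"
    using e unfolding iso_arr_def by blast
  then obtain d where d: "\<And>P. P \<in> Ob D \<Longrightarrow> d P \<in> Arr D P (?FG P)"
    "\<And>P. P \<in> Ob D \<Longrightarrow> Cmp D (?FG P) P (?FG P) (d P) (e P) = Ident D (?FG P)"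
    "\<And>P. P \<in> Ob D \<Longrightarrow> Cmp D P (?FG P) P (e P) (d P) = Ident D P"
    by metis
  have eA: "\<And>P. P \<in> Ob D \<Longrightarrow> e P \<in> Arr D (?FG P) P"
    using e unfolding iso_arr_def by blast
  have FG: "\<And>P. P \<in> Ob D \<Longrightarrow> ?FG P \<in> Ob D"
    using F_ob G0 by blast
  \<comment> \<open>The only arrow that makes \<open>e\<close> natural; so \<open>e\<close> becomes
    the isomorphism from \<open>F\<close> after \<open>G\<close> to the identity.\<close>
  define conj where "conj P Q h = Cmp D (?FG P) Q (?FG Q) (d Q) (Cmp D (?FG P) P Q h (e P))" for P Q h
  have conj_arr: "conj P Q h \<in> Arr D (?FG P) (?FG Q)" if "P \<in> Ob D" "Q \<in> Ob D" "h \<in> Arr D P Q" for P Q h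
    unfolding conj_def using that by (intro Dc FG d eA)
  have conj_id: "conj P P (Ident D P) = Ident D (?FG P)" if "P \<in> Ob D" for P
    unfolding conj_def using that by (simp add: Di(3) FG eA d)
  have e_conj: "Cmp D (?FG P) (?FG Q) Q (e Q) (conj P Q h) = Cmp D (?FG P) P Q h (e P)"
    if PQ: "P \<in> Ob D" "Q \<in> Ob D" "h \<in> Arr D P Q" for P Q h
  proof -
    have "Cmp D (?FG P) P Q h (e P) \<in> Arr D (?FG P) Q"
      using PQ by (intro Dc FG eA)
    then have "Cmp D (?FG P) (?FG Q) Q (e Q) (conj P Q h) =
        Cmp D (?FG P) Q Q (Cmp D Q (?FG Q) Q (e Q) (d Q)) (Cmp D (?FG P) P Q h (e P))"
      unfolding conj_def using PQ by (intro Da FG d eA)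
    also have "\<dots> = Cmp D (?FG P) P Q h (e P)"
      unfolding d(3)[OF PQ(2)] using PQ by (intro Di(3) FG Dc eA)
    finally show ?thesis .
  qed
  have conj_cmp: "conj P R (Cmp D P Q R k h) = Cmp D (?FG P) (?FG Q) (?FG R) (conj Q R k) (conj P Q h)"
    if P: "P \<in> Ob D" "Q \<in> Ob D" "R \<in> Ob D" and h: "h \<in> Arr D P Q" and k: "k \<in> Arr D Q R" for P Q R h k
  proof -
    have "Cmp D (?FG P) (?FG Q) (?FG R) (conj Q R k) (conj P Q h) =
        Cmp D (?FG P) R (?FG R) (d R) (Cmp D (?FG P) (?FG Q) R (Cmp D (?FG Q) Q R k (e Q)) (conj P Q h))"
      unfolding conj_def[of Q R k] using P h k by (intro Da[symmetric] FG d Dc eA conj_arr)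
    also have "Cmp D (?FG P) (?FG Q) R (Cmp D (?FG Q) Q R k (e Q)) (conj P Q h) =
        Cmp D (?FG P) Q R k (Cmp D (?FG P) (?FG Q) Q (e Q) (conj P Q h))"
      using P h k by (intro Da[symmetric] FG d Dc eA conj_arr)
    also have "\<dots> = Cmp D (?FG P) Q R k (Cmp D (?FG P) P Q h (e P))"
      using e_conj P h by simp
    also have "\<dots> = Cmp D (?FG P) P R (Cmp D P Q R k h) (e P)"
      using P h k by (intro Da FG eA)
    finally show ?thesis
      by (simp add: conj_def)
  qed
  define lft where "lft A B = inv_into (Arr C A B) (on_arr F A B)" for A B
  have lft: "lft A B h \<in> Arr C A B" "on_arr F A B (lft A B h) = h"
    if "A \<in> Ob C" "B \<in> Ob C" "h \<in> Arr D (on_ob F A) (on_ob F B)" for A B h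
    using ff[OF that(1,2)] that(3) unfolding lft_def bij_betw_def
    by (metis inv_into_into, metis f_inv_into_f)
  have faithful: "f = g" if "A \<in> Ob C" "B \<in> Ob C" "f \<in> Arr C A B" "g \<in> Arr C A B" "on_arr F A B f = on_arr F A B g" for A B f g
    using ff[OF that(1,2)] that(3-) by (auto simp: bij_betw_def inj_on_def)
  define G where "G = \<lparr>on_ob = G0, on_arr = (\<lambda>P Q h. lft (G0 P) (G0 Q) (conj P Q h))\<rparr>"
  have G_arr: "lft (G0 P) (G0 Q) (conj P Q h) \<in> Arr C (G0 P) (G0 Q)"
    "on_arr F (G0 P) (G0 Q) (lft (G0 P) (G0 Q) (conj P Q h)) = conj P Q h"
    if "P \<in> Ob D" "Q \<in> Ob D" "h \<in> Arr D P Q" for P Q h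
    using that lft G0 conj_arr by auto
  have "is_functor D C G"
    unfolding is_functor_def
  proof (intro conjI ballI C D)
    fix P assume P: "P \<in> Ob D"
    show "on_ob G P \<in> Ob C"
      using G0 P by (simp add: G_def)
    show "on_arr G P P (Ident D P) = Ident C (on_ob G P)"
      using G0(1)[OF P] G_arr[OF P P Di(1)[OF P], unfolded conj_id[OF P]] F_id category_ident(1)[OF C]
      by (auto simp: G_def conj_id[OF P] intro!: faithful[of "G0 P" "G0 P"])
    fix Q assume Q: "Q \<in> Ob D"
    show "on_arr G P Q h \<in> Arr C (on_ob G P) (on_ob G Q)" if "h \<in> Arr D P Q" for h
      using G_arr P Q that by (simp add: G_def)
    fix R h k assume R: "R \<in> Ob D" and h: "h \<in> Arr D P Q" and k: "k \<in> Arr D Q R"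
    have kh: "Cmp D P Q R k h \<in> Arr D P R"
      using P Q R h k by (rule Dc)
    have "lft (G0 P) (G0 R) (conj P R (Cmp D P Q R k h)) =
      Cmp C (G0 P) (G0 Q) (G0 R) (lft (G0 Q) (G0 R) (conj Q R k)) (lft (G0 P) (G0 Q) (conj P Q h))"
      using P Q R h k G0(1) G_arr G_arr[OF P R kh] conj_cmp[OF P Q R h k]
      by (intro faithful[of "G0 P" "G0 R"]) (simp_all add: category_arrow_closed[OF C] F_cmp)
    then show "on_arr G P R (Cmp D P Q R k h) =
      Cmp C (on_ob G P) (on_ob G Q) (on_ob G R) (on_arr G Q R k) (on_arr G P Q h)"
      by (simp add: G_def)
  qed
  moreover have "naturally_isomorphic D D (comp_fctr F G) id_fctr"
    unfolding naturally_isomorphic_def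
  proof (intro exI[of _ e] conjI ballI)
    fix P assume P: "P \<in> Ob D"
    show "iso_arr D (on_ob (comp_fctr F G) P) (on_ob id_fctr P) (e P)"
      using e[OF P] by (simp add: comp_fctr_def id_fctr_def G_def)
    fix Q h assume "Q \<in> Ob D" "h \<in> Arr D P Q"
    then show "Cmp D (on_ob (comp_fctr F G) P) (on_ob (comp_fctr F G) Q) (on_ob id_fctr Q) (e Q) (on_arr (comp_fctr F G) P Q h) =
        Cmp D (on_ob (comp_fctr F G) P) (on_ob id_fctr P) (on_ob id_fctr Q) (on_arr id_fctr P Q h) (e P)"
      using P G_arr e_conj by (simp add: comp_fctr_def id_fctr_def G_def)
  qed
  \<comment> \<open>The components are the lifts of \<open>e\<close> at the objects
    \<open>F A\<close>. Their inverses are the lifts of \<open>d\<close>, and naturality is that of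
    \<open>e\<close>, reflected by faithfulness.\<close>
  moreover have "naturally_isomorphic C C (comp_fctr G F) id_fctr"
    unfolding naturally_isomorphic_def
  proof (intro exI[of _ "\<lambda>A. lft (G0 (on_ob F A)) A (e (on_ob F A))"] conjI ballI)
    fix A assume A: "A \<in> Ob C"
    let ?A = "G0 (on_ob F A)"
    have FA: "on_ob F A \<in> Ob D" "?A \<in> Ob C"
      using A F_ob G0 by auto
    note \<eta> = lft[OF FA(2) A eA[OF FA(1)]] and \<theta> = lft[OF A FA(2) d(1)[OF FA(1)]]
    have "Cmp C ?A A ?A (lft A ?A (d (on_ob F A))) (lft ?A A (e (on_ob F A))) = Ident C ?A"
      using A FA \<eta> \<theta> d(2)[OF FA(1)] category_ident(1)[OF C]
      by (intro faithful[of ?A ?A]) (simp_all add: category_arrow_closed[OF C] F_cmp F_id)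
    moreover have "Cmp C A ?A A (lft ?A A (e (on_ob F A))) (lft A ?A (d (on_ob F A))) = Ident C A"
      using A FA \<eta> \<theta> d(3)[OF FA(1)] category_ident(1)[OF C]
      by (intro faithful[of A A]) (simp_all add: category_arrow_closed[OF C] F_cmp F_id)
    ultimately show "iso_arr C (on_ob (comp_fctr G F) A) (on_ob id_fctr A) (lft ?A A (e (on_ob F A)))"
      using \<eta> \<theta> by (auto simp: iso_arr_def comp_fctr_def id_fctr_def G_def)
    fix B f assume B: "B \<in> Ob C" and f: "f \<in> Arr C A B"
    let ?B = "G0 (on_ob F B)"
    have FB: "on_ob F B \<in> Ob D" "?B \<in> Ob C"
      using B F_ob G0 by auto
    note \<eta>B = lft[OF FB(2) B eA[OF FB(1)]]
    note Ff = F_arr[OF A B f]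
    have "Cmp C ?A ?B B (lft ?B B (e (on_ob F B))) (lft ?A ?B (conj (on_ob F A) (on_ob F B) (on_arr F A B f))) =
       Cmp C ?A A B f (lft ?A A (e (on_ob F A)))"
      using A B f FA FB \<eta> \<eta>B G_arr[OF FA(1) FB(1) Ff] e_conj[OF FA(1) FB(1) Ff]
      by (intro faithful[of ?A B]) (simp_all add: category_arrow_closed[OF C] F_cmp)
    then show "Cmp C (on_ob (comp_fctr G F) A) (on_ob (comp_fctr G F) B) (on_ob id_fctr B)
        (lft ?B B (e (on_ob F B))) (on_arr (comp_fctr G F) A B f) =
      Cmp C (on_ob (comp_fctr G F) A) (on_ob id_fctr A) (on_ob id_fctr B) (on_arr id_fctr A B f)
        (lft ?A A (e (on_ob F A)))"
      by (simp add: comp_fctr_def id_fctr_def G_def)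
  qed
  ultimately show ?thesis
    using F unfolding is_equivalence_def by blast
qed

section \<open>The cover associated with an action\<close>

text \<open>\<open>T\<close> is an action of the path groupoid of \<open>X\<close> whose fibres are all equal to \<open>S\<close>. The total space of
  the cover is the set \<open>topspace X \<times> S\<close>, embedded by \<open>k\<close> into the universe.\<close>

locale path_transport =
  fixes X :: "'a topology" and S :: "'s set" and T :: "(real \<Rightarrow> 'a) \<Rightarrow> 's \<Rightarrow> 's" and k :: "'a \<times> 's \<Rightarrow> 'u"
  assumes lpc: "locally_path_connected_space X" and slsc: "semilocally_simply_connected X"
    and k: "inj_on k (topspace X \<times> S)"
    and T_closed: "pathin X \<beta> \<Longrightarrow> s \<in> S \<Longrightarrow> T \<beta> s \<in> S"
    and T_homotopic: "path_homotopic X \<beta> \<beta>' \<Longrightarrow> s \<in> S \<Longrightarrow> T \<beta> s = T \<beta>' s"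
    and T_const: "y \<in> topspace X \<Longrightarrow> s \<in> S \<Longrightarrow> T (\<lambda>t. y) s = s"
    and T_join: "pathin X \<beta> \<Longrightarrow> pathin X \<beta>' \<Longrightarrow> \<beta> 1 = \<beta>' 0 \<Longrightarrow> s \<in> S \<Longrightarrow> T (path_join \<beta> \<beta>') s = T \<beta>' (T \<beta> s)"
begin

lemma T_rev:
  assumes "pathin X \<beta>" "s \<in> S"
  shows "T (path_rev \<beta>) (T \<beta> s) = s" "T \<beta> (T (path_rev \<beta>) s) = s"
proof -
  have "\<beta> 0 \<in> topspace X" "\<beta> 1 \<in> topspace X"
    using assms(1) path_start_in_topspace path_finish_in_topspace by auto
  then show "T (path_rev \<beta>) (T \<beta> s) = s" "T \<beta> (T (path_rev \<beta>) s) = s"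
    using T_homotopic[OF path_homotopic_join_rev(1)[OF assms(1)] assms(2)]
      T_homotopic[OF path_homotopic_join_rev(2)[OF assms(1)] assms(2)] assms
    by (simp_all add: T_join T_const pathin_rev)
qed

lemma k_eq_iff: "z \<in> topspace X \<Longrightarrow> t \<in> S \<Longrightarrow> z' \<in> topspace X \<Longrightarrow> t' \<in> S \<Longrightarrow> k (z, t) = k (z', t') \<longleftrightarrow> z = z' \<and> t = t'"
  using k by (auto simp: inj_on_def)

section \<open>The topology of the total space\<close>

definition proj :: "'u \<Rightarrow> 'a" where
  "proj u = fst (inv_into (topspace X \<times> S) k u)"

lemma proj_k [simp]: "z \<in> topspace X \<Longrightarrow> t \<in> S \<Longrightarrow> proj (k (z, t)) = z"
  unfolding proj_def by (subst inv_into_f_f[OF k]) auto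

text \<open>Stated pointwise and not through a basis of sheets, so that intersections and unions are
  immediate; openness of the sheets is then proved.\<close>

definition open_total :: "'u set \<Rightarrow> bool" where
  "open_total W \<longleftrightarrow> W \<subseteq> k ` (topspace X \<times> S) \<and>
     (\<forall>y\<in>topspace X. \<forall>s\<in>S. k (y, s) \<in> W \<longrightarrow>
        (\<exists>U. openin X U \<and> y \<in> U \<and> (\<forall>\<beta>. pathin (subtopology X U) \<beta> \<longrightarrow> \<beta> 0 = y \<longrightarrow> k (\<beta> 1, T \<beta> s) \<in> W)))"

definition total_space :: "'u topology" where
  "total_space = topology open_total"

lemma pathin_subtopologyD: "pathin (subtopology X U) \<beta> \<Longrightarrow> pathin X \<beta>"
  by (simp add: pathin_subtopology)

lemma openin_total_space: "openin total_space W \<longleftrightarrow> open_total W"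
proof -
  have "istopology open_total"
    unfolding istopology_def
  proof (intro conjI allI impI)
    fix V W assume VW: "open_total V" "open_total W"
    show "open_total (V \<inter> W)"
      unfolding open_total_def
    proof (intro conjI ballI impI)
      show "V \<inter> W \<subseteq> k ` (topspace X \<times> S)"
        using VW by (auto simp: open_total_def)
      fix y s assume ys: "y \<in> topspace X" "s \<in> S" "k (y, s) \<in> V \<inter> W"
      then obtain U U' where "openin X U" "y \<in> U" "\<forall>\<beta>. pathin (subtopology X U) \<beta> \<longrightarrow> \<beta> 0 = y \<longrightarrow> k (\<beta> 1, T \<beta> s) \<in> V"
        "openin X U'" "y \<in> U'" "\<forall>\<beta>. pathin (subtopology X U') \<beta> \<longrightarrow> \<beta> 0 = y \<longrightarrow> k (\<beta> 1, T \<beta> s) \<in> W"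
        using VW unfolding open_total_def by blast
      then show "\<exists>U. openin X U \<and> y \<in> U \<and> (\<forall>\<beta>. pathin (subtopology X U) \<beta> \<longrightarrow> \<beta> 0 = y \<longrightarrow> k (\<beta> 1, T \<beta> s) \<in> V \<inter> W)"
        by (intro exI[of _ "U \<inter> U'"]) (auto simp: pathin_subtopology)
    qed
  next
    fix K assume K: "\<forall>V\<in>K. open_total V"
    show "open_total (\<Union>K)"
      unfolding open_total_def
    proof (intro conjI ballI impI)
      show "\<Union>K \<subseteq> k ` (topspace X \<times> S)"
        using K by (auto simp: open_total_def)
      fix y s assume "y \<in> topspace X" "s \<in> S" "k (y, s) \<in> \<Union>K"
      then obtain V where V: "V \<in> K" "k (y, s) \<in> V" "y \<in> topspace X" "s \<in> S"
        by blast
      then have "open_total V"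
        using K by blast
      then show "\<exists>U. openin X U \<and> y \<in> U \<and> (\<forall>\<beta>. pathin (subtopology X U) \<beta> \<longrightarrow> \<beta> 0 = y \<longrightarrow> k (\<beta> 1, T \<beta> s) \<in> \<Union>K)"
        using V unfolding open_total_def by (meson UnionI)
    qed
  qed
  then show ?thesis
    by (simp add: total_space_def)
qed

lemma topspace_total_space: "topspace total_space = k ` (topspace X \<times> S)"
proof -
  have "open_total (k ` (topspace X \<times> S))"
    unfolding open_total_def
  proof (intro conjI subset_refl ballI impI)
    fix y s assume "y \<in> topspace X" "s \<in> S"
    then show "\<exists>U. openin X U \<and> y \<in> U \<and>
        (\<forall>\<beta>. pathin (subtopology X U) \<beta> \<longrightarrow> \<beta> 0 = y \<longrightarrow> k (\<beta> 1, T \<beta> s) \<in> k ` (topspace X \<times> S))"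
      using T_closed path_finish_in_topspace[of X]
      by (intro exI[of _ "topspace X"] conjI allI impI imageI SigmaI) auto
  qed
  then have "k ` (topspace X \<times> S) \<subseteq> topspace total_space"
    by (intro openin_subset) (simp add: openin_total_space)
  moreover have "topspace total_space \<subseteq> k ` (topspace X \<times> S)"
    using openin_topspace[of total_space] unfolding openin_total_space open_total_def by blast
  ultimately show ?thesis by blast
qed

lemma continuous_map_proj: "continuous_map total_space X proj"
  unfolding continuous_map
proof (intro conjI allI impI)
  show "proj ` topspace total_space \<subseteq> topspace X"
    by (auto simp: topspace_total_space)
  fix V assume V: "openin X V"
  have "k (\<beta> 1, T \<beta> s) \<in> k ` (topspace X \<times> S)" "proj (k (\<beta> 1, T \<beta> s)) \<in> V"
    if "pathin (subtopology X V) \<beta>" "s \<in> S" for \<beta> s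
    using that T_closed path_finish_in_topspace[of X \<beta>] by (auto simp: pathin_subtopology)
  then show "openin total_space {u \<in> topspace total_space. proj u \<in> V}"
    unfolding openin_total_space open_total_def topspace_total_space
    using V by (intro conjI ballI impI exI[of _ V]) auto
qed

text \<open>The ends of all lifts from \<open>k (y, s)\<close> of paths inside \<open>U\<close>. For
  general \<open>U\<close> several of these points can lie over the same point of
  \<open>U\<close>.\<close>

definition sheet :: "'a set \<Rightarrow> 'a \<Rightarrow> 's \<Rightarrow> 'u set" where
  "sheet U y s = {k (\<beta> 1, T \<beta> s) | \<beta>. pathin (subtopology X U) \<beta> \<and> \<beta> 0 = y}"

lemma sheetE:
  assumes "u \<in> sheet U y s" "s \<in> S"
  obtains \<beta> where "pathin (subtopology X U) \<beta>" "pathin X \<beta>" "\<beta> 0 = y" "\<beta> 1 \<in> U" "\<beta> 1 \<in> topspace X"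
    "T \<beta> s \<in> S" "u = k (\<beta> 1, T \<beta> s)"
  using assms T_closed path_finish_in_topspace[of X] unfolding sheet_def by (auto simp: pathin_subtopology)

text \<open>A path in \<open>U\<close> from \<open>y\<close> may be continued by another path in
  \<open>U\<close>, and transport along the concatenation is the composite.\<close>

lemma openin_sheet:
  assumes U: "openin X U" and s: "s \<in> S"
  shows "openin total_space (sheet U y s)"
  unfolding openin_total_space open_total_def
proof (intro conjI ballI impI)
  show "sheet U y s \<subseteq> k ` (topspace X \<times> S)"
  proof
    fix u assume "u \<in> sheet U y s"
    then show "u \<in> k ` (topspace X \<times> S)"
      using s by (elim sheetE) auto
  qed
  fix z t assume zt: "z \<in> topspace X" "t \<in> S" "k (z, t) \<in> sheet U y s"
  obtain \<beta> where \<beta>: "pathin (subtopology X U) \<beta>" "pathin X \<beta>" "\<beta> 0 = y" "\<beta> 1 \<in> U" "\<beta> 1 \<in> topspace X"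
    "T \<beta> s \<in> S" "k (z, t) = k (\<beta> 1, T \<beta> s)"
    using zt(3) s by (rule sheetE)
  then have z: "z = \<beta> 1" "t = T \<beta> s"
    using zt by (simp_all add: k_eq_iff)
  have "k (\<beta>' 1, T \<beta>' t) \<in> sheet U y s" if \<beta>': "pathin (subtopology X U) \<beta>'" "\<beta>' 0 = z" for \<beta>'
    unfolding sheet_def
    using \<beta>(1,3) \<beta>' z s T_join[OF \<beta>(2) pathin_subtopologyD[OF \<beta>'(1)] _ s]
    by (intro CollectI exI[of _ "path_join \<beta> \<beta>'"]) (auto intro: pathin_join)
  then show "\<exists>V. openin X V \<and> z \<in> V \<and> (\<forall>\<beta>. pathin (subtopology X V) \<beta> \<longrightarrow> \<beta> 0 = z \<longrightarrow> k (\<beta> 1, T \<beta> t) \<in> sheet U y s)"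
    using U \<beta>(4) z by blast
qed

lemma fibre_total_space:
  "y \<in> topspace X \<Longrightarrow> fibre (total_space, proj) y = (\<lambda>s. k (y, s)) ` S"
  by (auto simp: fibre_def topspace_total_space)

text \<open>Inside a small path connected set every point is the end of a path from
  \<open>z\<close>, and the lift of that path stays in \<open>W\<close>.\<close>

lemma openin_proj_image:
  assumes W: "openin total_space W"
  shows "openin X (proj ` W)"
proof (subst openin_subopen, intro ballI)
  fix z assume "z \<in> proj ` W"
  moreover have "W \<subseteq> k ` (topspace X \<times> S)"
    using W by (simp add: openin_total_space open_total_def)
  ultimately obtain t where t: "z \<in> topspace X" "t \<in> S" "k (z, t) \<in> W"
    by auto
  then obtain U where U: "openin X U" "z \<in> U" "\<forall>\<beta>. pathin (subtopology X U) \<beta> \<longrightarrow> \<beta> 0 = z \<longrightarrow> k (\<beta> 1, T \<beta> t) \<in> W"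
    using W unfolding openin_total_space open_total_def by blast
  obtain V where V: "openin X V" "path_connectedin X V" "z \<in> V" "V \<subseteq> U"
    using lpc U unfolding locally_path_connected_space by meson
  have "v \<in> proj ` W" if v: "v \<in> V" for v
  proof -
    obtain \<beta> where \<beta>: "pathin X \<beta>" "\<beta> \<in> {0..1} \<rightarrow> V" "\<beta> 0 = z" "\<beta> 1 = v"
      using V(2,3) v unfolding path_connectedin by blast
    then have "k (v, T \<beta> t) \<in> W"
      using U(3)[rule_format, of \<beta>] V(4) by (auto simp: pathin_subtopology Pi_iff)
    moreover have "proj (k (v, T \<beta> t)) = v"
      using \<beta> t T_closed path_finish_in_topspace[OF \<beta>(1)] by auto
    ultimately show ?thesis
      by force
  qed
  then show "\<exists>V. openin X V \<and> z \<in> V \<and> V \<subseteq> proj ` W"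
    using V by blast
qed

text \<open>For a path connected \<open>U\<close> inside a set whose loops at \<open>y\<close>
  contract in \<open>X\<close>, transport from \<open>y\<close> depends only on the end of the path,
  so each sheet is the graph of a function on \<open>U\<close>. Transport is invertible: this makes
  different sheets disjoint, and moving a point back to \<open>y\<close> tells which sheet contains
  it.\<close>

lemma is_cover_total_space: "is_cover X (total_space, proj)"
proof -
  have "\<exists>U. openin X U \<and> y \<in> U \<and>
        (\<exists>V. {z \<in> topspace total_space. proj z \<in> U} = (\<Union>u\<in>fibre (total_space, proj) y. V u) \<and>
             disjoint_family_on V (fibre (total_space, proj) y) \<and>
             (\<forall>u\<in>fibre (total_space, proj) y. u \<in> V u \<and> openin total_space (V u) \<and>
                homeomorphic_map (subtopology total_space (V u)) (subtopology X U) proj))"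
    if y: "y \<in> topspace X" for y
  proof -
    obtain U' where U': "openin X U'" "y \<in> U'" "\<And>\<gamma>. \<gamma> \<in> loops (subtopology X U') y \<Longrightarrow> path_homotopic X \<gamma> (\<lambda>t. y)"
      using slsc y unfolding semilocally_simply_connected_def by metis
    obtain U where U: "openin X U" "path_connectedin X U" "y \<in> U" "U \<subseteq> U'"
      using lpc U'(1,2) unfolding locally_path_connected_space by meson
    have U_sub: "U \<subseteq> topspace X"
      using openin_subset[OF U(1)] .
    have path_to: "\<exists>\<beta>. pathin (subtopology X U) \<beta> \<and> \<beta> 0 = y \<and> \<beta> 1 = z" if z: "z \<in> U" for z
    proof -
      obtain \<beta> where "pathin X \<beta>" "\<beta> \<in> {0..1} \<rightarrow> U" "\<beta> 0 = y" "\<beta> 1 = z"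
        using U(2,3) z unfolding path_connectedin by blast
      then show ?thesis
        by (auto simp: pathin_subtopology Pi_iff)
    qed
    \<comment> \<open>Going along \<open>\<beta>\<close> and back along \<open>\<beta>'\<close> is a
      loop in \<open>U'\<close>, which contracts in \<open>X\<close> and therefore transports
      trivially.\<close>
    have T_eq: "T \<beta> s = T \<beta>' s"
      if \<beta>: "pathin (subtopology X U) \<beta>" "pathin (subtopology X U) \<beta>'" "\<beta> 0 = y" "\<beta>' 0 = y" "\<beta> 1 = \<beta>' 1" and s: "s \<in> S"
      for \<beta> \<beta>' s
    proof -
      have "pathin (subtopology X U) (path_join \<beta> (path_rev \<beta>'))"
        using \<beta> by (intro pathin_join pathin_rev) auto
      then have "path_join \<beta> (path_rev \<beta>') \<in> loops (subtopology X U') y"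
        using \<beta> U(4) by (auto simp: loops_def pathin_subtopology)
      then have "T (path_join \<beta> (path_rev \<beta>')) s = s"
        using T_homotopic[OF U'(3) s] T_const[OF y s] by simp
      then have "T (path_rev \<beta>') (T \<beta> s) = s"
        using T_join[of \<beta> "path_rev \<beta>'" s] \<beta> s by (simp add: pathin_rev pathin_subtopologyD)
      then show ?thesis
        using T_rev(2)[of \<beta>' "T \<beta> s"] T_closed[of \<beta> s] \<beta> s by (simp add: pathin_subtopologyD)
    qed
    \<comment> \<open>The definition of a cover indexes sheets by points of the fibre, so
      \<open>s\<close> has to be recovered from \<open>k (y, s)\<close>.\<close>
    define V where "V u = sheet U y (snd (inv_into (topspace X \<times> S) k u))" for u
    have V: "V (k (y, s)) = sheet U y s" if "s \<in> S" for s
      unfolding V_def using that y by (subst inv_into_f_f[OF k]) auto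
    have mem_sheet: "k (z, t) \<in> sheet U y s \<longleftrightarrow> z \<in> U \<and> (\<exists>\<beta>. pathin (subtopology X U) \<beta> \<and> \<beta> 0 = y \<and> \<beta> 1 = z \<and> t = T \<beta> s)"
      if z: "z \<in> topspace X" "t \<in> S" and s: "s \<in> S" for z t s
    proof
      assume zt: "k (z, t) \<in> sheet U y s"
      obtain \<beta> where \<beta>: "pathin (subtopology X U) \<beta>" "pathin X \<beta>" "\<beta> 0 = y" "\<beta> 1 \<in> U" "\<beta> 1 \<in> topspace X"
        "T \<beta> s \<in> S" "k (z, t) = k (\<beta> 1, T \<beta> s)"
        using zt s by (rule sheetE)
      then have "z = \<beta> 1" "t = T \<beta> s"
        using z by (simp_all add: k_eq_iff)
      then show "z \<in> U \<and> (\<exists>\<beta>. pathin (subtopology X U) \<beta> \<and> \<beta> 0 = y \<and> \<beta> 1 = z \<and> t = T \<beta> s)"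
        using \<beta> by blast
    qed (auto simp: sheet_def)
    have sheet_sub: "sheet U y s \<subseteq> {u \<in> topspace total_space. proj u \<in> U}" if s: "s \<in> S" for s
    proof
      fix u assume "u \<in> sheet U y s"
      then obtain \<beta> where "\<beta> 1 \<in> U" "\<beta> 1 \<in> topspace X" "T \<beta> s \<in> S" "u = k (\<beta> 1, T \<beta> s)"
        using s by (rule sheetE)
      then show "u \<in> {u \<in> topspace total_space. proj u \<in> U}"
        by (auto simp: topspace_total_space)
    qed
    have cover: "{u \<in> topspace total_space. proj u \<in> U} \<subseteq> (\<Union>s\<in>S. sheet U y s)"
    proof
      fix u assume "u \<in> {u \<in> topspace total_space. proj u \<in> U}"
      then obtain z t where z: "z \<in> topspace X" "t \<in> S" "u = k (z, t)" "z \<in> U"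
        by (auto simp: topspace_total_space)
      obtain \<beta> where \<beta>: "pathin (subtopology X U) \<beta>" "\<beta> 0 = y" "\<beta> 1 = z"
        using path_to[OF z(4)] by blast
      note \<beta>X = pathin_subtopologyD[OF \<beta>(1)]
      have "T (path_rev \<beta>) t \<in> S" "T \<beta> (T (path_rev \<beta>) t) = t"
        using T_closed[OF pathin_rev[OF \<beta>X] z(2)] T_rev(2)[OF \<beta>X z(2)] by auto
      then show "u \<in> (\<Union>s\<in>S. sheet U y s)"
        using z \<beta> mem_sheet by (intro UN_I[of "T (path_rev \<beta>) t"]) auto
    qed
    have disj: "sheet U y s \<inter> sheet U y s' = {}" if s: "s \<in> S" "s' \<in> S" "s \<noteq> s'" for s s'
    proof (rule ccontr)
      assume "sheet U y s \<inter> sheet U y s' \<noteq> {}"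
      then obtain u where u: "u \<in> sheet U y s" "u \<in> sheet U y s'" by blast
      obtain \<beta> where \<beta>: "pathin (subtopology X U) \<beta>" "pathin X \<beta>" "\<beta> 0 = y" "\<beta> 1 \<in> topspace X" "T \<beta> s \<in> S" "u = k (\<beta> 1, T \<beta> s)"
        using u(1) s(1) by (rule sheetE)
      obtain \<beta>' where \<beta>': "pathin (subtopology X U) \<beta>'" "\<beta>' 0 = y" "\<beta>' 1 \<in> topspace X" "T \<beta>' s' \<in> S" "u = k (\<beta>' 1, T \<beta>' s')"
        using u(2) s(2) by (rule sheetE)
      have "\<beta> 1 = \<beta>' 1" "T \<beta> s = T \<beta>' s'"
        using \<beta> \<beta>' by (simp_all add: k_eq_iff)
      moreover have "T \<beta>' s' = T \<beta> s'"
        using T_eq[of \<beta>' \<beta> s'] \<beta> \<beta>' s \<open>\<beta> 1 = \<beta>' 1\<close> by simp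
      ultimately have "T (path_rev \<beta>) (T \<beta> s) = T (path_rev \<beta>) (T \<beta> s')"
        by simp
      then show False
        using T_rev(1)[OF \<beta>(2)] s by simp
    qed
    have homeo: "homeomorphic_map (subtopology total_space (sheet U y s)) (subtopology X U) proj" if s: "s \<in> S" for s
    proof (rule bijective_open_imp_homeomorphic_map)
      have top: "topspace (subtopology total_space (sheet U y s)) = sheet U y s"
        using openin_subset[OF openin_sheet[OF U(1) s]] by (simp add: Int_absorb1)
      show "continuous_map (subtopology total_space (sheet U y s)) (subtopology X U) proj"
        using continuous_map_from_subtopology[OF continuous_map_proj] sheet_sub[OF s]
        by (auto simp: continuous_map_in_subtopology)
      show "open_map (subtopology total_space (sheet U y s)) (subtopology X U) proj"
        unfolding open_map_def
      proof (intro allI impI)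
        fix W assume "openin (subtopology total_space (sheet U y s)) W"
        then have "openin total_space W" "W \<subseteq> sheet U y s"
          using openin_sheet[OF U(1) s] openin_open_subtopology by blast+
        then show "openin (subtopology X U) (proj ` W)"
          using openin_proj_image sheet_sub[OF s] U(1) by (auto simp: openin_open_subtopology)
      qed
      show "proj ` topspace (subtopology total_space (sheet U y s)) = topspace (subtopology X U)"
        unfolding top
      proof
        show "proj ` sheet U y s \<subseteq> topspace (subtopology X U)"
          using sheet_sub[OF s] U_sub by auto
        show "topspace (subtopology X U) \<subseteq> proj ` sheet U y s"
        proof
          fix z assume "z \<in> topspace (subtopology X U)"
          then have z: "z \<in> U" "z \<in> topspace X" by auto
          then obtain \<beta> where \<beta>: "pathin (subtopology X U) \<beta>" "\<beta> 0 = y" "\<beta> 1 = z"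
            using path_to by blast
          then have "T \<beta> s \<in> S" "k (z, T \<beta> s) \<in> sheet U y s"
            using T_closed[OF pathin_subtopologyD[OF \<beta>(1)] s] by (auto simp: sheet_def)
          then show "z \<in> proj ` sheet U y s"
            using z(2) by (force simp: image_iff)
        qed
      qed
      show "inj_on proj (topspace (subtopology total_space (sheet U y s)))"
        unfolding top
      proof (rule inj_onI)
        fix u u' assume u: "u \<in> sheet U y s" "u' \<in> sheet U y s" "proj u = proj u'"
        obtain \<beta> where \<beta>: "pathin (subtopology X U) \<beta>" "\<beta> 0 = y" "\<beta> 1 \<in> topspace X" "T \<beta> s \<in> S" "u = k (\<beta> 1, T \<beta> s)"
          using u(1) s by (rule sheetE)
        obtain \<beta>' where \<beta>': "pathin (subtopology X U) \<beta>'" "\<beta>' 0 = y" "\<beta>' 1 \<in> topspace X" "T \<beta>' s \<in> S" "u' = k (\<beta>' 1, T \<beta>' s)"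
          using u(2) s by (rule sheetE)
        have "\<beta> 1 = \<beta>' 1"
          using u(3) \<beta> \<beta>' by simp
        then show "u = u'"
          using T_eq[of \<beta> \<beta>' s] \<beta> \<beta>' s by simp
      qed
    qed
    have const_sheet: "k (y, s) \<in> sheet U y s" if "s \<in> S" for s
      using that y U(3) T_const[OF y that] by (auto simp: mem_sheet pathin_subtopology intro!: exI[of _ "\<lambda>t. y"])
    show ?thesis
      unfolding fibre_total_space[OF y]
    proof (intro exI[of _ U] exI[of _ V] conjI U(1,3) ballI)
      show "{z \<in> topspace total_space. proj z \<in> U} = \<Union> (V ` (\<lambda>s. k (y, s)) ` S)"
        using cover sheet_sub V by auto
      show "disjoint_family_on V ((\<lambda>s. k (y, s)) ` S)"
        unfolding disjoint_family_on_def using disj V by fastforce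
      fix u assume "u \<in> (\<lambda>s. k (y, s)) ` S"
      then obtain s where s: "s \<in> S" "u = k (y, s)" by blast
      then show "u \<in> V u" "openin total_space (V u)" "homeomorphic_map (subtopology total_space (V u)) (subtopology X U) proj"
        using V const_sheet openin_sheet[OF U(1)] homeo by auto
    qed
  qed
  then show ?thesis
    using continuous_map_proj by (simp add: is_cover_def)
qed

section \<open>Lifts of paths to the total space\<close>

lemma segment_in_unit_interval:
  assumes "a \<in> {0..1}" "b \<in> {0..1}" "r \<in> {0..1}"
  shows "a + r * (b - a) \<in> {0..1::real}"
proof -
  have "(1 - r) * a + r * b \<le> 1" "(1 - r) * a + r * b \<ge> 0"
    using assms convex_bound_le[of a 1 b "1 - r" r] by auto
  then show ?thesis
    by (simp add: algebra_simps)
qed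

text \<open>Both sides transport along reparametrisations of \<open>\<beta>\<close> that end at
  \<open>b\<close>; \<open>u\<close> first visits \<open>a\<close>. The segment from
  \<open>a\<close> to \<open>b\<close> may run backwards, as is needed for points on either side of
  a given time. Writing \<open>u\<close> with \<open>min\<close> and \<open>max\<close> makes it
  evidently continuous.\<close>

lemma T_subpath_join:
  assumes \<beta>: "pathin X \<beta>" and ab: "a \<in> {0..1}" "b \<in> {0..1}" and s: "s \<in> S"
  shows "T (\<lambda>r. \<beta> (a + r * (b - a))) (T (\<lambda>r. \<beta> (r * a)) s) = T (\<lambda>r. \<beta> (r * b)) s"
proof -
  have seg: "a + r * (b - a) \<in> {0..1}" if "r \<in> {0..1}" for r
    using ab that by (rule segment_in_unit_interval)
  have seg0: "r * c \<in> {0..1}" if "r \<in> {0..1}" "c \<in> {0..1}" for r c :: real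
    using that by (auto simp: mult_le_one)
  have p1: "pathin X (\<lambda>r. \<beta> (r * c))" if "c \<in> {0..1}" for c
    using seg0 that by (intro pathin_reparametrize[OF \<beta>]) (auto intro!: continuous_intros)
  have p2: "pathin X (\<lambda>r. \<beta> (a + r * (b - a)))"
    using seg by (intro pathin_reparametrize[OF \<beta>]) (auto intro!: continuous_intros)
  define u where "u r = min (2 * r) 1 * a + max (2 * r - 1) 0 * (b - a)" for r :: real
  have u1: "u r = 2 * r * a" if "r \<le> 1/2" for r
    using that by (simp add: u_def min_def max_def)
  have u2: "u r = a + (2 * r - 1) * (b - a)" if "1/2 < r" for r
    using that by (simp add: u_def min_def max_def)
  have "path_homotopic X (path_join (\<lambda>r. \<beta> (r * a)) (\<lambda>r. \<beta> (a + r * (b - a)))) (\<lambda>r. \<beta> (r * b))"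
  proof (rule path_homotopic_reparametrize[OF \<beta>, where u = u and v = "\<lambda>r. r * b"])
    show "continuous_on {0..1} u"
      unfolding u_def by (intro continuous_intros)
    show "u \<in> {0..1} \<rightarrow> {0..1}"
    proof
      fix r :: real assume r: "r \<in> {0..1}"
      show "u r \<in> {0..1}"
      proof (cases "r \<le> 1/2")
        case True
        then show ?thesis
          using seg0[of "2 * r" a] ab r by (simp add: u1)
      next
        case False
        then show ?thesis
          using seg[of "2 * r - 1"] r by (simp add: u2)
      qed
    qed
    show "(\<lambda>r. r * b) \<in> {0..1} \<rightarrow> {0..1}"
      using seg0 ab by auto
    show "path_join (\<lambda>r. \<beta> (r * a)) (\<lambda>r. \<beta> (a + r * (b - a))) r = \<beta> (u r)" for r
      by (cases "r \<le> 1/2") (simp_all add: path_join_def u1 u2)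
    show "u 0 = 0 * b" "u 1 = 1 * b"
      by (simp_all add: u1 u2)
  qed (auto intro!: continuous_intros)
  from T_homotopic[OF this s] show ?thesis
    using T_join[OF p1[OF ab(1)] p2 _ s] by simp
qed

text \<open>The lift at time \<open>t\<close> is the transport of \<open>s\<close> along the initial
  segment of \<open>\<beta>\<close> up to \<open>t\<close>. It is continuous at \<open>t0\<close>
  because the segment from \<open>t0\<close> to a nearby \<open>t\<close> stays in \<open>U\<close>,
  and open sets contain the ends of such short lifts.\<close>

lemma lifts_from_to_total_space:
  assumes \<beta>: "pathin X \<beta>" and s: "s \<in> S"
  shows "lifts_from_to (total_space, proj) \<beta> (k (\<beta> 0, s)) (k (\<beta> 1, T \<beta> s))"
proof -
  define g where "g t = k (\<beta> t, T (\<lambda>r. \<beta> (r * t)) s)" for t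
  have \<beta>_in: "\<beta> t \<in> topspace X" if "t \<in> {0..1}" for t
    using path_image_subset_topspace[OF \<beta>] that by auto
  have Ts: "T (\<lambda>r. \<beta> (r * t)) s \<in> S" if t: "t \<in> {0..1}" for t
    using t by (intro T_closed pathin_reparametrize[OF \<beta>] s) (auto intro!: continuous_intros simp: mult_le_one)
  have "openin unit_interval {t \<in> topspace unit_interval. g t \<in> W}" if W: "openin total_space W" for W
    unfolding openin_euclidean_subtopology_iff
  proof (intro conjI ballI)
    fix t0 assume "t0 \<in> {t \<in> topspace unit_interval. g t \<in> W}"
    then have t0: "t0 \<in> {0..1}" "g t0 \<in> W" by auto
    obtain U where U: "openin X U" "\<beta> t0 \<in> U"
      "\<And>\<beta>'. pathin (subtopology X U) \<beta>' \<Longrightarrow> \<beta>' 0 = \<beta> t0 \<Longrightarrow> k (\<beta>' 1, T \<beta>' (T (\<lambda>r. \<beta> (r * t0)) s)) \<in> W"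
      using W t0(2) \<beta>_in[OF t0(1)] Ts[OF t0(1)] unfolding g_def openin_total_space open_total_def by metis
    obtain d where d: "d > 0" "\<And>t. t \<in> {0..1} \<Longrightarrow> \<bar>t - t0\<bar> < d \<Longrightarrow> \<beta> t \<in> U"
      using open_preimage_interval[OF \<beta>[unfolded pathin_def] U(1) t0(1) U(2)] by blast
    have "g t \<in> W" if t: "t \<in> {0..1}" "\<bar>t - t0\<bar> < d" for t
    proof -
      have seg: "t0 + r * (t - t0) \<in> {0..1}" "\<bar>t0 + r * (t - t0) - t0\<bar> < d" if r: "r \<in> {0..1}" for r
      proof -
        show "t0 + r * (t - t0) \<in> {0..1}"
          using t0(1) t(1) r by (rule segment_in_unit_interval)
        have "\<bar>r * (t - t0)\<bar> \<le> 1 * \<bar>t - t0\<bar>"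
          unfolding abs_mult using r by (intro mult_right_mono) auto
        then show "\<bar>t0 + r * (t - t0) - t0\<bar> < d"
          using t(2) by simp
      qed
      have "pathin (subtopology X U) (\<lambda>r. \<beta> (t0 + r * (t - t0)))"
        unfolding pathin_subtopology
        using seg d(2) by (intro conjI pathin_reparametrize[OF \<beta>]) (auto intro!: continuous_intros)
      from U(3)[OF this] show ?thesis
        using T_subpath_join[OF \<beta> t0(1) t(1) s] by (simp add: g_def)
    qed
    then show "\<exists>e>0. \<forall>t\<in>{0..1}. dist t t0 < e \<longrightarrow> t \<in> {t \<in> topspace unit_interval. g t \<in> W}"
      using d(1) by (auto simp: dist_real_def)
  qed auto
  then have "pathin total_space g"
    unfolding pathin_def continuous_map using \<beta>_in Ts by (auto simp: topspace_total_space g_def)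
  moreover have "g 0 = k (\<beta> 0, s)" "g 1 = k (\<beta> 1, T \<beta> s)"
    using T_const[OF \<beta>_in s, of 0] by (simp_all add: g_def)
  moreover have "\<forall>t\<in>{0..1}. proj (g t) = \<beta> t"
    using \<beta>_in Ts by (simp add: g_def)
  ultimately show ?thesis
    unfolding lifts_from_to_def prod.case by blast
qed

end

text \<open>The return along \<open>a'\<close> cancels against the following \<open>a'\<close>. This
  makes closing paths to loops compatible with concatenation.\<close>

lemma path_homotopic_conj_join:
  assumes a: "pathin X a" "pathin X a'" "pathin X a''" and b: "pathin X b" "pathin X b'"
    and ends: "a 1 = b 0" "b 1 = a' 1" "a' 1 = b' 0" "b' 1 = a'' 1"
  shows "path_homotopic X (path_join (path_join (path_join a b) (path_rev a')) (path_join (path_join a' b') (path_rev a'')))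
    (path_join (path_join a (path_join b b')) (path_rev a''))"
proof -
  let ?r' = "path_rev a'" and ?r'' = "path_rev a''"
  note p = a b pathin_rev[OF a(2)] pathin_rev[OF a(3)]
  have 1: "path_homotopic X (path_join ?r' (path_join (path_join a' b') ?r'')) (path_join b' ?r'')"
  proof -
    have "path_homotopic X (path_join ?r' (path_join (path_join a' b') ?r''))
        (path_join ?r' (path_join a' (path_join b' ?r'')))"
      using p ends
      by (intro path_homotopic_join[OF path_homotopic_refl path_homotopic_join_assoc]) auto
    also have "path_homotopic X \<dots> (path_join (path_join ?r' a') (path_join b' ?r''))"
      using p ends by (intro path_homotopic_sym[OF path_homotopic_join_assoc] pathin_join) auto
    also have "path_homotopic X \<dots> (path_join (\<lambda>t. a' 1) (path_join b' ?r''))"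
      using p ends
      by (intro path_homotopic_join[OF path_homotopic_join_rev(2) path_homotopic_refl] pathin_join) auto
    also have "path_homotopic X \<dots> (path_join b' ?r'')"
      using p ends path_homotopic_join_const(2)[OF pathin_join[of X b' ?r'']] by simp
    finally show ?thesis .
  qed
  have "path_homotopic X (path_join (path_join (path_join a b) ?r') (path_join (path_join a' b') ?r''))
      (path_join (path_join a b) (path_join ?r' (path_join (path_join a' b') ?r'')))"
    using p ends by (intro path_homotopic_join_assoc pathin_join) auto
  also have "path_homotopic X \<dots> (path_join (path_join a b) (path_join b' ?r''))"
    using p ends by (intro path_homotopic_join[OF path_homotopic_refl 1] pathin_join) auto
  also have "path_homotopic X \<dots> (path_join (path_join (path_join a b) b') ?r'')"
    using p ends by (intro path_homotopic_sym[OF path_homotopic_join_assoc] pathin_join) auto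
  also have "path_homotopic X \<dots> (path_join (path_join a (path_join b b')) ?r'')"
    using p ends by (intro path_homotopic_join[OF path_homotopic_join_assoc path_homotopic_refl]) auto
  finally show ?thesis .
qed

theorem cover_of_action:
  fixes X :: "'a topology" and \<iota> :: "'a \<times> nat \<Rightarrow> 'u" and S :: "'s set"
  assumes X: "path_connected_space X" "locally_path_connected_space X" "semilocally_simply_connected X"
    and x: "x \<in> topspace X" and \<iota>: "inj_on \<iota> (topspace X \<times> UNIV)"
    and act: "group_action (fundamental_group X x) S \<mu>" and S: "finite S"
  obtains Y :: "'u topology" and p f where "is_finite_cover X (Y, p)" "bij_betw f (fibre (Y, p) x) S"
    "\<And>a u. a \<in> carrier (fundamental_group X x) \<Longrightarrow> u \<in> fibre (Y, p) x \<Longrightarrow> f (monodromy (Y, p) x a u) = \<mu> a (f u)"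
proof -
  let ?G = "fundamental_group X x"
  \<comment> \<open>Numbering the finite set lets the one embedding \<open>\<iota>\<close> serve
    every action.\<close>
  obtain e :: "'s \<Rightarrow> nat" where e: "inj_on e S"
    using finite_imp_inj_to_nat_seg[OF S] by blast
  define k where "k = (\<lambda>(y, s). \<iota> (y, e s))"
  have k: "inj_on k (topspace X \<times> S)"
    using \<iota> e by (auto simp: inj_on_def k_def)
  have "\<forall>y\<in>topspace X. \<exists>\<alpha>. pathin X \<alpha> \<and> \<alpha> 0 = x \<and> \<alpha> 1 = y"
    using X(1) x by (simp add: path_connected_space_def)
  then obtain \<alpha>' where \<alpha>': "\<And>y. y \<in> topspace X \<Longrightarrow> pathin X (\<alpha>' y) \<and> \<alpha>' y 0 = x \<and> \<alpha>' y 1 = y"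
    by metis
  \<comment> \<open>With the constant path chosen at \<open>x\<close>, closing a loop at
    \<open>x\<close> does not change its class, so the monodromy over \<open>x\<close> is
    \<open>\<mu>\<close> itself and not a conjugate of it.\<close>
  define \<alpha> where "\<alpha> = \<alpha>'(x := \<lambda>t. x)"
  have \<alpha>: "pathin X (\<alpha> y)" "\<alpha> y 0 = x" "\<alpha> y 1 = y" if "y \<in> topspace X" for y
    using \<alpha>'[OF that] x by (auto simp: \<alpha>_def)
  \<comment> \<open>Every path is closed to a loop at \<open>x\<close> by the chosen paths to its
    two ends; the class of that loop acts through \<open>\<mu>\<close>.\<close>
  define L where "L \<beta> = path_join (path_join (\<alpha> (\<beta> 0)) \<beta>) (path_rev (\<alpha> (\<beta> 1)))" for \<beta>
  define T where "T \<beta> s = \<mu> (loop_class X x (L \<beta>)) s" for \<beta> s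
  have ends: "\<beta> 0 \<in> topspace X" "\<beta> 1 \<in> topspace X" if "pathin X \<beta>" for \<beta>
    using that path_start_in_topspace path_finish_in_topspace by auto
  have L: "L \<beta> \<in> loops X x" if \<beta>: "pathin X \<beta>" for \<beta>
    using \<alpha>[OF ends(1)[OF \<beta>]] \<alpha>[OF ends(2)[OF \<beta>]] \<beta>
    by (simp add: loops_def L_def pathin_join pathin_rev)
  have const: "(\<lambda>t. x) \<in> loops X x"
    using x by (simp add: loops_def)
  have T_eqI: "T \<beta> s = \<mu> (loop_class X x \<gamma>) s" if "pathin X \<beta>" "path_homotopic X (L \<beta>) \<gamma>" for \<beta> \<gamma> s
    using loop_class_eq[OF that(2) L[OF that(1)]] by (simp add: T_def)
  interpret path_transport X S T k
  proof
    show "T \<beta> s \<in> S" if "pathin X \<beta>" "s \<in> S" for \<beta> s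
      unfolding T_def by (intro group_action_closed[OF act] loop_class_in_carrier L that)
    show "T \<beta> s = T \<beta>' s" if \<beta>: "path_homotopic X \<beta> \<beta>'" for \<beta> \<beta>' s
    proof -
      note b = path_homotopic_imp[OF \<beta>]
      have "path_homotopic X (L \<beta>) (L \<beta>')"
        unfolding L_def b(3,4) using \<alpha> ends[OF b(1)] b
        by (intro path_homotopic_join path_homotopic_refl pathin_rev \<beta>) auto
      then show ?thesis
        using T_eqI[OF b(1)] by (simp add: T_def)
    qed
    show "T (\<lambda>t. y) s = s" if y: "y \<in> topspace X" and s: "s \<in> S" for y s
    proof -
      have "path_homotopic X (L (\<lambda>t. y)) (path_join (\<alpha> y) (path_rev (\<alpha> y)))"
        unfolding L_def using \<alpha>[OF y] path_homotopic_join_const(1)[OF \<alpha>(1)[OF y]]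
        by (intro path_homotopic_join path_homotopic_refl pathin_rev) auto
      also have "path_homotopic X \<dots> (\<lambda>t. x)"
        using path_homotopic_join_rev(1)[OF \<alpha>(1)[OF y]] \<alpha>(2)[OF y] by simp
      finally have "T (\<lambda>t. y) s = \<mu> \<one>\<^bsub>?G\<^esub> s"
        using T_eqI y by (simp add: one_fundamental_group)
      then show ?thesis
        using group_action_one[OF act s] by simp
    qed
    show "T (path_join \<beta> \<beta>') s = T \<beta>' (T \<beta> s)"
      if \<beta>: "pathin X \<beta>" "pathin X \<beta>'" "\<beta> 1 = \<beta>' 0" and s: "s \<in> S" for \<beta> \<beta>' s
    proof -
      have hom: "path_homotopic X (path_join (L \<beta>) (L \<beta>')) (L (path_join \<beta> \<beta>'))"
        using \<alpha>[OF ends(1)[OF \<beta>(1)]] \<alpha>[OF ends(2)[OF \<beta>(1)]] \<alpha>[OF ends(2)[OF \<beta>(2)]] \<beta>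
        unfolding L_def path_join_ends \<beta>(3)[symmetric]
        by (intro path_homotopic_conj_join) (auto simp: \<beta>(3)[symmetric])
      have "T (path_join \<beta> \<beta>') s = \<mu> (loop_class X x (path_join (L \<beta>) (L \<beta>'))) s"
        by (rule T_eqI[OF pathin_join[OF \<beta>] path_homotopic_sym[OF hom]])
      also have "\<dots> = T \<beta>' (T \<beta> s)"
        unfolding T_def mult_loop_class[OF L[OF \<beta>(2)] L[OF \<beta>(1)], symmetric]
        by (intro group_action_mult[OF act] loop_class_in_carrier L \<beta> s)
      finally show ?thesis .
    qed
  qed (use X k in auto)
  have T_loop: "T \<gamma> s = \<mu> (loop_class X x \<gamma>) s" if \<gamma>: "\<gamma> \<in> loops X x" for \<gamma> s
  proof (rule T_eqI)
    have g: "pathin X \<gamma>" "\<gamma> 0 = x" "\<gamma> 1 = x"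
      using \<gamma> by (auto simp: loops_def)
    have "L \<gamma> = path_join (path_join (\<lambda>t. \<gamma> 0) \<gamma>) (\<lambda>t. \<gamma> 1)"
      using g by (simp add: L_def \<alpha>_def path_rev_def)
    moreover have "path_homotopic X (path_join (path_join (\<lambda>t. \<gamma> 0) \<gamma>) (\<lambda>t. \<gamma> 1)) (path_join \<gamma> (\<lambda>t. \<gamma> 1))"
      using path_homotopic_join_const(2)[OF g(1)] ends(2)[OF g(1)]
      by (intro path_homotopic_join path_homotopic_refl) auto
    ultimately show "path_homotopic X (L \<gamma>) \<gamma>"
      using path_homotopic_join_const(1)[OF g(1)] path_homotopic_trans by metis
  qed (use \<gamma> in \<open>simp add: loops_def\<close>)
  have fin: "is_finite_cover X (total_space, proj)"
    using is_cover_total_space S by (simp add: is_finite_cover_def fibre_total_space)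
  have inj: "inj_on (\<lambda>s. k (x, s)) S"
    using x by (auto simp: inj_on_def k_eq_iff)
  define f where "f = inv_into S (\<lambda>s. k (x, s))"
  have f: "f (k (x, s)) = s" if "s \<in> S" for s
    unfolding f_def using inv_into_f_f[OF inj that] by simp
  have "bij_betw f (fibre (total_space, proj) x) S"
    unfolding f_def fibre_total_space[OF x] by (intro bij_betw_inv_into inj_on_imp_bij_betw inj)
  moreover have "f (monodromy (total_space, proj) x a u) = \<mu> a (f u)"
    if a: "a \<in> carrier ?G" and u: "u \<in> fibre (total_space, proj) x" for a u
  proof -
    obtain \<gamma> where \<gamma>: "\<gamma> \<in> loops X x" "a = loop_class X x \<gamma>"
      using a by (rule carrier_fundamental_groupE)
    then have g: "pathin X \<gamma>" "\<gamma> 0 = x" "\<gamma> 1 = x"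
      by (auto simp: loops_def)
    obtain s where s: "s \<in> S" "u = k (x, s)"
      using u unfolding fibre_total_space[OF x] by blast
    have "lifts_from_to (total_space, proj) \<gamma> u (k (x, T \<gamma> s))"
      using lifts_from_to_total_space[OF g(1) s(1)] g s by simp
    then have "monodromy (total_space, proj) x a u = k (x, T \<gamma> s)"
      unfolding \<gamma>(2) by (rule monodromy_eq[OF is_cover_total_space \<gamma>(1)])
    then show ?thesis
      using f s T_closed[OF g(1) s(1)] T_loop[OF \<gamma>(1)] \<gamma>(2) by simp
  qed
  ultimately show thesis
    using that fin by blast
qed

section \<open>Galois covers\<close>

text \<open>Around \<open>p y\<close> the image contains the preimage of \<open>V\<close> under a
  section through \<open>y\<close>.\<close>

lemma cover_open_map:
  assumes c: "is_cover X (Y, p)" and V: "openin Y V"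
  shows "openin X (p ` V)"
proof (subst openin_subopen, intro ballI)
  fix z assume "z \<in> p ` V"
  then obtain y where y: "y \<in> V" "z = p y" "y \<in> topspace Y"
    using openin_subset[OF V] by blast
  obtain U \<sigma> where U: "openin X U" "z \<in> U" and \<sigma>: "local_section X (Y, p) U \<sigma>" "\<sigma> z = y"
    using cover_section_at[OF c y(3)] unfolding y(2) .
  let ?T = "{u \<in> U. \<sigma> u \<in> V}"
  have "openin X ?T"
    using \<sigma>(1) U(1) V by (rule openin_section_preimage)
  moreover have "z \<in> ?T"
    using U \<sigma>(2) y(1) by auto
  moreover have "?T \<subseteq> p ` V"
  proof
    fix u assume "u \<in> ?T"
    then have "p (\<sigma> u) = u" "\<sigma> u \<in> V"
      using \<sigma>(1) by (auto simp: local_section_def)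
    then show "u \<in> p ` V"
      by (metis imageI)
  qed
  ultimately show "\<exists>T. openin X T \<and> z \<in> T \<and> T \<subseteq> p ` V"
    by blast
qed

lemma cover_surjective:
  assumes X: "path_connected_space X" and c: "is_cover X (Y, p)" and y: "y \<in> topspace Y"
  shows "p ` topspace Y = topspace X"
proof
  show "p ` topspace Y \<subseteq> topspace X"
    using cover_continuous[OF c] by (auto simp: continuous_map_def Pi_iff)
  then have py: "p y \<in> topspace X"
    using y by blast
  show "topspace X \<subseteq> p ` topspace Y"
  proof
    fix z assume "z \<in> topspace X"
    then obtain \<alpha> where \<alpha>: "pathin X \<alpha>" "\<alpha> 0 = p y" "\<alpha> 1 = z"
      using X py unfolding path_connected_space_def by blast
    obtain w where "lifts_from_to (Y, p) \<alpha> y w"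
      using lifts_from_to_exists[OF c \<alpha>(1) y] \<alpha>(2) by auto
    then show "z \<in> p ` topspace Y"
      using lifts_from_to_ends[of Y p \<alpha> y w] \<alpha>(3) by auto
  qed
qed

lemma cover_aut_iff:
  "f \<in> carrier (cover_aut (Y, p)) \<longleftrightarrow> f \<in> cover_maps (Y, p) (Y, p) \<and> homeomorphic_map Y Y f"
  by (auto simp: cover_aut_def cover_maps_def Bij_def bij_betw_def homeomorphic_imp_continuous_map
      dest: homeomorphic_imp_injective_map homeomorphic_imp_surjective_map)

lemma cover_map_compose:
  assumes "f \<in> cover_maps (Y, p) (Z, q)" "g \<in> cover_maps (Z, q) (W, r)"
  shows "compose (topspace Y) g f \<in> cover_maps (Y, p) (W, r)"
proof -
  have "continuous_map Y W (g \<circ> f)"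
    using assms by (auto simp: cover_maps_def intro: continuous_map_compose)
  then have "continuous_map Y W (compose (topspace Y) g f)"
    by (rule continuous_map_eq) (simp add: compose_def)
  moreover have "f \<in> topspace Y \<rightarrow> topspace Z"
    using assms(1) by (auto simp: cover_maps_def continuous_map_def)
  ultimately show ?thesis
    using assms by (auto simp: cover_maps_def compose_def Pi_iff)
qed

lemma cover_map_ident: "(\<lambda>y\<in>topspace Y. y) \<in> cover_maps (Y, p) (Y, p)"
proof -
  have "continuous_map Y Y (\<lambda>y\<in>topspace Y. y)"
    by (rule continuous_map_eq[OF continuous_map_id]) simp
  then show ?thesis
    by (simp add: cover_maps_def)
qed

lemma cover_aut_compose:
  assumes "f \<in> carrier (cover_aut (Y, p))" "g \<in> carrier (cover_aut (Y, p))"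
  shows "compose (topspace Y) g f \<in> carrier (cover_aut (Y, p))"
proof -
  have "homeomorphic_map Y Y (g \<circ> f)"
    using assms by (auto simp: cover_aut_iff intro: homeomorphic_map_compose)
  then have "homeomorphic_map Y Y (compose (topspace Y) g f)"
    by (rule homeomorphic_map_eq) (simp add: compose_def)
  then show ?thesis
    using assms cover_map_compose by (auto simp: cover_aut_iff)
qed

lemma cover_aut_inverse:
  assumes f: "f \<in> carrier (cover_aut (Y, p))"
  obtains g where "g \<in> carrier (cover_aut (Y, p))" "\<And>y. y \<in> topspace Y \<Longrightarrow> g (f y) = y"
proof -
  obtain g where g: "homeomorphic_maps Y Y f g"
    using f by (auto simp: cover_aut_iff homeomorphic_map_maps)
  have gY: "g \<in> topspace Y \<rightarrow> topspace Y" and gf: "\<And>y. y \<in> topspace Y \<Longrightarrow> g (f y) = y"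
    and fg: "\<And>y. y \<in> topspace Y \<Longrightarrow> f (g y) = y" and fY: "f \<in> topspace Y \<rightarrow> topspace Y"
    using g by (auto simp: homeomorphic_maps_def continuous_map_def)
  have "homeomorphic_map Y Y g"
    using g homeomorphic_maps_sym homeomorphic_maps_map by blast
  then have h: "homeomorphic_map Y Y (restrict g (topspace Y))"
    by (rule homeomorphic_map_eq) simp
  have "p (g y) = p y" if y: "y \<in> topspace Y" for y
  proof -
    have "g y \<in> topspace Y"
      using gY y by blast
    then have "p (f (g y)) = p (g y)"
      using f by (simp add: cover_aut_iff cover_maps_def)
    then show ?thesis
      using fg[OF y] by simp
  qed
  then have "restrict g (topspace Y) \<in> carrier (cover_aut (Y, p))"
    using h homeomorphic_imp_continuous_map[OF h] by (auto simp: cover_aut_iff cover_maps_def)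
  moreover have "restrict g (topspace Y) (f y) = y" if "y \<in> topspace Y" for y
    using gf[OF that] fY that by auto
  ultimately show thesis
    by (rule that)
qed

text \<open>On a connected \<open>Y\<close> the composite of \<open>f\<close> and \<open>g\<close>
  is a lift of \<open>p\<close> that agrees with the identity at \<open>y\<close>, hence everywhere;
  the other composite fixes \<open>f y\<close>. So one point suffices to see that \<open>f\<close>
  is invertible.\<close>

lemma cover_aut_if_inverse_point:
  assumes c: "is_cover X (Y, p)" and Y: "connected_space Y"
    and f: "f \<in> cover_maps (Y, p) (Y, p)" and g: "g \<in> cover_maps (Y, p) (Y, p)"
    and y: "y \<in> topspace Y" "g (f y) = y"
  shows "f \<in> carrier (cover_aut (Y, p))"
proof -
  have id_if: "g (f z) = z"
    if f: "f \<in> cover_maps (Y, p) (Y, p)" and g: "g \<in> cover_maps (Y, p) (Y, p)"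
      and y: "y \<in> topspace Y" "g (f y) = y" and z: "z \<in> topspace Y" for f g y z
  proof -
    have gf: "compose (topspace Y) g f \<in> cover_maps (Y, p) (Y, p)"
      using f g by (rule cover_map_compose)
    have "compose (topspace Y) g f z = (\<lambda>y\<in>topspace Y. y) z"
    proof (rule lift_unique[OF c Y, of "compose (topspace Y) g f" "\<lambda>y\<in>topspace Y. y" y z])
      show "p (compose (topspace Y) g f w) = p ((\<lambda>y\<in>topspace Y. y) w)" if "w \<in> topspace Y" for w
        using gf that by (simp add: cover_maps_def)
      show "compose (topspace Y) g f y = (\<lambda>y\<in>topspace Y. y) y"
        using y by (simp add: compose_def)
    qed (use gf cover_map_ident[of Y p] y z in \<open>auto simp: cover_maps_def\<close>)
    then show ?thesis
      using z by (simp add: compose_def)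
  qed
  have "f y \<in> topspace Y" "f (g (f y)) = f y"
    using f y by (auto simp: cover_maps_def continuous_map_def Pi_iff)
  then have "homeomorphic_maps Y Y f g"
    using id_if[OF f g y] id_if[OF g f] f g by (auto simp: homeomorphic_maps_def cover_maps_def)
  then show ?thesis
    using f by (auto simp: cover_aut_iff homeomorphic_map_maps)
qed

text \<open>The map on the orbit space is well defined, and continuous and open because
  \<open>p\<close> is. It is therefore a homeomorphism as soon as it is bijective; its injectivity
  is transitivity of the automorphisms on the fibres.\<close>

lemma is_galois_cover_iff:
  assumes c: "is_cover X (Y, p)"
  shows "is_galois_cover X (Y, p) \<longleftrightarrow> connected_space Y \<and> p ` topspace Y = topspace X \<and>
    (\<forall>y\<in>topspace Y. \<forall>y'\<in>topspace Y. p y = p y' \<longrightarrow> (\<exists>f\<in>carrier (cover_aut (Y, p)). f y = y'))"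
proof -
  let ?A = "carrier (cover_aut (Y, p))"
  define q where "q = orbit (cover_aut (Y, p)) (\<lambda>f. f)"
  let ?Q = "quotient_topology Y q" and ?h = "\<lambda>A. the_elem (p ` A)"
  have q: "q y = {f y | f. f \<in> ?A}" for y
    by (simp add: q_def orbit_def)
  have id: "(\<lambda>y\<in>topspace Y. y) \<in> ?A"
    using cover_map_ident homeomorphic_map_eq[OF iffD2[OF homeomorphic_map_id refl], of Y "\<lambda>y\<in>topspace Y. y"]
    by (auto simp: cover_aut_iff)
  have self: "y \<in> q y" if "y \<in> topspace Y" for y
    using id that unfolding q by (intro CollectI exI[of _ "\<lambda>y\<in>topspace Y. y"]) simp
  have hq: "?h (q y) = p y" if y: "y \<in> topspace Y" for y
  proof -
    have "p z = p y" if "z \<in> q y" for z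
      using that y by (auto simp: q cover_aut_iff cover_maps_def)
    then have "p ` q y = {p y}"
      using self[OF y] by blast
    then show ?thesis by simp
  qed
  have q_eq: "q (f y) = q y" if f: "f \<in> ?A" and y: "y \<in> topspace Y" for f y
  proof -
    obtain g where g: "g \<in> ?A" "\<And>y. y \<in> topspace Y \<Longrightarrow> g (f y) = y"
      by (rule cover_aut_inverse[OF f]) blast
    have fy: "f y \<in> topspace Y"
      using f y by (auto simp: cover_aut_iff cover_maps_def continuous_map_def Pi_iff)
    have "h (f y) \<in> q y" if "h \<in> ?A" for h
      unfolding q using cover_aut_compose[OF f that] y
      by (intro CollectI exI[of _ "compose (topspace Y) h f"]) (simp add: compose_def)
    moreover have "h y \<in> q (f y)" if "h \<in> ?A" for h
      unfolding q using cover_aut_compose[OF g(1) that] g(2)[OF y] fy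
      by (intro CollectI exI[of _ "compose (topspace Y) h g"]) (simp add: compose_def)
    ultimately show ?thesis
      unfolding q by blast
  qed
  have "homeomorphic_map ?Q X ?h \<longleftrightarrow> p ` topspace Y = topspace X \<and>
    (\<forall>y\<in>topspace Y. \<forall>y'\<in>topspace Y. p y = p y' \<longrightarrow> (\<exists>f\<in>?A. f y = y'))" (is "_ \<longleftrightarrow> ?surj \<and> ?trans")
  proof
    assume h: "homeomorphic_map ?Q X ?h"
    have "?h ` q ` topspace Y = topspace X"
      using homeomorphic_imp_surjective_map[OF h] by (simp add: topspace_quotient_topology)
    moreover have "?h ` q ` topspace Y = p ` topspace Y"
      using hq by (simp add: image_image)
    moreover have "?trans"
    proof (intro ballI impI)
      fix y y' assume y: "y \<in> topspace Y" "y' \<in> topspace Y" "p y = p y'"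
      then have "?h (q y) = ?h (q y')"
        using hq by simp
      then have "q y = q y'"
        using homeomorphic_imp_injective_map[OF h] y(1,2)
        by (auto simp: inj_on_def topspace_quotient_topology)
      then have "y' \<in> q y"
        using self[OF y(2)] by simp
      then show "\<exists>f\<in>?A. f y = y'"
        unfolding q by blast
    qed
    ultimately show "?surj \<and> ?trans"
      by simp
  next
    assume st: "?surj \<and> ?trans"
    show "homeomorphic_map ?Q X ?h"
    proof (rule bijective_open_imp_homeomorphic_map)
      have "continuous_map Y X (?h \<circ> q)"
        by (rule continuous_map_eq[OF cover_continuous[OF c]]) (simp add: hq)
      then show "continuous_map ?Q X ?h"
        using continuous_compose_quotient_map[OF quotient_map_quotient_topology] by blast
      show "open_map ?Q X ?h"
        unfolding open_map_def openin_quotient_topology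
      proof (intro allI impI)
        fix W assume W: "W \<subseteq> q ` topspace Y \<and> openin Y {y \<in> topspace Y. q y \<in> W}"
        have "?h ` W = p ` {y \<in> topspace Y. q y \<in> W}"
        proof
          show "?h ` W \<subseteq> p ` {y \<in> topspace Y. q y \<in> W}"
            using W hq by fastforce
          show "p ` {y \<in> topspace Y. q y \<in> W} \<subseteq> ?h ` W"
            using hq by force
        qed
        then show "openin X (?h ` W)"
          using cover_open_map[OF c] W by simp
      qed
      show "?h ` topspace ?Q = topspace X"
        using st hq by (simp add: topspace_quotient_topology image_image)
      show "inj_on ?h (topspace ?Q)"
        unfolding topspace_quotient_topology
      proof (rule inj_onI)
        fix A B assume "A \<in> q ` topspace Y" "B \<in> q ` topspace Y" "?h A = ?h B"
        then obtain y y' where y: "y \<in> topspace Y" "y' \<in> topspace Y" "A = q y" "B = q y'" "p y = p y'"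
          using hq by auto
        then obtain f where "f \<in> ?A" "f y = y'"
          using st by blast
        then show "A = B"
          using q_eq[of f y] y by simp
      qed
    qed
  qed
  then show ?thesis
    using c unfolding is_galois_cover_def q_def by auto
qed

section \<open>The fibre functor\<close>

text \<open>Covers and sets with an action both have extensional functions as arrows, so the laws of
  \<open>compose\<close> give the category laws for both.\<close>

lemma category_of_structured_sets:
  fixes car :: "'o \<Rightarrow> 's set"
  assumes maps: "\<And>A B f. A \<in> Obj \<Longrightarrow> B \<in> Obj \<Longrightarrow> f \<in> M A B \<Longrightarrow> f \<in> car A \<rightarrow>\<^sub>E car B"
    and ident: "\<And>A. A \<in> Obj \<Longrightarrow> (\<lambda>s\<in>car A. s) \<in> M A A"
    and comp: "\<And>A B D f g. A \<in> Obj \<Longrightarrow> B \<in> Obj \<Longrightarrow> D \<in> Obj \<Longrightarrow> f \<in> M A B \<Longrightarrow> g \<in> M B D \<Longrightarrow> compose (car A) g f \<in> M A D"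
  shows "category \<lparr>Ob = Obj, Arr = M, Ident = (\<lambda>A. \<lambda>s\<in>car A. s), Cmp = (\<lambda>A B D g f. compose (car A) g f)\<rparr>"
proof -
  have f: "f \<in> car A \<rightarrow> car B" "f \<in> extensional (car A)" if "A \<in> Obj" "B \<in> Obj" "f \<in> M A B" for A B f
    using maps[OF that] by (auto simp: PiE_def)
  show ?thesis
    unfolding category_def cat.simps
    by (intro conjI ballI ident comp Id_compose[OF f] compose_Id[OF f] compose_assoc[OF f(1)])
qed

lemma category_finite_covers:
  fixes X :: "'a topology"
  shows "category (finite_covers X :: (('u, 'a) space_over, 'u \<Rightarrow> 'u) cat)"
  unfolding finite_covers_def
proof (rule category_of_structured_sets)
  show "f \<in> topspace (fst c) \<rightarrow>\<^sub>E topspace (fst d)" if "f \<in> cover_maps c d" for c d :: "('u, 'a) space_over" and f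
    using that by (cases c, cases d) (auto simp: cover_maps_def PiE_def continuous_map_def)
  show "(\<lambda>s\<in>topspace (fst c). s) \<in> cover_maps c c" for c :: "('u, 'a) space_over"
    using cover_map_ident by (cases c) simp
  show "compose (topspace (fst c)) g f \<in> cover_maps c e" if "f \<in> cover_maps c d" "g \<in> cover_maps d e"
    for c d e :: "('u, 'a) space_over" and f g
    using that cover_map_compose by (cases c, cases d, cases e) fastforce
qed

section \<open>Equivariant maps\<close>

lemma equivariant_mapsD:
  assumes "f \<in> equivariant_maps H A B"
  shows "f \<in> fst A \<rightarrow>\<^sub>E fst B"
    and "\<And>h s. h \<in> carrier H \<Longrightarrow> s \<in> fst A \<Longrightarrow> f (snd A h s) = snd B h (f s)"
  using assms by (auto simp: equivariant_maps_def split: prod.splits)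

lemma equivariant_mapsI:
  assumes "f \<in> fst A \<rightarrow>\<^sub>E fst B"
    and "\<And>h s. h \<in> carrier H \<Longrightarrow> s \<in> fst A \<Longrightarrow> f (snd A h s) = snd B h (f s)"
  shows "f \<in> equivariant_maps H A B"
  using assms by (auto simp: equivariant_maps_def split: prod.splits)

lemma equivariant_maps_compose:
  assumes A: "group_action H (fst A) (snd A)"
    and f: "f \<in> equivariant_maps H A B" and g: "g \<in> equivariant_maps H B D"
  shows "compose (fst A) g f \<in> equivariant_maps H A D"
proof (rule equivariant_mapsI)
  note f' = equivariant_mapsD[OF f] and g' = equivariant_mapsD[OF g]
  have fs: "f s \<in> fst B" if "s \<in> fst A" for s
    using f'(1) that by auto
  then show "compose (fst A) g f \<in> fst A \<rightarrow>\<^sub>E fst D"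
    using g'(1) by (auto simp: compose_def)
  show "compose (fst A) g f (snd A h s) = snd D h (compose (fst A) g f s)" if "h \<in> carrier H" "s \<in> fst A" for h s
    using that f'(2) g'(2) fs group_action_closed[OF A] by (simp add: compose_def)
qed

lemma equivariant_maps_ident:
  assumes A: "group_action H (fst A) (snd A)"
  shows "(\<lambda>s\<in>fst A. s) \<in> equivariant_maps H A A"
  using group_action_closed[OF A] by (intro equivariant_mapsI) auto

lemma finite_cont_gset_action:
  "finite_cont_gset G A \<Longrightarrow> group_action (profinite_completion G) (fst A) (snd A)"
  by (auto simp: finite_cont_gset_def)

lemma category_finite_gsets: "category (finite_gsets G)"
  unfolding finite_gsets_def
  by (rule category_of_structured_sets)
    (auto intro: equivariant_maps_ident equivariant_maps_compose finite_cont_gset_action dest: equivariant_mapsD)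

lemma equivariant_maps_inverse:
  assumes A: "group_action H (fst A) (snd A)" and B: "group_action H (fst B) (snd B)"
    and f: "f \<in> equivariant_maps H A B" and bij: "bij_betw f (fst A) (fst B)"
  shows "restrict (inv_into (fst A) f) (fst B) \<in> equivariant_maps H B A"
proof (rule equivariant_mapsI)
  let ?g = "restrict (inv_into (fst A) f) (fst B)"
  have g: "?g t \<in> fst A" "f (?g t) = t" if "t \<in> fst B" for t
    using bij that by (auto simp: bij_betw_def intro: inv_into_into f_inv_into_f)
  then show "?g \<in> fst B \<rightarrow>\<^sub>E fst A" by auto
  fix h t assume h: "h \<in> carrier H" and t: "t \<in> fst B"
  have "f (?g (snd B h t)) = f (snd A h (?g t))"
    using g(2)[OF group_action_closed[OF B h t]] equivariant_mapsD(2)[OF f h g(1)[OF t]] g(2)[OF t] by simp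
  then show "?g (snd B h t) = snd A h (?g t)"
    using bij g(1)[OF group_action_closed[OF B h t]] group_action_closed[OF A h g(1)[OF t]]
    unfolding bij_betw_def inj_on_def by blast
qed

lemma iso_arr_finite_gsets:
  assumes A: "finite_cont_gset G A" and B: "finite_cont_gset G B"
    and f: "f \<in> equivariant_maps (profinite_completion G) A B" and bij: "bij_betw f (fst A) (fst B)"
  shows "iso_arr (finite_gsets G) A B f"
proof -
  let ?g = "restrict (inv_into (fst A) f) (fst B)"
  have "?g \<in> equivariant_maps (profinite_completion G) B A"
    using A B f bij by (intro equivariant_maps_inverse finite_cont_gset_action)
  moreover have "compose (fst A) ?g f = (\<lambda>s\<in>fst A. s)" "compose (fst B) f ?g = (\<lambda>s\<in>fst B. s)"
    using bij by (auto simp: compose_def bij_betw_def f_inv_into_f fun_eq_iff restrict_def)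
  ultimately show ?thesis
    using f by (auto simp: iso_arr_def finite_gsets_def)
qed

lemma equivariant_maps_restrict_iff:
  assumes A: "group_action H (fst A) (snd A)"
  shows "restrict f (fst A) \<in> equivariant_maps H A B \<longleftrightarrow>
    f \<in> fst A \<rightarrow> fst B \<and> (\<forall>h\<in>carrier H. \<forall>s\<in>fst A. f (snd A h s) = snd B h (f s))"
  using group_action_closed[OF A] by (auto simp: equivariant_maps_def Pi_iff split: prod.splits)

section \<open>The fibre functor over a path connected base\<close>

context
  fixes X :: "'a topology" and x :: 'a
  assumes pc: "path_connected_space X" and lpc: "locally_path_connected_space X" and x: "x \<in> topspace X"
begin

interpretation group "fundamental_group X x"
  by (rule group_fundamental_group[OF x])

abbreviation (input) "pi1 \<equiv> fundamental_group X x"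
abbreviation (input) "pi1_hat \<equiv> profinite_completion pi1"

lemma finite_cover_cover: "is_finite_cover X c \<Longrightarrow> is_cover X c"
  by (simp add: is_finite_cover_def)

lemma finite_cover_fibre: "is_finite_cover X c \<Longrightarrow> finite (fibre c x)"
  using x by (simp add: is_finite_cover_def)

lemma finite_cover_action: "is_finite_cover X c \<Longrightarrow> group_action pi1 (fibre c x) (monodromy c x)"
  using group_action_monodromy[OF _ x] by (cases c) (auto dest: finite_cover_cover)

lemma on_ob_Fib:
  "fst (on_ob (Fib X x) c) = fibre c x"
  "snd (on_ob (Fib X x) c) = completed_action pi1 (fibre c x) (monodromy c x)"
  by (simp_all add: Fib_def)

lemma finite_cont_gset_Fib:
  assumes "is_finite_cover X c"
  shows "finite_cont_gset pi1 (on_ob (Fib X x) c)"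
  using finite_cont_gset_completed_action[OF finite_cover_action[OF assms] finite_cover_fibre[OF assms]]
  by (simp add: Fib_def)

lemma Fib_action:
  assumes "is_finite_cover X c"
  shows "group_action pi1_hat (fst (on_ob (Fib X x) c)) (snd (on_ob (Fib X x) c))"
  by (rule finite_cont_gset_action[OF finite_cont_gset_Fib[OF assms]])

text \<open>The passage from the profinite group to loops: by approximation, equivariance for the
  completion is equivariance for monodromy. All statements about arrows of finite sets are reduced
  to covers through it.\<close>

lemma restrict_equivariant_Fib_iff:
  assumes c: "is_finite_cover X c" and d: "is_finite_cover X d"
  shows "restrict f (fibre c x) \<in> equivariant_maps pi1_hat (on_ob (Fib X x) c) (on_ob (Fib X x) d) \<longleftrightarrow>
    monodromy_equivariant X x c d f"
  using equivariant_maps_restrict_iff[OF Fib_action[OF c], of f "on_ob (Fib X x) d"]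
    completed_equivariant_iff[OF finite_cover_action[OF c] finite_cover_action[OF d]
      finite_cover_fibre[OF c] finite_cover_fibre[OF d], of f]
  unfolding monodromy_equivariant_def on_ob_Fib by blast

lemma equivariant_Fib_restrict:
  assumes "f \<in> equivariant_maps pi1_hat (on_ob (Fib X x) c) B"
  shows "restrict f (fibre c x) = f"
  using equivariant_mapsD(1)[OF assms] unfolding on_ob_Fib by (simp add: PiE_restrict)

lemma cover_map_equivariant_Fib:
  assumes "is_finite_cover X c" "is_finite_cover X d" "f \<in> cover_maps c d"
  shows "restrict f (fibre c x) \<in> equivariant_maps pi1_hat (on_ob (Fib X x) c) (on_ob (Fib X x) d)"
  unfolding restrict_equivariant_Fib_iff[OF assms(1,2)]
  using assms monodromy_equivariant_cover_map[of X "fst c" "snd c" "fst d" "snd d" f x]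
  by (simp add: finite_cover_cover)

lemma is_functor_Fib:
  "is_functor (finite_covers X :: (('u, 'a) space_over, 'u \<Rightarrow> 'u) cat) (finite_gsets pi1) (Fib X x)"
  unfolding is_functor_def
proof (intro conjI category_finite_covers category_finite_gsets ballI)
  let ?F = "Fib X x :: (('u, 'a) space_over, 'u \<Rightarrow> 'u, _, _) fctr"
  fix c :: "('u, 'a) space_over" assume "c \<in> Ob (finite_covers X)"
  then have c: "is_finite_cover X c"
    by (simp add: finite_covers_def)
  have sub: "fibre c x \<subseteq> topspace (fst c)"
    by (cases c) (auto simp: fibre_def)
  show "on_ob ?F c \<in> Ob (finite_gsets pi1)"
    using finite_cont_gset_Fib[OF c] by (simp add: finite_gsets_def)
  show "on_arr ?F c c (Ident (finite_covers X) c) = Ident (finite_gsets pi1) (on_ob ?F c)"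
    using sub by (auto simp: Fib_def finite_covers_def finite_gsets_def fun_eq_iff)
  fix d :: "('u, 'a) space_over" assume "d \<in> Ob (finite_covers X)"
  then have d: "is_finite_cover X d"
    by (simp add: finite_covers_def)
  show "on_arr ?F c d f \<in> Arr (finite_gsets pi1) (on_ob ?F c) (on_ob ?F d)"
    if "f \<in> Arr (finite_covers X) c d" for f
    using cover_map_equivariant_Fib[OF c d, of f] that
    by (simp add: Fib_def finite_covers_def finite_gsets_def)
  fix e :: "('u, 'a) space_over" and f g
  assume "f \<in> Arr (finite_covers X) c d"
  then have f: "f \<in> cover_maps c d"
    by (simp add: finite_covers_def)
  have "f s \<in> fibre d x" if "s \<in> fibre c x" for s
    using f that by (cases c, cases d) (auto simp: cover_maps_def fibre_def continuous_map_def Pi_iff)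
  then show "on_arr ?F c e (Cmp (finite_covers X) c d e g f) =
      Cmp (finite_gsets pi1) (on_ob ?F c) (on_ob ?F d) (on_ob ?F e) (on_arr ?F d e g) (on_arr ?F c d f)"
    using sub by (auto simp: Fib_def finite_covers_def finite_gsets_def compose_def fun_eq_iff)
qed

lemma equivariant_Fib_extends:
  assumes c: "is_finite_cover X c" and d: "is_finite_cover X d"
    and f: "f \<in> equivariant_maps pi1_hat (on_ob (Fib X x) c) (on_ob (Fib X x) d)"
  obtains F where "F \<in> cover_maps c d" "\<And>s. s \<in> fibre c x \<Longrightarrow> F s = f s"
proof -
  have "monodromy_equivariant X x c d f"
    using f unfolding equivariant_Fib_restrict[OF f] restrict_equivariant_Fib_iff[OF c d, symmetric] .
  then show thesis
    using that extend_equivariant_to_cover_map[OF pc lpc x, of "fst c" "snd c" "fst d" "snd d" f]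
      finite_cover_cover[OF c] finite_cover_cover[OF d] by auto
qed

lemma Fib_fully_faithful:
  assumes c: "is_finite_cover X c" and d: "is_finite_cover X d"
  shows "bij_betw (on_arr (Fib X x) c d) (cover_maps c d) (equivariant_maps pi1_hat (on_ob (Fib X x) c) (on_ob (Fib X x) d))"
  unfolding bij_betw_def
proof
  have on_arr: "on_arr (Fib X x) c d f = restrict f (fibre c x)" for f
    by (simp add: Fib_def)
  show "inj_on (on_arr (Fib X x) c d) (cover_maps c d)"
  proof (rule inj_onI)
    fix f g assume fg: "f \<in> cover_maps c d" "g \<in> cover_maps c d" "on_arr (Fib X x) c d f = on_arr (Fib X x) c d g"
    have "f s = g s" if "s \<in> fibre c x" for s
      using fun_cong[OF fg(3), of s] that by (simp add: on_arr)
    then show "f = g"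
      using cover_map_eq[OF pc x, of "fst c" "snd c" "fst d" "snd d" f g] fg(1,2)
        finite_cover_cover[OF c] finite_cover_cover[OF d] by simp
  qed
  show "on_arr (Fib X x) c d ` cover_maps c d = equivariant_maps pi1_hat (on_ob (Fib X x) c) (on_ob (Fib X x) d)"
  proof
    show "on_arr (Fib X x) c d ` cover_maps c d \<subseteq> equivariant_maps pi1_hat (on_ob (Fib X x) c) (on_ob (Fib X x) d)"
      using cover_map_equivariant_Fib[OF c d] by (auto simp: on_arr)
    show "equivariant_maps pi1_hat (on_ob (Fib X x) c) (on_ob (Fib X x) d) \<subseteq> on_arr (Fib X x) c d ` cover_maps c d"
    proof
      fix f assume f: "f \<in> equivariant_maps pi1_hat (on_ob (Fib X x) c) (on_ob (Fib X x) d)"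
      obtain F where F: "F \<in> cover_maps c d" "\<And>s. s \<in> fibre c x \<Longrightarrow> F s = f s"
        using equivariant_Fib_extends[OF c d f] by blast
      have "restrict F (fibre c x) = restrict f (fibre c x)"
        using F(2) by (rule restrict_ext)
      then have "on_arr (Fib X x) c d F = f"
        using equivariant_Fib_restrict[OF f] by (simp add: on_arr)
      then show "f \<in> on_arr (Fib X x) c d ` cover_maps c d"
        using F(1) by blast
    qed
  qed
qed

text \<open>The action is restricted to the fundamental group and realised by a cover. Completing
  the monodromy action of that cover gives back the original action because the latter is
  continuous.\<close>

lemma Fib_essentially_surjective:
  fixes \<iota> :: "'a \<times> nat \<Rightarrow> 'u"
  assumes slsc: "semilocally_simply_connected X" and \<iota>: "inj_on \<iota> (topspace X \<times> UNIV)"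
    and A: "finite_cont_gset pi1 A"
  obtains c :: "('u, 'a) space_over" where "is_finite_cover X c" "gset_isomorphic pi1_hat (on_ob (Fib X x) c) A"
proof -
  obtain S \<phi> where S: "A = (S, \<phi>)"
    by (cases A)
  let ?\<mu> = "\<lambda>g. \<phi> (to_completion pi1 g)"
  have fin: "finite S" and act: "group_action pi1 S ?\<mu>"
    using A group_action_restrict_completion by (auto simp: S finite_cont_gset_iff)
  obtain Y :: "'u topology" and p f where c: "is_finite_cover X (Y, p)" and bij: "bij_betw f (fibre (Y, p) x) S"
    and f: "\<And>a u. a \<in> carrier pi1 \<Longrightarrow> u \<in> fibre (Y, p) x \<Longrightarrow> f (monodromy (Y, p) x a u) = ?\<mu> a (f u)"
    using cover_of_action[OF pc lpc slsc x \<iota> act fin] by blast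
  have fS: "f \<in> fibre (Y, p) x \<rightarrow> S"
    using bij by (auto simp: bij_betw_def)
  have "f (completed_action pi1 (fibre (Y, p) x) (monodromy (Y, p) x) \<xi> u) = \<phi> \<xi> (f u)"
    if "\<xi> \<in> carrier pi1_hat" "u \<in> fibre (Y, p) x" for \<xi> u
    using completed_equivariant_iff[OF finite_cover_action[OF c] act finite_cover_fibre[OF c] fin fS] f that fS
      completed_action_restrict[OF A[unfolded S] that(1)] by (simp add: Pi_iff)
  then have "restrict f (fst (on_ob (Fib X x) (Y, p))) \<in> equivariant_maps pi1_hat (on_ob (Fib X x) (Y, p)) A"
    unfolding equivariant_maps_restrict_iff[OF Fib_action[OF c]] using fS by (simp add: S on_ob_Fib)
  moreover have "bij_betw (restrict f (fst (on_ob (Fib X x) (Y, p)))) (fst (on_ob (Fib X x) (Y, p))) (fst A)"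
    using bij unfolding on_ob_Fib S fst_conv by (simp cong: bij_betw_cong)
  ultimately show thesis
    using that c unfolding gset_isomorphic_def by blast
qed

text \<open>Fibres are subsets of covering spaces, so the finite sets are taken from the same
  universe \<open>'u\<close>.\<close>

theorem is_equivalence_Fib:
  fixes \<iota> :: "'a \<times> nat \<Rightarrow> 'u"
  assumes "semilocally_simply_connected X" "inj_on \<iota> (topspace X \<times> UNIV)"
  shows "is_equivalence (finite_covers X :: (('u, 'a) space_over, 'u \<Rightarrow> 'u) cat) (finite_gsets pi1) (Fib X x)"
proof (rule is_equivalence_if_fully_faithful[OF is_functor_Fib])
  show "bij_betw (on_arr (Fib X x) c d) (Arr (finite_covers X) c d)
      (Arr (finite_gsets pi1) (on_ob (Fib X x) c) (on_ob (Fib X x) d))"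
    if "c \<in> Ob (finite_covers X)" "d \<in> Ob (finite_covers X)" for c d :: "('u, 'a) space_over"
    using Fib_fully_faithful[of c d] that by (simp add: finite_covers_def finite_gsets_def)
  show "\<exists>c\<in>Ob (finite_covers X). \<exists>f. iso_arr (finite_gsets pi1) (on_ob (Fib X x) c) A f"
    if "A \<in> Ob (finite_gsets pi1)" for A :: "(_, 'u) gset"
  proof -
    have A: "finite_cont_gset pi1 A"
      using that by (simp add: finite_gsets_def)
    obtain c :: "('u, 'a) space_over" where c: "is_finite_cover X c" "gset_isomorphic pi1_hat (on_ob (Fib X x) c) A"
      by (rule Fib_essentially_surjective[OF assms A])
    then obtain f where "iso_arr (finite_gsets pi1) (on_ob (Fib X x) c) A f"
      using iso_arr_finite_gsets[OF finite_cont_gset_Fib[OF c(1)] A] by (auto simp: gset_isomorphic_def)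
    then show ?thesis
      using c(1) by (intro bexI[of _ c] exI) (auto simp: finite_covers_def)
  qed
qed

text \<open>Connected means path connected here. A path in \<open>Y\<close> between points of the
  fibre projects to a loop whose class moves one to the other; conversely, arbitrary points are
  first joined to the fibre by lifts. The empty cover fits in: the empty space counts as connected
  and its empty fibre as transitive.\<close>

lemma connected_iff_transitive:
  assumes c: "is_finite_cover X c"
  shows "connected_space (fst c) \<longleftrightarrow>
    transitive_action pi1_hat (fst (on_ob (Fib X x) c)) (snd (on_ob (Fib X x) c))"
proof -
  obtain Y p where Y: "c = (Y, p)"
    by (cases c)
  note cover = finite_cover_cover[OF c, unfolded Y]
  have "connected_space Y \<longleftrightarrow> path_connected_space Y"
    using locally_path_connected_cover[OF lpc cover] path_connected_eq_connected_space by blast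
  also have "\<dots> \<longleftrightarrow> (\<forall>s\<in>fibre c x. \<forall>t\<in>fibre c x. \<exists>a\<in>carrier pi1. monodromy c x a s = t)"
  proof (intro iffI ballI)
    fix s t assume pcY: "path_connected_space Y" and st: "s \<in> fibre c x" "t \<in> fibre c x"
    then obtain g where g: "pathin Y g" "g 0 = s" "g 1 = t"
      unfolding path_connected_space_def Y by (auto simp: fibre_def)
    then have "p \<circ> g \<in> loops X x"
      using pathin_compose[OF g(1) cover_continuous[OF cover]] st by (auto simp: loops_def fibre_def Y)
    moreover have "lifts_from_to (Y, p) (p \<circ> g) s t"
      using g by (auto simp: lifts_from_to_def)
    ultimately show "\<exists>a\<in>carrier pi1. monodromy c x a s = t"
      unfolding Y by (intro bexI[OF _ loop_class_in_carrier] monodromy_eq[OF cover])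
  next
    assume trans: "\<forall>s\<in>fibre c x. \<forall>t\<in>fibre c x. \<exists>a\<in>carrier pi1. monodromy c x a s = t"
    show "path_connected_space Y"
      unfolding path_connected_space_def
    proof (intro ballI)
      fix y z assume yz: "y \<in> topspace Y" "z \<in> topspace Y"
      obtain \<alpha> s where s: "s \<in> fibre (Y, p) x" "lifts_from_to (Y, p) \<alpha> s y"
        using yz(1) by (rule path_lift_from_fibre[OF pc x cover]) blast
      obtain \<beta> t where t: "t \<in> fibre (Y, p) x" "lifts_from_to (Y, p) \<beta> t z"
        using yz(2) by (rule path_lift_from_fibre[OF pc x cover]) blast
      obtain a where a: "a \<in> carrier pi1" "monodromy c x a s = t"
        using trans s(1) t(1) unfolding Y by blast
      obtain \<gamma> where \<gamma>: "\<gamma> \<in> loops X x" "a = loop_class X x \<gamma>"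
        using a(1) by (rule carrier_fundamental_groupE)
      have "lifts_from_to (Y, p) \<gamma> s t"
        using lifts_from_to_monodromy[OF cover \<gamma>(1) s(1)] a(2) unfolding \<gamma>(2) Y by simp
      then have "lifts_from_to (Y, p) (path_join (path_rev \<alpha>) (path_join \<gamma> \<beta>)) y z"
        using lifts_from_to_rev[OF s(2)] t(2) by (intro lifts_from_to_join)
      then show "\<exists>g. pathin Y g \<and> g 0 = y \<and> g 1 = z"
        by (auto simp: lifts_from_to_def)
    qed
  qed
  also have "\<dots> \<longleftrightarrow> transitive_action pi1_hat (fst (on_ob (Fib X x) c)) (snd (on_ob (Fib X x) c))"
    unfolding on_ob_Fib using completed_transitive_iff[OF finite_cover_action[OF c] finite_cover_fibre[OF c]] by simp
  finally show ?thesis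
    by (simp add: Y)
qed

text \<open>Galois means that automorphisms of the cover act transitively on fibres, and by full
  faithfulness these are the automorphisms of the finite set over \<open>x\<close>. A transitive
  action with transitive automorphisms is a coset space of a normal subgroup, which is open as a
  stabiliser of a continuous action.\<close>

lemma galois_iff_coset_space:
  assumes c: "is_finite_cover X c"
  shows "is_galois_cover X c \<longleftrightarrow>
    (\<exists>N. open_normal_subgroup pi1 N \<and> gset_isomorphic pi1_hat (on_ob (Fib X x) c) (coset_space pi1_hat N))"
proof -
  obtain Y p where Y: "c = (Y, p)"
    by (cases c)
  let ?F = "fibre c x"
  define \<phi> where "\<phi> = snd (on_ob (Fib X x) c)"
  interpret hat: group pi1_hat
    by (rule group_profinite_completion)
  note cover = finite_cover_cover[OF c, unfolded Y]
  have ob: "on_ob (Fib X x) c = (?F, \<phi>)"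
    by (simp add: \<phi>_def Fib_def)
  have act: "group_action pi1_hat ?F \<phi>"
    using Fib_action[OF c] by (simp add: ob)
  have trans_iff: "connected_space Y \<longleftrightarrow> (\<forall>s\<in>?F. \<forall>t\<in>?F. \<exists>g\<in>carrier pi1_hat. \<phi> g s = t)"
  proof -
    have "connected_space Y \<longleftrightarrow> transitive_action pi1_hat ?F \<phi>"
      using connected_iff_transitive[OF c] unfolding ob by (simp add: Y)
    then show ?thesis
      using act by (auto simp: transitive_action_def transitive_action_axioms_def)
  qed
  show ?thesis
  proof
    assume gal: "is_galois_cover X c"
    note gal' = gal[unfolded Y is_galois_cover_iff[OF cover]]
    then have "x \<in> p ` topspace Y"
      using x by simp
    then obtain s0 where s0: "s0 \<in> ?F"
      by (auto simp: fibre_def Y)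
    have trans: "\<exists>g\<in>carrier pi1_hat. \<phi> g s0 = s" if "s \<in> ?F" for s
      using gal' trans_iff s0 that by blast
    have aut: "\<exists>f\<in>equivariant_maps pi1_hat (?F, \<phi>) (?F, \<phi>). f s0 = s" if s: "s \<in> ?F" for s
    proof -
      have "s0 \<in> topspace Y" "s \<in> topspace Y" "p s0 = p s"
        using s s0 by (auto simp: fibre_def Y)
      then obtain f where f: "f \<in> carrier (cover_aut (Y, p))" "f s0 = s"
        using gal' by blast
      then have "restrict f ?F \<in> equivariant_maps pi1_hat (?F, \<phi>) (?F, \<phi>)"
        using cover_map_equivariant_Fib[OF c c, of f] unfolding cover_aut_iff ob by (simp add: Y)
      then show ?thesis
        using f(2) s0 by (intro bexI[of _ "restrict f ?F"]) auto
    qed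
    note N = hat.coset_space_of_regular_action[OF act s0 trans aut]
    have "openin (profinite_topology pi1) (stabilizer pi1_hat \<phi> s0)"
      using finite_cont_gset_Fib[OF c] s0 unfolding ob by (rule openin_stabilizer)
    then show "\<exists>N. open_normal_subgroup pi1 N \<and> gset_isomorphic pi1_hat (on_ob (Fib X x) c) (coset_space pi1_hat N)"
      using N unfolding open_normal_subgroup_def ob by blast
  next
    assume "\<exists>N. open_normal_subgroup pi1 N \<and> gset_isomorphic pi1_hat (on_ob (Fib X x) c) (coset_space pi1_hat N)"
    then obtain N where "N \<lhd> pi1_hat" "gset_isomorphic pi1_hat (?F, \<phi>) (coset_space pi1_hat N)"
      unfolding open_normal_subgroup_def ob by blast
    note regular = hat.regular_action_of_coset_space[OF this(1) act this(2)]
    have conn: "connected_space Y"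
      using trans_iff regular(2) by blast
    have surj: "p ` topspace Y = topspace X"
    proof -
      obtain s where "s \<in> topspace Y"
        using regular(1) by (auto simp: fibre_def Y)
      then show ?thesis
        by (rule cover_surjective[OF pc cover])
    qed
    \<comment> \<open>Points over an arbitrary point are moved along one path
      \<open>\<alpha>\<close> to points \<open>s\<close> and \<open>t\<close> over \<open>x\<close>;
      the extension of an automorphism of the fibre that takes \<open>s\<close> to \<open>t\<close>
      takes \<open>y\<close> to \<open>y'\<close>, since cover maps respect lifts.\<close>
    have deck: "\<exists>f\<in>cover_maps (Y, p) (Y, p). f y = y'"
      if y: "y \<in> topspace Y" "y' \<in> topspace Y" "p y = p y'" for y y'
    proof -
      obtain \<alpha> s where s: "pathin X \<alpha>" "\<alpha> 0 = x" "s \<in> fibre (Y, p) x" "lifts_from_to (Y, p) \<alpha> s y"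
        using y(1) by (rule path_lift_from_fibre[OF pc x cover]) blast
      have "\<alpha> 1 = p y'"
        using lifts_from_to_ends[OF s(4)] y(3) by simp
      then obtain t where t: "lifts_from_to (Y, p) (path_rev \<alpha>) y' t"
        using lifts_from_to_exists[OF cover pathin_rev[OF s(1)] y(2)] by auto
      have "t \<in> fibre (Y, p) x"
        using lifts_from_to_ends[OF t] s(2) by (simp add: fibre_def)
      then obtain f where f: "f \<in> equivariant_maps pi1_hat (?F, \<phi>) (?F, \<phi>)" "f s = t"
        using regular(3)[of s t] s(3) by (auto simp: Y)
      obtain F where F: "F \<in> cover_maps c c" "\<And>s. s \<in> ?F \<Longrightarrow> F s = f s"
        using equivariant_Fib_extends[OF c c, of f] f(1) unfolding ob by blast
      have "lifts_from_to (Y, p) \<alpha> t (F y)"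
        using lifts_from_to_map[OF F(1)[unfolded Y] s(4)] F(2)[of s] s(3) f(2) by (simp add: Y)
      moreover have "lifts_from_to (Y, p) \<alpha> t y'"
        using lifts_from_to_rev[OF t] by simp
      ultimately have "F y = y'"
        by (rule lifts_from_to_unique[OF cover])
      then show ?thesis
        using F(1) unfolding Y by blast
    qed
    \<comment> \<open>A cover map from \<open>y\<close> to \<open>y'\<close> and one back compose to
      a map that fixes \<open>y\<close>, which makes the first one invertible.\<close>
    have "\<exists>f\<in>carrier (cover_aut (Y, p)). f y = y'"
      if y: "y \<in> topspace Y" "y' \<in> topspace Y" "p y = p y'" for y y'
    proof -
      obtain f g where "f \<in> cover_maps (Y, p) (Y, p)" "f y = y'" "g \<in> cover_maps (Y, p) (Y, p)" "g y' = y"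
        using deck[OF y] deck[OF y(2,1) y(3)[symmetric]] by blast
      then show ?thesis
        using cover_aut_if_inverse_point[OF cover conn, of f g y] y(1) by blast
    qed
    then show "is_galois_cover X c"
      unfolding Y is_galois_cover_iff[OF cover] using conn surj by blast
  qed
qed

text \<open>The coset space is a continuous finite set with an action, so it is the fibre of some
  cover, and the criterion above recognises that cover as Galois.\<close>

lemma galois_cover_of_open_normal_subgroup:
  fixes \<iota> :: "'a \<times> nat \<Rightarrow> 'u"
  assumes "semilocally_simply_connected X" "inj_on \<iota> (topspace X \<times> UNIV)" and N: "open_normal_subgroup pi1 N"
  obtains c :: "('u, 'a) space_over" where "is_finite_cover X c" "is_galois_cover X c"
    "gset_isomorphic pi1_hat (on_ob (Fib X x) c) (coset_space pi1_hat N)"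
proof -
  obtain c :: "('u, 'a) space_over" where "is_finite_cover X c" "gset_isomorphic pi1_hat (on_ob (Fib X x) c) (coset_space pi1_hat N)"
    by (rule Fib_essentially_surjective[OF assms(1,2) finite_cont_gset_coset_space[OF N]])
  then show thesis
    using that galois_iff_coset_space N by blast
qed

end

theorem theorem1p5p4:
  fixes X :: "'a topology" and x :: 'a and \<iota> :: "'a \<times> nat \<Rightarrow> 'u"
  assumes "connected_space X"
    and "locally_path_connected_space X"
    and "semilocally_simply_connected X"
    and "x \<in> topspace X"
    \<comment> \<open>The universe \<open>'u\<close> of points is large enough to contain finite covers of all degrees.\<close>
    and "inj_on \<iota> (topspace X \<times> UNIV)"
  shows
    "is_equivalence (finite_covers X :: (('u, 'a) space_over, 'u \<Rightarrow> 'u) cat)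
       (finite_gsets (fundamental_group X x)) (Fib X x)
     \<and> (\<forall>c :: ('u, 'a) space_over. is_finite_cover X c \<longrightarrow>
          (connected_space (fst c) \<longleftrightarrow>
           transitive_action (profinite_completion (fundamental_group X x))
             (fst (on_ob (Fib X x) c)) (snd (on_ob (Fib X x) c))))
     \<and> (\<forall>c :: ('u, 'a) space_over. is_finite_cover X c \<longrightarrow>
          (is_galois_cover X c \<longleftrightarrow>
           (\<exists>N. open_normal_subgroup (fundamental_group X x) N \<and>
              gset_isomorphic (profinite_completion (fundamental_group X x))
                (on_ob (Fib X x) c) (coset_space (profinite_completion (fundamental_group X x)) N))))
     \<and> (\<forall>N. open_normal_subgroup (fundamental_group X x) N \<longrightarrow>
          (\<exists>c :: ('u, 'a) space_over. is_finite_cover X c \<and> is_galois_cover X c \<and>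
              gset_isomorphic (profinite_completion (fundamental_group X x))
                (on_ob (Fib X x) c) (coset_space (profinite_completion (fundamental_group X x)) N)))"
proof -
  have pc: "path_connected_space X"
    using assms(1,2) path_connected_eq_connected_space by blast
  note hyps = pc assms(2,4)
  show ?thesis
    by (intro conjI allI impI is_equivalence_Fib[OF hyps assms(3,5)] connected_iff_transitive[OF hyps]
        galois_iff_coset_space[OF hyps], assumption+)
      (rule galois_cover_of_open_normal_subgroup[OF hyps assms(3,5)], assumption, blast)
qed

end
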